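(* Let $q$ be a prime power and let $P\in\mathbb{F}_q[x,y,z]$ be a polynomial of the form $$P(x,y,z) = F(x,G(y,z))+H(y,z)+J(x),$$ where $F,G,H$ are polynomials in two variables over $\mathbb{F}_q$ and $J\in \mathbb{F}_q[x]$ are such that: (i) $F$ is non-diagonal and symmetric with $\deg(F)<\mathrm{char}(\mathbb{F}_q)$, and (ii) $G$ and $H$ are algebraically independent. Then there exists a constant $C = C_{\deg(P)}$, depending only on $\deg(P)$, such that if $X,Y,Z\subseteq\mathbb{F}_q$ and $|X|,|Y|,|Z|\geq Cq^{1/2}$ then $$|P(X,Y,Z)| = q-O_{\deg(P)}\left(\frac{q^{11/3}}{|X|\cdot|Y|\cdot|Z|}\right).$$
   Context: For $X,Y,Z \subseteq \mathbb{F}_q$, $P(X,Y,Z) := \{P(x,y,z) : x\in X, y \in Y, z \in Z\}$. A polynomial $F$ in two variables is symmetric if $F(a,x) = F(x,a)$. It is diagonal if it has the form $f(a)+g(x)$ for single-variable polynomials $f,g$ (i.e. no monomial involving both variables occurs with non-zero coefficient), and non-diagonal otherwise. $\deg$ denotes total degree. The notation $A = q - O_{\deg(P)}(E)$ means $|A-q| \le C' E$ for some constant $C'>0$ depending only on $\deg(P)$ (in particular not on $q$, $X$, $Y$, $Z$). *)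

theory Defs
  imports Complex_Main "HOL-Algebra.UnivPoly"
begin

text \<open>
  A finite field is a HOL-Algebra structure \<open>R\<close>, so that the constants of the theorem can be
  quantified before the field; \<open>q = order R\<close>.  The type of the elements of \<open>R\<close> is arbitrary.
  At an infinite type such as \<open>nat\<close>, a single instance of the theorem covers every finite field up
  to isomorphism, with constants depending on the degree alone.

  Polynomials in several variables are iterated univariate polynomials.  The first variable is the
  innermost one: the coefficient of \<open>x\<^sup>i y\<^sup>j z\<^sup>k\<close> in \<open>p\<close> is obtained by taking
  the \<open>k\<close>-th, then the \<open>j\<close>-th, then the \<open>i\<close>-th coefficient of \<open>p\<close>.
\<close>

abbreviation UP2 where "UP2 R \<equiv> UP (UP R)"
abbreviation UP3 where "UP3 R \<equiv> UP (UP2 R)"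

definition coeff2 :: "('a, 'm) ring_scheme \<Rightarrow> (nat \<Rightarrow> nat \<Rightarrow> 'a) \<Rightarrow> nat \<Rightarrow> nat \<Rightarrow> 'a" where
  "coeff2 R p i j = coeff (UP R) (coeff (UP2 R) p j) i"

definition coeff3 ::
  "('a, 'm) ring_scheme \<Rightarrow> (nat \<Rightarrow> nat \<Rightarrow> nat \<Rightarrow> 'a) \<Rightarrow> nat \<Rightarrow> nat \<Rightarrow> nat \<Rightarrow> 'a" where
  "coeff3 R p i j k = coeff2 R (coeff (UP3 R) p k) i j"

text \<open>Total degrees; the zero polynomial gets degree \<open>0\<close>, as for \<^const>\<open>deg\<close>.\<close>

definition total_deg2 :: "('a, 'm) ring_scheme \<Rightarrow> (nat \<Rightarrow> nat \<Rightarrow> 'a) \<Rightarrow> nat" where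
  "total_deg2 R p = Max (insert 0 {i + j | i j. coeff2 R p i j \<noteq> \<zero>\<^bsub>R\<^esub>})"

definition total_deg3 :: "('a, 'm) ring_scheme \<Rightarrow> (nat \<Rightarrow> nat \<Rightarrow> nat \<Rightarrow> 'a) \<Rightarrow> nat" where
  "total_deg3 R p = Max (insert 0 {i + j + k | i j k. coeff3 R p i j k \<noteq> \<zero>\<^bsub>R\<^esub>})"

definition const2 :: "('a, 'm) ring_scheme \<Rightarrow> 'a \<Rightarrow> (nat \<Rightarrow> nat \<Rightarrow> 'a)" where
  "const2 R a = monom (UP2 R) (monom (UP R) a 0) 0"

definition const3 :: "('a, 'm) ring_scheme \<Rightarrow> 'a \<Rightarrow> (nat \<Rightarrow> nat \<Rightarrow> nat \<Rightarrow> 'a)" where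
  "const3 R a = monom (UP3 R) (const2 R a) 0"

definition X2 :: "('a, 'm) ring_scheme \<Rightarrow> (nat \<Rightarrow> nat \<Rightarrow> 'a)" where
  "X2 R = monom (UP2 R) (monom (UP R) \<one>\<^bsub>R\<^esub> 1) 0"

definition Y2 :: "('a, 'm) ring_scheme \<Rightarrow> (nat \<Rightarrow> nat \<Rightarrow> 'a)" where
  "Y2 R = monom (UP2 R) \<one>\<^bsub>UP R\<^esub> 1"

definition X3 :: "('a, 'm) ring_scheme \<Rightarrow> (nat \<Rightarrow> nat \<Rightarrow> nat \<Rightarrow> 'a)" where
  "X3 R = monom (UP3 R) (X2 R) 0"

definition Y3 :: "('a, 'm) ring_scheme \<Rightarrow> (nat \<Rightarrow> nat \<Rightarrow> nat \<Rightarrow> 'a)" where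
  "Y3 R = monom (UP3 R) (Y2 R) 0"

definition Z3 :: "('a, 'm) ring_scheme \<Rightarrow> (nat \<Rightarrow> nat \<Rightarrow> nat \<Rightarrow> 'a)" where
  "Z3 R = monom (UP3 R) \<one>\<^bsub>UP2 R\<^esub> 1"

text \<open>
  Substitution of elements of a commutative ring \<open>S\<close> for the variables, the coefficients being
  mapped by the ring homomorphism \<open>h\<close> from \<open>R\<close> to \<open>S\<close>.
\<close>

definition eval2 ::
  "('a, 'm) ring_scheme \<Rightarrow> ('b, 'n) ring_scheme \<Rightarrow> ('a \<Rightarrow> 'b) \<Rightarrow> 'b \<Rightarrow> 'b \<Rightarrow> (nat \<Rightarrow> nat \<Rightarrow> 'a) \<Rightarrow> 'b" where
  "eval2 R S h a b = eval (UP R) S (eval R S h a) b"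

definition eval3 ::
  "('a, 'm) ring_scheme \<Rightarrow> ('b, 'n) ring_scheme \<Rightarrow> ('a \<Rightarrow> 'b) \<Rightarrow> 'b \<Rightarrow> 'b \<Rightarrow> 'b
    \<Rightarrow> (nat \<Rightarrow> nat \<Rightarrow> nat \<Rightarrow> 'a) \<Rightarrow> 'b" where
  "eval3 R S h a b c = eval (UP2 R) S (eval2 R S h a b) c"

definition value_set3 ::
  "('a, 'm) ring_scheme \<Rightarrow> (nat \<Rightarrow> nat \<Rightarrow> nat \<Rightarrow> 'a) \<Rightarrow> 'a set \<Rightarrow> 'a set \<Rightarrow> 'a set \<Rightarrow> 'a set" where
  "value_set3 R P X Y Z = {eval3 R R id x y z P | x y z. x \<in> X \<and> y \<in> Y \<and> z \<in> Z}"

definition symmetric2 :: "('a, 'm) ring_scheme \<Rightarrow> (nat \<Rightarrow> nat \<Rightarrow> 'a) \<Rightarrow> bool" where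
  "symmetric2 R F \<longleftrightarrow>
    eval2 R (UP2 R) (const2 R) (X2 R) (Y2 R) F = eval2 R (UP2 R) (const2 R) (Y2 R) (X2 R) F"

definition diagonal2 :: "('a, 'm) ring_scheme \<Rightarrow> (nat \<Rightarrow> nat \<Rightarrow> 'a) \<Rightarrow> bool" where
  "diagonal2 R F \<longleftrightarrow> (\<exists>f \<in> carrier (UP R). \<exists>g \<in> carrier (UP R).
     F = eval R (UP2 R) (const2 R) (X2 R) f \<oplus>\<^bsub>UP2 R\<^esub> eval R (UP2 R) (const2 R) (Y2 R) g)"

definition alg_independent2 ::
  "('a, 'm) ring_scheme \<Rightarrow> (nat \<Rightarrow> nat \<Rightarrow> 'a) \<Rightarrow> (nat \<Rightarrow> nat \<Rightarrow> 'a) \<Rightarrow> bool" where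
  "alg_independent2 R G H \<longleftrightarrow> (\<forall>Q \<in> carrier (UP2 R).
     eval2 R (UP2 R) (const2 R) G H Q = \<zero>\<^bsub>UP2 R\<^esub> \<longrightarrow> Q = \<zero>\<^bsub>UP2 R\<^esub>)"

definition ring_char :: "('a, 'm) ring_scheme \<Rightarrow> nat" where
  "ring_char R =
    (if \<exists>n::nat. 0 < n \<and> [n] \<cdot>\<^bsub>R\<^esub> \<one>\<^bsub>R\<^esub> = \<zero>\<^bsub>R\<^esub>
     then LEAST n::nat. 0 < n \<and> [n] \<cdot>\<^bsub>R\<^esub> \<one>\<^bsub>R\<^esub> = \<zero>\<^bsub>R\<^esub> else 0)"

definition composite_poly ::
  "('a, 'm) ring_scheme \<Rightarrow> (nat \<Rightarrow> nat \<Rightarrow> 'a) \<Rightarrow> (nat \<Rightarrow> nat \<Rightarrow> 'a) \<Rightarrow> (nat \<Rightarrow> nat \<Rightarrow> 'a)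
    \<Rightarrow> (nat \<Rightarrow> 'a) \<Rightarrow> (nat \<Rightarrow> nat \<Rightarrow> nat \<Rightarrow> 'a)" where
  "composite_poly R F G H J =
     eval2 R (UP3 R) (const3 R) (X3 R) (eval2 R (UP3 R) (const3 R) (Y3 R) (Z3 R) G) F
     \<oplus>\<^bsub>UP3 R\<^esub> eval2 R (UP3 R) (const3 R) (Y3 R) (Z3 R) H
     \<oplus>\<^bsub>UP3 R\<^esub> eval R (UP3 R) (const3 R) (X3 R) J"

end

theory Submission
  imports Defs "HOL-Algebra.Algebraic_Closure_Type" "HOL-Analysis.Analysis" "HOL-Number_Theory.Cong"
begin

text \<open>
  Let \<open>f\<close> be the part of \<open>F\<close> made up of the monomials containing both variables.  With \<open>a = G(y, z)\<close> and
  \<open>b = H(y, z) + F(0, G(y, z)) + J(0)\<close>, the value \<open>P(x, y, z)\<close> is \<open>f(x, a) + b + J'(x)\<close> for a function \<open>J'\<close>.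
  The polynomial \<open>b\<close> is a coefficient of \<open>P\<close> with respect to \<open>x\<close>, so its degree is at most \<open>d\<close>, and it is
  algebraically independent of \<open>G\<close>; hence \<open>(y, z) \<mapsto> (a, b)\<close> has bounded fibres outside a curve of bounded
  degree, and the set \<open>Q\<close> of the pairs \<open>(a, b)\<close> has size at least a constant times \<open>|Y| |Z|\<close>.
  If \<open>W\<close> is the set of missed values, the number of solutions of \<open>f(x, a) + b + J'(x) = w\<close> with \<open>w \<in> W\<close>
  is zero.  Expanding it in additive characters and applying the Cauchy--Schwarz inequality twice reduces
  \<open>|X| |Q| |W| \<le> 2 d q\<^sup>7\<^sup>/\<^sup>2\<close> to bounds for the sums of \<open>\<psi>(f(x, a) - f(x', a))\<close> over all \<open>a\<close>.
  These are Weil sums, as \<open>deg F\<close> is less than the characteristic.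

  For the Weil bound, Newton's identities show that the exponential sums over the extensions of the field
  are, up to sign, the power sums of the inverse roots of a polynomial of bounded degree.  Stepanov's method, applied to the curves
  \<open>y\<^sup>q - y = f(x) - w\<close> over the extensions of even degree, bounds the growth of these sums, and hence
  the absolute value of each inverse root by \<open>q\<^sup>1\<^sup>/\<^sup>2\<close>.
\<close>

text \<open>The constants may depend on deg P only, but F, H and J can have larger degrees than P,
  since parts of H(y, z), F(0, G(y, z)), F(x, 0) and J(x) may cancel. This is why H is replaced by
  b. The degrees of G and of f are read off from the coefficients of P at positive powers of x: H
  does not occur there, and different powers of G cannot cancel each other.

  Extensions of even degree have r^2 elements, where r is a power of q, and on them the r-th power
  map is its own inverse. This lets the auxiliary function be an r-th root, at the points to be
  counted, of a function vanishing on the whole curve. The method bounds numbers of points only from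
  above. That is enough, because the curves for all w together have a known number of points. Even
  degrees are enough as well: for L(z), the polynomial whose logarithmic derivative generates the
  exponential sums, the logarithmic derivative of L(z) L(-z) involves only the sums of even index,
  and zeros of L are zeros of this product.

  The coefficients of L are sums over Frobenius-stable multisets. They vanish from deg f on, because
  translating one coefficient of a monic polynomial multiplies such a sum by a number other than
  1.\<close>

no_notation var (\<open>X\<index>\<close>)
hide_const (open) Polynomial.order

section \<open>Multisets stable under an injective map\<close>

text \<open>Points are counted with multiplicity: when \<open>k\<close> is \<open>j\<close> times
  the period of \<open>x\<close>, every point of the cycle occurs \<open>j\<close> times.\<close>

definition orbit_mset :: "('b \<Rightarrow> 'b) \<Rightarrow> nat \<Rightarrow> 'b \<Rightarrow> 'b multiset" where
  "orbit_mset \<phi> k x = image_mset (\<lambda>i. (\<phi> ^^ i) x) (mset_set {..<k})"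

lemma size_orbit_mset [simp]: "size (orbit_mset \<phi> k x) = k"
  by (simp add: orbit_mset_def)

lemma orbit_mset_Suc: "orbit_mset \<phi> (Suc k) x = add_mset ((\<phi> ^^ k) x) (orbit_mset \<phi> k x)"
  by (simp add: orbit_mset_def lessThan_Suc)

lemma orbit_mset_add: "orbit_mset \<phi> (j + k) x = orbit_mset \<phi> j x + orbit_mset \<phi> k ((\<phi> ^^ j) x)"
proof (induction k)
  case (Suc k)
  have "(\<phi> ^^ (j + k)) x = (\<phi> ^^ k) ((\<phi> ^^ j) x)"
    by (metis add.commute comp_apply funpow_add)
  with Suc show ?case by (simp add: orbit_mset_Suc)
qed (simp add: orbit_mset_def)

lemma image_orbit_mset:
  assumes "(\<phi> ^^ k) x = x"
  shows "image_mset \<phi> (orbit_mset \<phi> k x) = orbit_mset \<phi> k x"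
proof -
  have "add_mset x (image_mset \<phi> (orbit_mset \<phi> k x)) = orbit_mset \<phi> (1 + k) x" for k
    by (induction k) (auto simp: orbit_mset_def lessThan_Suc)
  also have "orbit_mset \<phi> (1 + k) x = add_mset x (orbit_mset \<phi> k x)"
    using assms by (simp add: orbit_mset_Suc)
  finally show ?thesis by simp
qed

lemma funpow_fixed_mult: "(\<phi> ^^ n) x = x \<Longrightarrow> (\<phi> ^^ (n * j)) x = x"
  by (induction j) (auto simp: funpow_add)

text \<open>By injectivity \<open>y\<close> is the only preimage of \<open>\<phi> y\<close>, so its
  multiplicity in \<open>D\<close> becomes the multiplicity of \<open>\<phi> y\<close> in the image,
  which is \<open>D\<close> again.\<close>

lemma stable_mset_count:
  assumes "inj \<phi>" "image_mset \<phi> D = D"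
  shows "count D ((\<phi> ^^ i) x) = count D x"
proof (induction i)
  case (Suc i)
  have "count D (\<phi> y) = count D y" for y
    by (subst (1) assms(2)[symmetric]) (use assms(1) in \<open>cases "y \<in># D"; simp add: count_image_mset vimage_def inj_eq not_in_iff\<close>)
  with Suc show ?case by simp
qed simp

text \<open>All iterates of \<open>x\<close> stay in the support of \<open>D\<close>, so two of the
  first \<open>size D + 1\<close> iterates coincide; injectivity cancels the steps that they
  share.\<close>

lemma stable_mset_periodic:
  assumes "inj \<phi>" "image_mset \<phi> D = D" "x \<in># D"
  obtains n where "1 \<le> n" "n \<le> size D" "(\<phi> ^^ n) x = x"
proof -
  have "(\<lambda>i. (\<phi> ^^ i) x) ` {..size D} \<subseteq> set_mset D"
    using stable_mset_count[OF assms(1,2)] assms(3) by (auto simp flip: count_greater_zero_iff)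
  then have "card ((\<lambda>i. (\<phi> ^^ i) x) ` {..size D}) \<le> card (set_mset D)"
    by (rule card_mono[rotated]) simp
  also have "\<dots> = (\<Sum>y\<in>set_mset D. 1)" by simp
  also have "\<dots> \<le> size D"
    unfolding size_multiset_overloaded_eq by (intro sum_mono) (simp add: Suc_le_eq)
  finally have "\<not> inj_on (\<lambda>i. (\<phi> ^^ i) x) {..size D}"
    by (intro pigeonhole) simp
  then obtain i j where ij: "i < j" "j \<le> size D" "(\<phi> ^^ i) x = (\<phi> ^^ j) x"
    using linorder_inj_onI'[of "{..size D}" "\<lambda>i. (\<phi> ^^ i) x"] by auto
  then have "(\<phi> ^^ i) x = (\<phi> ^^ i) ((\<phi> ^^ (j - i)) x)"
    by (metis comp_apply funpow_add le_add_diff_inverse less_imp_le_nat)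
  then have "(\<phi> ^^ (j - i)) x = x"
    by (simp add: inj_eq[OF inj_fn[OF assms(1)]])
  then show thesis using ij that[of "j - i"] by auto
qed

text \<open>The admissible lengths are multiples \<open>\<delta> * j\<close> of the period. A walk
  of that length consists of \<open>j\<close> copies of a cycle of distinct points, and it fits into
  \<open>D\<close> exactly when \<open>j\<close> is at most the multiplicity of \<open>x\<close>,
  which is constant along the cycle.\<close>

lemma card_orbits_through:
  assumes "inj \<phi>" "image_mset \<phi> D = D" "x \<in># D"
  shows "card {k. 1 \<le> k \<and> (\<phi> ^^ k) x = x \<and> orbit_mset \<phi> k x \<subseteq># D} = count D x"
proof -
  define \<delta> where "\<delta> = (LEAST n. 1 \<le> n \<and> (\<phi> ^^ n) x = x)"
  obtain n where "1 \<le> n" "(\<phi> ^^ n) x = x"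
    using stable_mset_periodic[OF assms] by blast
  then have \<delta>: "1 \<le> \<delta> \<and> (\<phi> ^^ \<delta>) x = x"
    unfolding \<delta>_def by (intro LeastI) auto
  have least: "\<delta> \<le> n" if "1 \<le> n" "(\<phi> ^^ n) x = x" for n
    unfolding \<delta>_def using that by (intro Least_le) auto
  have dvd: "(\<phi> ^^ k) x = x \<longleftrightarrow> \<delta> dvd k" for k
  proof
    assume k: "(\<phi> ^^ k) x = x"
    have "(\<phi> ^^ k) x = (\<phi> ^^ (k mod \<delta>)) ((\<phi> ^^ (\<delta> * (k div \<delta>))) x)"
      by (metis comp_apply funpow_add mod_mult_div_eq mult.commute add.commute)
    then have "(\<phi> ^^ (k mod \<delta>)) x = x"
      using \<delta> k by (simp add: funpow_fixed_mult)
    then have "k mod \<delta> = 0"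
      using least[of "k mod \<delta>"] \<delta> mod_less_divisor[of \<delta> k] by linarith
    then show "\<delta> dvd k" by auto
  next
    assume "\<delta> dvd k" then show "(\<phi> ^^ k) x = x"
      using \<delta> by (auto simp: dvd_def funpow_fixed_mult)
  qed
  have inj: "inj_on (\<lambda>i. (\<phi> ^^ i) x) {..<\<delta>}"
  proof (rule linorder_inj_onI')
    fix i j assume ij: "i \<in> {..<\<delta>}" "j \<in> {..<\<delta>}" "i < j"
    show "(\<phi> ^^ i) x \<noteq> (\<phi> ^^ j) x"
    proof
      assume "(\<phi> ^^ i) x = (\<phi> ^^ j) x"
      then have "(\<phi> ^^ i) x = (\<phi> ^^ i) ((\<phi> ^^ (j - i)) x)"
        using ij by (metis comp_apply funpow_add le_add_diff_inverse less_imp_le_nat)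
      then have "(\<phi> ^^ (j - i)) x = x"
        by (simp add: inj_eq[OF inj_fn[OF assms(1)]])
      moreover have "1 \<le> j - i" using ij by auto
      ultimately have "\<delta> \<le> j - i" by (intro least)
      then show False using ij by auto
    qed
  qed
  have cnt: "count (orbit_mset \<phi> \<delta> x) y = (if y \<in> (\<lambda>i. (\<phi> ^^ i) x) ` {..<\<delta>} then 1 else 0)" for y
    unfolding orbit_mset_def using inj by (simp add: image_mset_mset_set)
  have rep: "orbit_mset \<phi> (\<delta> * j) x = repeat_mset j (orbit_mset \<phi> \<delta> x)" for j
  proof (induction j)
    case (Suc j)
    have "orbit_mset \<phi> (\<delta> * Suc j) x = orbit_mset \<phi> (\<delta> * j + \<delta>) x" by (simp add: add.commute)
    also have "\<dots> = orbit_mset \<phi> (\<delta> * j) x + orbit_mset \<phi> \<delta> x"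
      using \<delta> by (subst orbit_mset_add) (simp add: funpow_fixed_mult)
    finally show ?case using Suc by simp
  qed (simp add: orbit_mset_def)
  have sub: "orbit_mset \<phi> (\<delta> * j) x \<subseteq># D \<longleftrightarrow> j \<le> count D x" for j
  proof
    assume "orbit_mset \<phi> (\<delta> * j) x \<subseteq># D"
    then have "count (repeat_mset j (orbit_mset \<phi> \<delta> x)) x \<le> count D x"
      unfolding rep by (rule mset_subset_eq_count)
    moreover have "x \<in> (\<lambda>i. (\<phi> ^^ i) x) ` {..<\<delta>}"
      using \<delta> by (intro image_eqI[of _ _ 0]) auto
    ultimately show "j \<le> count D x" using cnt[of x] by simp
  next
    assume "j \<le> count D x"
    then show "orbit_mset \<phi> (\<delta> * j) x \<subseteq># D"
      using stable_mset_count[OF assms(1,2)] by (auto simp: rep subseteq_mset_def cnt)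
  qed
  have "{k. 1 \<le> k \<and> (\<phi> ^^ k) x = x \<and> orbit_mset \<phi> k x \<subseteq># D} = (\<lambda>j. \<delta> * j) ` {1..count D x}"
  proof (intro equalityI subsetI)
    fix k assume "k \<in> {k. 1 \<le> k \<and> (\<phi> ^^ k) x = x \<and> orbit_mset \<phi> k x \<subseteq># D}"
    then obtain j where "k = \<delta> * j" "1 \<le> k" "orbit_mset \<phi> (\<delta> * j) x \<subseteq># D"
      using dvd by (auto simp: dvd_def)
    then have "k = \<delta> * j" "j \<in> {1..count D x}" using sub by (auto intro!: Suc_leI)
    then show "k \<in> (\<lambda>j. \<delta> * j) ` {1..count D x}" by (rule image_eqI)
  next
    fix k assume "k \<in> (\<lambda>j. \<delta> * j) ` {1..count D x}"
    then show "k \<in> {k. 1 \<le> k \<and> (\<phi> ^^ k) x = x \<and> orbit_mset \<phi> k x \<subseteq># D}"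
      using sub dvd \<delta> by auto
  qed
  moreover have "card ((\<lambda>j. \<delta> * j) ` {1..count D x}) = count D x"
    using \<delta> by (subst card_image) (auto simp: inj_on_def)
  ultimately show ?thesis by simp
qed

text \<open>The pairs mark the ways of splitting a closed walk off \<open>D\<close>. Their number
  becomes the factor \<open>n\<close> on the left of \<open>a_recursion\<close>.\<close>

definition orbits_in :: "('b \<Rightarrow> 'b) \<Rightarrow> 'b multiset \<Rightarrow> (nat \<times> 'b) set" where
  "orbits_in \<phi> D = {(k, x). 1 \<le> k \<and> (\<phi> ^^ k) x = x \<and> orbit_mset \<phi> k x \<subseteq># D}"

lemma orbits_in_bounds:
  assumes "(k, x) \<in> orbits_in \<phi> D"
  shows "k \<le> size D" "x \<in># D"
proof -
  have k: "1 \<le> k" "orbit_mset \<phi> k x \<subseteq># D" using assms by (auto simp: orbits_in_def)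
  show "k \<le> size D" using size_mset_mono[OF k(2)] by simp
  have "x \<in># orbit_mset \<phi> k x"
    using k by (auto simp: orbit_mset_def intro!: image_eqI[of _ _ 0])
  then show "x \<in># D" using k(2) by (rule mset_subset_eqD[rotated])
qed

lemma card_orbits_in:
  assumes "inj \<phi>" "image_mset \<phi> D = D"
  shows "finite (orbits_in \<phi> D)" "card (orbits_in \<phi> D) = size D"
proof -
  let ?A = "\<lambda>x. {k. 1 \<le> k \<and> (\<phi> ^^ k) x = x \<and> orbit_mset \<phi> k x \<subseteq># D}"
  have "orbits_in \<phi> D \<subseteq> {..size D} \<times> set_mset D"
    by (auto dest: orbits_in_bounds)
  then show "finite (orbits_in \<phi> D)" by (rule finite_subset) simp
  have fin: "finite (?A x)" for x
  proof (rule finite_subset)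
    show "?A x \<subseteq> {..size D}" using size_mset_mono[of "orbit_mset \<phi> _ x" D] by auto
  qed simp
  have "orbits_in \<phi> D = prod.swap ` Sigma (set_mset D) ?A"
  proof (intro equalityI subsetI)
    fix z assume z: "z \<in> orbits_in \<phi> D"
    then show "z \<in> prod.swap ` Sigma (set_mset D) ?A"
      using orbits_in_bounds(2)[of "fst z" "snd z" \<phi> D]
      by (intro image_eqI[of _ _ "prod.swap z"]) (cases z; auto simp: orbits_in_def)+
  qed (auto simp: orbits_in_def)
  then have "card (orbits_in \<phi> D) = card (Sigma (set_mset D) ?A)"
    by (simp add: card_image)
  also have "\<dots> = (\<Sum>x\<in>set_mset D. card (?A x))"
    using fin by simp
  also have "\<dots> = (\<Sum>x\<in>set_mset D. count D x)"
    using card_orbits_through[OF assms] by (intro sum.cong) auto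
  finally show "card (orbits_in \<phi> D) = size D" by (simp add: size_multiset_overloaded_eq)
qed

section \<open>Newton's identities\<close>

definition mset_poly :: "'b :: idom multiset \<Rightarrow> 'b poly" where
  "mset_poly D = (\<Prod>x\<in>#D. [:-x, 1:])"

lemma mset_poly_monic: "lead_coeff (mset_poly D) = 1" "degree (mset_poly D) = size D"
proof -
  have "lead_coeff (mset_poly D) = 1 \<and> degree (mset_poly D) = size D"
  proof (induction D)
    case (add x D)
    then have "mset_poly D \<noteq> 0" by auto
    with add show ?case
      unfolding mset_poly_def image_mset_add_mset prod_mset.add_mset
      by (subst lead_coeff_mult, subst degree_mult_eq) auto
  qed (simp add: mset_poly_def)
  then show "lead_coeff (mset_poly D) = 1" "degree (mset_poly D) = size D" by auto
qed

lemma mset_poly_nonzero [simp]: "mset_poly D \<noteq> 0"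
  using mset_poly_monic(1)[of D] by auto

lemma proots_mset_poly [simp]: "proots (mset_poly D) = D"
proof (induction D)
  case (add x D)
  have "mset_poly (add_mset x D) = [:-x, 1:] * mset_poly D"
    by (simp add: mset_poly_def)
  with add show ?case by (simp add: proots_mult del: mult_pCons_left)
qed (simp add: mset_poly_def)

lemma mset_poly_proots:
  fixes p :: "'b :: alg_closed_field poly"
  assumes "lead_coeff p = 1"
  shows "mset_poly (proots p) = p" "size (proots p) = degree p"
proof -
  have "p \<noteq> 0" using assms by auto
  then obtain A where "size A = degree p" "p = smult (lead_coeff p) (\<Prod>x\<in>#A. [:-x, 1:])"
    using alg_closed_imp_factorization by blast
  then have A: "size A = degree p" "p = mset_poly A"
    using assms by (auto simp: mset_poly_def)
  then have "proots p = A" by (metis proots_mset_poly)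
  with A show "mset_poly (proots p) = p" "size (proots p) = degree p" by auto
qed

text \<open>The reciprocal polynomial of \<open>mset_poly D\<close>, taken as a power series because
  its logarithmic derivative generates the power sums.\<close>

definition mset_fps :: "'b :: idom multiset \<Rightarrow> 'b fps" where
  "mset_fps D = (\<Prod>x\<in>#D. 1 - fps_const x * fps_X)"

lemma mset_fps_nth:
  "k \<le> size D \<Longrightarrow> fps_nth (mset_fps D) k = poly.coeff (mset_poly D) (size D - k)"
  "k > size D \<Longrightarrow> fps_nth (mset_fps D) k = 0"
proof -
  have "fps_nth (mset_fps D) k = (if k \<le> size D then poly.coeff (mset_poly D) (size D - k) else 0)"
  proof (induction D arbitrary: k)
    case empty
    then show ?case by (auto simp: mset_fps_def mset_poly_def)
  next
    case (add x D)
    have top: "poly.coeff (mset_poly D) (Suc (size D)) = 0"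
      by (intro coeff_eq_0) (simp add: mset_poly_monic)
    have eq: "mset_fps (add_mset x D) = mset_fps D - fps_const x * (fps_X * mset_fps D)"
      "mset_poly (add_mset x D) = [:-x, 1:] * mset_poly D"
      by (simp_all add: mset_fps_def mset_poly_def algebra_simps)
    show ?case
    proof (cases k)
      case 0
      then show ?thesis using add[of 0] top
        by (simp add: eq coeff_pCons del: mult_pCons_left) (simp add: coeff_pCons)
    next
      case (Suc j)
      show ?thesis
      proof (cases "j < size D")
        case True
        then have "Suc (size D) - k = Suc (size D - k)" using Suc by auto
        then show ?thesis using Suc True add[of k] add[of j]
          by (simp add: eq coeff_pCons Suc_diff_Suc) (simp add: Suc_diff_Suc[symmetric])
      next
        case False
        then show ?thesis using Suc add[of k] add[of j]
          by (auto simp: eq coeff_pCons)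
      qed
    qed
  qed
  then show "k \<le> size D \<Longrightarrow> fps_nth (mset_fps D) k = poly.coeff (mset_poly D) (size D - k)"
    "k > size D \<Longrightarrow> fps_nth (mset_fps D) k = 0" by auto
qed

definition power_sum :: "nat \<Rightarrow> 'b :: comm_semiring_1 multiset \<Rightarrow> 'b" where
  "power_sum k D = (\<Sum>x\<in>#D. x ^ k)"

text \<open>Logarithmic differentiation of the product: a factor 1 - x T contributes -x / (1 - x T),
  a geometric series whose coefficients are powers of x.\<close>

lemma fps_deriv_mset_fps:
  "fps_deriv (mset_fps D) = - (mset_fps D * Abs_fps (\<lambda>k. power_sum (Suc k) D))"
proof (induction D)
  case (add x D)
  define A where "A = 1 - fps_const x * fps_X"
  define B where "B = Abs_fps (\<lambda>k. x ^ Suc k)"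
  define P where "P = Abs_fps (\<lambda>k. power_sum (Suc k) D)"
  have AB: "A * B = fps_const x"
  proof (rule fps_ext)
    fix k show "fps_nth (A * B) k = fps_nth (fps_const x) k"
      by (cases k) (simp_all add: A_def B_def left_diff_distrib mult.assoc)
  qed
  have P: "Abs_fps (\<lambda>k. power_sum (Suc k) (add_mset x D)) = B + P"
    by (rule fps_ext) (simp add: power_sum_def B_def P_def)
  have M: "mset_fps (add_mset x D) = A * mset_fps D"
    by (simp add: mset_fps_def A_def)
  have "fps_deriv A = - fps_const x"
    by (simp add: A_def)
  then have "fps_deriv (A * mset_fps D) = - (A * B) * mset_fps D - A * (mset_fps D * P)"
    using add by (simp add: AB P_def)
  then show ?case
    unfolding M P by (simp add: algebra_simps)
qed (simp_all add: mset_fps_def power_sum_def fps_zero_def[symmetric])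

text \<open>Coefficient \<open>k - 1\<close> of the logarithmic derivative, solved for the summand
  with the constant coefficient 1. There is no division by \<open>k\<close>, so the identity is
  available in positive characteristic.\<close>

lemma power_sum_newton:
  assumes "k \<ge> 1"
  shows "power_sum k D = - of_nat k * fps_nth (mset_fps D) k
    - (\<Sum>i=1..<k. fps_nth (mset_fps D) i * power_sum (k - i) D)"
proof -
  obtain j where k: "k = Suc j" using assms by (cases k) auto
  have 0: "fps_nth (mset_fps D) 0 = 1"
    using mset_poly_monic[of D] by (simp add: mset_fps_nth)
  have "of_nat k * fps_nth (mset_fps D) k = fps_nth (fps_deriv (mset_fps D)) j"
    by (simp add: k)
  also have "\<dots> = - (\<Sum>i=0..j. fps_nth (mset_fps D) i * power_sum (Suc (j - i)) D)"
    by (simp add: fps_deriv_mset_fps fps_mult_nth)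
  also have "(\<Sum>i=0..j. fps_nth (mset_fps D) i * power_sum (Suc (j - i)) D) =
    (\<Sum>i=0..j. fps_nth (mset_fps D) i * power_sum (k - i) D)"
    by (intro sum.cong) (auto simp: k Suc_diff_le)
  also have "\<dots> = power_sum k D + (\<Sum>i=1..<k. fps_nth (mset_fps D) i * power_sum (k - i) D)"
    using 0 by (subst sum.atLeast_Suc_atMost) (auto simp: k atLeastLessThanSuc_atLeastAtMost)
  finally have "of_nat k * fps_nth (mset_fps D) k =
    - (power_sum k D + (\<Sum>i=1..<k. fps_nth (mset_fps D) i * power_sum (k - i) D))" .
  then show ?thesis by simp
qed

text \<open>By Newton's identities the power sum of order \<open>k\<close> depends only on the
  coefficients of \<open>mset_fps\<close> up to index \<open>k\<close>, and the last of them enters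
  linearly with the factor \<open>- k\<close>. The change made here is a change of the coefficient
  with index \<open>d\<close>.\<close>

lemma power_sum_shift:
  assumes "1 \<le> d" "d \<le> size D" "size D' = size D"
    and "mset_poly D' = mset_poly D + Polynomial.monom s (size D - d)"
  shows "k < d \<Longrightarrow> power_sum k D' = power_sum k D"
    and "power_sum d D' = power_sum d D - of_nat d * s"
proof -
  have e: "fps_nth (mset_fps D') k = fps_nth (mset_fps D) k + (if k = d then s else 0)" if "k \<le> d" for k
    using that assms by (auto simp: mset_fps_nth)
  show lt: "power_sum k D' = power_sum k D" if "k < d" for k
    using that
  proof (induction k rule: less_induct)
    case (less k)
    show ?case
    proof (cases "k = 0")
      case True then show ?thesis using assms(3) by (simp add: power_sum_def)
    next
      case False
      have "(\<Sum>i=1..<k. fps_nth (mset_fps D') i * power_sum (k - i) D') =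
        (\<Sum>i=1..<k. fps_nth (mset_fps D) i * power_sum (k - i) D)"
        using less e by (intro sum.cong) auto
      with False less.prems e[of k] show ?thesis
        using power_sum_newton[of k D] power_sum_newton[of k D'] by simp
    qed
  qed
  have "(\<Sum>i=1..<d. fps_nth (mset_fps D') i * power_sum (d - i) D') =
    (\<Sum>i=1..<d. fps_nth (mset_fps D) i * power_sum (d - i) D)"
    using lt e by (intro sum.cong) auto
  then show "power_sum d D' = power_sum d D - of_nat d * s"
    using power_sum_newton[OF assms(1), of D] power_sum_newton[OF assms(1), of D'] e[of d]
    by (simp add: distrib_left)
qed

section \<open>Stepanov's method for Artin--Schreier curves\<close>

definition subring_set :: "'b :: comm_ring_1 set \<Rightarrow> bool" where
  "subring_set K \<longleftrightarrow> 0 \<in> K \<and> 1 \<in> K \<and> (\<forall>x\<in>K. \<forall>y\<in>K. x - y \<in> K \<and> x * y \<in> K)"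

lemma subring_setD:
  assumes "subring_set K"
  shows "0 \<in> K" "1 \<in> K" "x \<in> K \<Longrightarrow> y \<in> K \<Longrightarrow> x - y \<in> K" "x \<in> K \<Longrightarrow> y \<in> K \<Longrightarrow> x * y \<in> K"
    "x \<in> K \<Longrightarrow> y \<in> K \<Longrightarrow> x + y \<in> K"
proof -
  show *: "0 \<in> K" "1 \<in> K" "x \<in> K \<Longrightarrow> y \<in> K \<Longrightarrow> x - y \<in> K" "x \<in> K \<Longrightarrow> y \<in> K \<Longrightarrow> x * y \<in> K" for x y
    using assms by (auto simp: subring_set_def)
  show "x + y \<in> K" if "x \<in> K" "y \<in> K"
    using *(3)[OF that(1) *(3)[OF *(1) that(2)]] by simp
qed

lemma subring_set_sum:
  assumes "subring_set K" "\<And>i. i \<in> A \<Longrightarrow> f i \<in> K"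
  shows "sum f A \<in> K"
  using assms(2) by (induction A rule: infinite_finite_induct) (auto simp: subring_setD[OF assms(1)])

text \<open>Counting replaces linear algebra: there are more coefficient vectors over
  \<open>K\<close> than value vectors, so two of them have the same values, and their difference is
  a relation. That its coefficients lie in \<open>K\<close> matters later, when they are replaced by
  their \<open>r\<close>-th powers.\<close>

lemma nontrivial_linear_relation:
  fixes m :: "'v \<Rightarrow> 'u \<Rightarrow> 'b :: comm_ring_1"
  assumes K: "subring_set K" "finite K" and UV: "finite U" "finite V" "card V < card U"
    and m: "\<And>u v. u \<in> U \<Longrightarrow> v \<in> V \<Longrightarrow> m v u \<in> K"
  obtains c where "\<And>u. u \<in> U \<Longrightarrow> c u \<in> K" "\<exists>u\<in>U. c u \<noteq> 0" "\<And>v. v \<in> V \<Longrightarrow> (\<Sum>u\<in>U. c u * m v u) = 0"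
proof -
  define \<Phi> where "\<Phi> c = (\<lambda>v\<in>V. \<Sum>u\<in>U. c u * m v u)" for c
  have "card {0::'b, 1} \<le> card K"
    using K by (intro card_mono) (auto simp: subring_setD)
  then have "card K ^ card V < card K ^ card U"
    using UV by (intro power_strict_increasing) auto
  then have "card (V \<rightarrow>\<^sub>E K) < card (U \<rightarrow>\<^sub>E K)"
    using UV by (simp add: card_PiE)
  moreover have "\<Phi> ` (U \<rightarrow>\<^sub>E K) \<subseteq> (V \<rightarrow>\<^sub>E K)"
    using K m by (auto simp: \<Phi>_def PiE_iff intro!: subring_set_sum subring_setD)
  moreover have "finite (V \<rightarrow>\<^sub>E K)"
    using UV K by (intro finite_PiE) auto
  ultimately have "\<not> inj_on \<Phi> (U \<rightarrow>\<^sub>E K)"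
    by (metis card_inj_on_le leD)
  then obtain c1 c2 where c: "c1 \<in> U \<rightarrow>\<^sub>E K" "c2 \<in> U \<rightarrow>\<^sub>E K" "\<Phi> c1 = \<Phi> c2" "c1 \<noteq> c2"
    by (auto simp: inj_on_def)
  show thesis
  proof (rule that[of "\<lambda>u. c1 u - c2 u"])
    show "c1 u - c2 u \<in> K" if "u \<in> U" for u
      using c that K by (auto intro!: subring_setD)
    show "\<exists>u\<in>U. c1 u - c2 u \<noteq> 0"
      using c PiE_ext[OF c(1,2)] by auto
    show "(\<Sum>u\<in>U. (c1 u - c2 u) * m v u) = 0" if "v \<in> V" for v
      using fun_cong[OF c(3), of v] that by (simp add: \<Phi>_def left_diff_distrib sum_subtractf)
  qed
qed

text \<open>The normal form of \<open>y\<^sup>b\<close> modulo \<open>y\<^sup>q = y + f(x)\<close>: the coefficient of \<open>y\<^sup>j\<close> for \<open>j < q\<close>.\<close>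

function curve_red :: "'b :: comm_ring_1 poly \<Rightarrow> nat \<Rightarrow> nat \<Rightarrow> nat \<Rightarrow> 'b poly" where
  "curve_red f q b j = (if b < q \<or> q < 2 then (if j = b then 1 else 0)
     else curve_red f q (b + 1 - q) j + f * curve_red f q (b - q) j)"
  by pat_completeness auto
termination by (relation "Wellfounded.measure (\<lambda>(f, q, b, j). b)") auto

declare curve_red.simps [simp del]

lemma curve_red_eval:
  fixes x :: "'b :: comm_ring_1"
  assumes "y ^ q = y + poly f x" "q \<ge> 2"
  shows "y ^ b = (\<Sum>j<q. poly (curve_red f q b j) x * y ^ j)"
proof (induction b rule: less_induct)
  case (less b)
  show ?case
  proof (cases "b < q")
    case True
    have "(\<Sum>j<q. poly (curve_red f q b j) x * y ^ j) = (\<Sum>j<q. if j = b then y ^ j else 0)"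
      using True by (intro sum.cong) (auto simp: curve_red.simps)
    then show ?thesis using True by simp
  next
    case False
    have "y ^ b = y ^ (b - q) * y ^ q"
      using False by (simp flip: power_add)
    also have "\<dots> = y ^ (b + 1 - q) + poly f x * y ^ (b - q)"
      using False by (simp add: assms(1) algebra_simps Suc_diff_le)
    also have "y ^ (b + 1 - q) = (\<Sum>j<q. poly (curve_red f q (b + 1 - q) j) x * y ^ j)"
      using False assms by (intro less) auto
    also have "y ^ (b - q) = (\<Sum>j<q. poly (curve_red f q (b - q) j) x * y ^ j)"
      using False assms by (intro less) auto
    also have "(\<Sum>j<q. poly (curve_red f q (b + 1 - q) j) x * y ^ j) +
      poly f x * (\<Sum>j<q. poly (curve_red f q (b - q) j) x * y ^ j) =
      (\<Sum>j<q. poly (curve_red f q b j) x * y ^ j)"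
      using False assms(2)
      by (subst (3) curve_red.simps)
        (simp add: sum_distrib_left ring_distribs sum.distrib mult.assoc)
    finally show ?thesis .
  qed
qed

text \<open>Let \<open>x\<close> have weight \<open>q\<close> and \<open>y\<close> weight
  \<open>degree f\<close>; for coprime weights these are the pole orders at infinity. In the rule
  that replaces \<open>y^q\<close> by \<open>y + f(x)\<close>, no term on the right is heavier than
  \<open>y^q\<close>, so reduction never raises the weight.\<close>

lemma curve_red_weight:
  fixes f :: "'b :: idom poly"
  assumes "j < q" "2 \<le> q" "curve_red f q b j \<noteq> 0"
  shows "q * degree (curve_red f q b j) + degree f * j \<le> degree f * b"
  using assms(3)
proof (induction b rule: less_induct)
  case (less b)
  show ?case
  proof (cases "b < q")
    case True
    then show ?thesis using less.prems by (auto simp: curve_red.simps split: if_splits)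
  next
    case False
    let ?A = "curve_red f q (b + 1 - q) j" and ?B = "curve_red f q (b - q) j"
    have eq: "curve_red f q b j = ?A + f * ?B"
      using False assms(2) by (subst curve_red.simps) auto
    have A: "q * degree ?A + degree f * j \<le> degree f * b" if "?A \<noteq> 0"
    proof -
      have "q * degree ?A + degree f * j \<le> degree f * (b + 1 - q)"
        using False assms(2) that by (intro less.IH) auto
      also have "\<dots> \<le> degree f * b" using assms(2) by (intro mult_left_mono) auto
      finally show ?thesis .
    qed
    have B: "q * degree (f * ?B) + degree f * j \<le> degree f * b" if "f * ?B \<noteq> 0"
    proof -
      have "q * degree ?B + degree f * j \<le> degree f * (b - q)"
        using False assms(2) that by (intro less.IH) auto
      moreover have "degree f * (b - q) + q * degree f = degree f * b"
        using False by (metis add_mult_distrib2 le_add_diff_inverse2 mult.commute not_less)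
      ultimately show ?thesis
        using that by (subst degree_mult_eq) (auto simp: algebra_simps)
    qed
    show ?thesis
    proof (cases "?A = 0 \<or> f * ?B = 0")
      case True
      then show ?thesis using A B less.prems eq by auto
    next
      case nz: False
      consider "degree (?A + f * ?B) \<le> degree ?A" | "degree (?A + f * ?B) \<le> degree (f * ?B)"
        using degree_add_le_max[of ?A "f * ?B"] by linarith
      then show ?thesis
      proof cases
        case 1
        then have "q * degree (?A + f * ?B) \<le> q * degree ?A" by simp
        moreover have "q * degree ?A + degree f * j \<le> degree f * b" using A nz by blast
        ultimately show ?thesis unfolding eq by linarith
      next
        case 2
        then have "q * degree (?A + f * ?B) \<le> q * degree (f * ?B)" by simp
        moreover have "q * degree (f * ?B) + degree f * j \<le> degree f * b" using B nz by blast
        ultimately show ?thesis unfolding eq by linarith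
      qed
    qed
  qed
qed

text \<open>Always choosing \<open>f(x)\<close> when \<open>y^q\<close> is replaced keeps the full
  weight. The other choice \<open>y\<close> loses weight, so it cannot cancel the leading
  term.\<close>

lemma curve_red_top:
  fixes f :: "'b :: idom poly"
  assumes "2 \<le> q" "1 \<le> degree f"
  shows "curve_red f q b (b mod q) \<noteq> 0 \<and> degree (curve_red f q b (b mod q)) = degree f * (b div q)"
proof (induction b rule: less_induct)
  case (less b)
  show ?case
  proof (cases "b < q")
    case True
    then show ?thesis by (simp add: curve_red.simps)
  next
    case False
    let ?j = "b mod q"
    let ?A = "curve_red f q (b + 1 - q) ?j" and ?B = "curve_red f q (b - q) ?j"
    have eq: "curve_red f q b ?j = ?A + f * ?B"
      using False assms by (subst curve_red.simps) auto
    have f: "f \<noteq> 0" using assms by auto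
    have "(b - q) mod q = ?j" "b div q = Suc ((b - q) div q)"
      using False assms by (simp_all add: le_mod_geq le_div_geq)
    then have B: "f * ?B \<noteq> 0" "degree (f * ?B) = degree f * (b div q)"
      using less.IH[of "b - q"] False assms f by (auto simp: degree_mult_eq)
    have "degree ?A < degree (f * ?B)" if "?A \<noteq> 0"
    proof -
      have "q * degree ?A + degree f * ?j \<le> degree f * (b + 1 - q)"
        using assms that by (intro curve_red_weight) auto
      also have "\<dots> < degree f * b"
        using assms False by (intro mult_strict_left_mono) auto
      also have "\<dots> = q * (degree f * (b div q)) + degree f * ?j"
        by (metis add_mult_distrib2 mult.left_commute mult_div_mod_eq)
      finally show ?thesis by (simp add: B)
    qed
    moreover have "0 < degree (f * ?B)"
      using False assms by (simp add: B div_greater_zero_iff)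
    ultimately have "degree (?A + f * ?B) = degree (f * ?B)"
      by (intro degree_add_eq_right) (cases "?A = 0"; simp)
    then show ?thesis using B eq \<open>0 < degree (f * ?B)\<close> by (metis degree_0 less_irrefl)
  qed
qed

lemma curve_red_coeff_in:
  assumes "subring_set K" "\<And>i. poly.coeff f i \<in> K"
  shows "poly.coeff (curve_red f q b j) i \<in> K"
proof (induction b arbitrary: i rule: less_induct)
  case (less b)
  show ?case
  proof (cases "b < q \<or> q < 2")
    case True
    then show ?thesis using assms(1) by (auto simp: curve_red.simps subring_setD)
  next
    case False
    then have "poly.coeff (curve_red f q (b + 1 - q) j) i \<in> K" "\<And>i. poly.coeff (curve_red f q (b - q) j) i \<in> K"
      by (intro less; auto)+
    then show ?thesis using False assms
      by (subst curve_red.simps) (auto simp: coeff_mult intro!: subring_setD(4,5)[OF assms(1)] subring_set_sum)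
  qed
qed

text \<open>Points are counted over the solutions of \<open>x ^ (r * r) = x\<close>, on which the
  \<open>r\<close>-th power map is its own inverse. The assumption \<open>big\<close> pays for the
  comparison of dimensions in \<open>card_VU\<close>, and \<open>cop\<close> makes weights separate
  monomials.\<close>

locale artin_schreier =
  fixes f :: "'b :: field poly" and q r d a m :: nat
  assumes char: "prime CHAR('b)" and q: "q = CHAR('b) ^ a" and q2: "2 \<le> q"
    and fixq: "card {s :: 'b. s ^ q = s} = q" and r: "r = q ^ m"
    and d: "d = degree f" and cop: "coprime d q"
    and finK: "finite {x :: 'b. x ^ (r * r) = x}"
    and fK: "poly.coeff f i ^ (r * r) = poly.coeff f i"
    and big: "(q * d + 2)\<^sup>2 \<le> r"
begin

definition K where "K = {x :: 'b. x ^ (r * r) = x}"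
definition wt where "wt z = q * fst z + d * snd z" for z :: "nat \<times> nat"
text \<open>These monomials play the role of a basis of the Riemann-Roch space of \<open>l\<close>
  times the point at infinity: \<open>snd z < q\<close> selects the normal forms, \<open>wt\<close>
  is the pole order.\<close>

definition idx where "idx l = {z. snd z < q \<and> wt z \<le> l}"

lemma d_pos: "1 \<le> d"
  using cop q2 by (cases d) auto

lemma pow_add:
  "(x + y :: 'b) ^ q = x ^ q + y ^ q" "(x + y :: 'b) ^ r = x ^ r + y ^ r"
  "(x + y :: 'b) ^ (r * r) = x ^ (r * r) + y ^ (r * r)"
  using char by (auto intro!: freshmans_dream' simp: q r simp flip: power_mult power_add)

lemma K_subring: "subring_set K"
proof -
  have "(x - y) ^ (r * r) = x ^ (r * r) - y ^ (r * r)" for x y :: 'b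
    using pow_add(3)[of "x - y" y] by (simp add: algebra_simps)
  moreover have "0 < r" using big by (cases r) auto
  ultimately show ?thesis
    by (auto simp: subring_set_def K_def power_mult_distrib)
qed

text \<open>Equal weights make \<open>q\<close> divide \<open>d (j - j')\<close>, hence
  \<open>j - j'\<close> by coprimality, but this difference is smaller than \<open>q\<close> in
  absolute value.\<close>

lemma wt_inj: "inj_on wt {z. snd z < q}"
proof (rule inj_onI)
  fix z z' assume z: "z \<in> {z. snd z < q}" "z' \<in> {z. snd z < q}" "wt z = wt z'"
  obtain i j i' j' where [simp]: "z = (i, j)" "z' = (i', j')" by (cases z; cases z') auto
  have e: "int q * int i + int d * int j = int q * int i' + int d * int j'"
    using z(3) unfolding wt_def by (simp flip: of_nat_mult of_nat_add)
  then have "int d * (int j - int j') = int q * (int i' - int i)" by (simp add: algebra_simps)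
  then have "int q dvd int d * (int j - int j')" by simp
  then have "int q dvd int j - int j'"
    using cop by (subst (asm) coprime_dvd_mult_right_iff) (auto simp: coprime_commute)
  moreover have "\<bar>int j - int j'\<bar> < int q" using z by auto
  ultimately have "j = j'" using zdvd_imp_le[of "int q" "\<bar>int j - int j'\<bar>"] by fastforce
  with e q2 show "z = z'" by auto
qed

lemma idx_finite: "finite (idx l)"
proof (rule finite_subset)
  show "idx l \<subseteq> {..l} \<times> {..<q}"
  proof
    fix z assume "z \<in> idx l"
    then have "fst z \<le> q * fst z" "q * fst z \<le> l" "snd z < q"
      using q2 by (auto simp: idx_def wt_def)
    then have "fst z \<le> l" "snd z < q" by (metis order_trans)+
    then show "z \<in> {..l} \<times> {..<q}" by (cases z) auto
  qed
qed simp

lemma idx_card_le: "card (idx l) \<le> l + 1"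
proof -
  have "card (idx l) = card (wt ` idx l)"
    by (intro card_image[symmetric] inj_on_subset[OF wt_inj]) (auto simp: idx_def)
  also have "\<dots> \<le> card {..l}" by (intro card_mono) (auto simp: idx_def)
  finally show ?thesis by simp
qed

text \<open>As \<open>j\<close> runs through the residues modulo \<open>q\<close>, so does
  \<open>d * j\<close>; hence every weight from \<open>q * d\<close> on is attained. The loss of
  \<open>q * d\<close> is a crude form of the Riemann-Roch inequality, with no need for the exact
  genus.\<close>

lemma idx_card_ge: "l + 1 \<le> card (idx l) + q * d"
proof -
  have inj: "inj_on (\<lambda>j. d * j mod q) {..<q}"
  proof (rule inj_onI)
    fix j j' assume j: "j \<in> {..<q}" "j' \<in> {..<q}" "d * j mod q = d * j' mod q"
    then have "int q dvd int d * int j - int d * int j'"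
      by (metis mod_eq_dvd_iff of_nat_mult zmod_int)
    then have "int q dvd int d * (int j - int j')" by (simp add: algebra_simps)
    then have "int q dvd int j - int j'"
      using cop by (subst (asm) coprime_dvd_mult_right_iff) (auto simp: coprime_commute)
    moreover have "\<bar>int j - int j'\<bar> < int q" using j by auto
    ultimately show "j = j'" using zdvd_imp_le[of "int q" "\<bar>int j - int j'\<bar>"] by fastforce
  qed
  have surj: "(\<lambda>j. d * j mod q) ` {..<q} = {..<q}"
    using inj q2 by (intro endo_inj_surj) auto
  have "{q * d..l} \<subseteq> wt ` idx l"
  proof
    fix w assume w: "w \<in> {q * d..l}"
    have "w mod q \<in> (\<lambda>j. d * j mod q) ` {..<q}" using q2 by (simp add: surj)
    then obtain j where j: "j < q" "d * j mod q = w mod q" by auto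
    have "d * j \<le> q * d" using j by (simp add: mult.commute)
    then have "d * j \<le> w" using w by (meson atLeastAtMost_iff order_trans)
    then have "q dvd w - d * j" using j(2) by (metis mod_eq_dvd_iff_nat)
    then obtain i where "w - d * j = q * i" by (auto simp: dvd_def)
    then have "wt (i, j) = w" using \<open>d * j \<le> w\<close> by (simp add: wt_def)
    then show "w \<in> wt ` idx l" using j w by (intro image_eqI[of _ _ "(i, j)"]) (auto simp: idx_def)
  qed
  then have "card {q * d..l} \<le> card (wt ` idx l)"
    using idx_finite by (intro card_mono) auto
  also have "\<dots> \<le> card (idx l)" using idx_finite by (intro card_image_le)
  finally show ?thesis by auto
qed

text \<open>\<open>U\<close> indexes pairs of a monomial of weight below \<open>r\<close> and one of
  weight at most \<open>M\<close>; \<open>V\<close> indexes the coefficients that can occur in the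
  normal form of the products \<open>low\<close>. The surplus \<open>2 * (q * d)\<close> makes up
  for a loss of \<open>q * d\<close> in each of the two lower bounds for the number of
  monomials.\<close>

definition M where "M = r + 2 * (q * d)"
definition U where "U = idx (r - 1) \<times> idx M"
definition V where "V = idx ((r - 1) * r + M)"
text \<open>If \<open>u\<close> stands for the monomials m and n, then \<open>low u\<close> is the
  exponent of m^r n, and \<open>high u\<close> that of m n^r. At points with coordinates in
  \<open>K\<close> the former is the \<open>r\<close>-th power of the latter.\<close>

definition low where "low u = (fst (fst u) * r + fst (snd u), snd (fst u) * r + snd (snd u))"
  for u :: "(nat \<times> nat) \<times> (nat \<times> nat)"
definition high where "high u = (fst (fst u) + fst (snd u) * r, snd (fst u) + snd (snd u) * r)"
  for u :: "(nat \<times> nat) \<times> (nat \<times> nat)"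

definition xy_red where "xy_red z j = Polynomial.monom 1 (fst z) * curve_red f q (snd z) j"
  for z :: "nat \<times> nat"

lemma xy_red_weight:
  assumes "j < q" "poly.coeff (xy_red z j) k \<noteq> 0"
  shows "q * k + d * j \<le> wt z"
proof -
  have k: "fst z \<le> k" "poly.coeff (curve_red f q (snd z) j) (k - fst z) \<noteq> 0"
    using assms(2) by (auto simp: xy_red_def coeff_monom_mult split: if_splits)
  then have "k - fst z \<le> degree (curve_red f q (snd z) j)" and nz: "curve_red f q (snd z) j \<noteq> 0"
    by (auto intro: le_degree)
  then have "q * (k - fst z) \<le> q * degree (curve_red f q (snd z) j)" by simp
  then have "q * (k - fst z) + d * j \<le> d * snd z"
    using curve_red_weight[OF assms(1) q2 nz] unfolding d by linarith
  moreover have "q * k = q * (k - fst z) + q * fst z"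
    using k by (simp flip: add_mult_distrib2)
  ultimately show ?thesis by (simp add: wt_def)
qed

text \<open>The normal form of a monomial keeps its full weight. As weights separate monomials, this
  will rule out complete cancellation in the auxiliary function.\<close>

lemma xy_red_top:
  obtains j k where "j < q" "poly.coeff (xy_red z j) k \<noteq> 0" "q * k + d * j = wt z"
proof
  let ?j = "snd z mod q" and ?k = "fst z + d * (snd z div q)"
  have t: "curve_red f q (snd z) ?j \<noteq> 0" "degree (curve_red f q (snd z) ?j) = d * (snd z div q)"
    using curve_red_top[OF q2, of f "snd z"] d_pos d by auto
  show "?j < q" using q2 by simp
  show "poly.coeff (xy_red z ?j) ?k \<noteq> 0"
    using t by (auto simp: xy_red_def coeff_monom_mult simp flip: t(2))
  have "q * (d * (snd z div q)) + d * (snd z mod q) = d * snd z"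
    by (metis add_mult_distrib2 mult.left_commute mult_div_mod_eq)
  then show "q * ?k + d * ?j = wt z" by (simp add: wt_def distrib_left)
qed

lemma xy_red_eval:
  assumes "y ^ q = y + poly f x"
  shows "x ^ fst z * y ^ snd z = (\<Sum>j<q. poly (xy_red z j) x * y ^ j)"
  by (subst curve_red_eval[OF assms q2, of "snd z"])
     (simp add: xy_red_def sum_distrib_left poly_monom mult.assoc)

lemma wt_low: "wt (low u) = r * wt (fst u) + wt (snd u)"
  by (simp add: wt_def low_def algebra_simps)

lemma wt_high: "wt (high u) = wt (fst u) + r * wt (snd u)"
  by (simp add: wt_def high_def algebra_simps)

lemma r_big: "q * d + 2 \<le> r" "q * d * (q * d) + 4 * (q * d) + 4 \<le> r"
  using big by (simp_all add: power2_eq_square algebra_simps)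

text \<open>The difference of the bounds for \<open>card U\<close> and \<open>card V\<close> is
  \<open>r\<close> minus the number (q d)^2 + 3 q d + 1, which is positive since \<open>big\<close>
  yields (q d)^2 + 4 q d + 4 as a lower bound for \<open>r\<close>.\<close>

lemma card_VU: "card V < card U"
proof -
  obtain s where s: "r = q * d + s" "2 \<le> s" using r_big(1) by (metis add.assoc le_Suc_ex le_add1 add.commute)
  have V: "card V \<le> (r - 1) * r + M + 1" unfolding V_def by (rule idx_card_le)
  have "r - q * d \<le> card (idx (r - 1))" using idx_card_ge[of "r - 1"] r_big(1) by linarith
  moreover have "r + q * d + 1 \<le> card (idx M)" using idx_card_ge[of M] unfolding M_def by linarith
  ultimately have "(r - q * d) * (r + q * d + 1) \<le> card U"
    unfolding U_def card_cartesian_product by (rule mult_le_mono)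
  moreover have "(r - 1) * r + M + 1 < (r - q * d) * (r + q * d + 1)"
  proof -
    have "int ((r - 1) * r + M + 1) = (int r - 1) * int r + int r + 2 * (int q * int d) + 1"
      using r_big(1) by (simp add: M_def of_nat_diff)
    moreover have "int ((r - q * d) * (r + q * d + 1)) = (int r - int q * int d) * (int r + int q * int d + 1)"
    proof -
      have "int (r - q * d) = int r - int q * int d" using r_big(1) by (simp add: of_nat_diff)
      then show ?thesis by (simp only: of_nat_mult of_nat_add of_nat_1)
    qed
    moreover have "int q * int d * (int q * int d) + 4 * (int q * int d) + 4 \<le> int r"
      using r_big(2) by (simp flip: of_nat_mult of_nat_add add: of_nat_le_iff[symmetric, where 'a = int] del: of_nat_le_iff)
    moreover have "(int r - int q * int d) * (int r + int q * int d + 1)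
        - ((int r - 1) * int r + int r + 2 * (int q * int d) + 1)
      = int r - (int q * int d * (int q * int d) + 3 * (int q * int d) + 1)"
      by (simp add: algebra_simps)
    ultimately have "int ((r - 1) * r + M + 1) < int ((r - q * d) * (r + q * d + 1))"
      by (smt (verit) of_nat_0_le_iff mult_nonneg_nonneg)
    then show ?thesis by (simp only: of_nat_less_iff)
  qed
  ultimately show ?thesis using V by linarith
qed

text \<open>A combination of the products m^r n vanishes on the whole curve once its normal form is
  zero. Only coefficients indexed by \<open>V\<close> can be nonzero, for reasons of weight, so
  there are fewer linear conditions than unknowns.\<close>

lemma auxiliary_coefficients:
  obtains c where "\<And>u. u \<in> U \<Longrightarrow> c u \<in> K" "\<exists>u\<in>U. c u \<noteq> 0"
    "\<And>j. j < q \<Longrightarrow> (\<Sum>u\<in>U. Polynomial.smult (c u) (xy_red (low u) j)) = 0"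
proof -
  have "\<And>i. poly.coeff f i \<in> K" using fK by (simp add: K_def)
  then have inK: "poly.coeff (xy_red z j) k \<in> K" for z j k
    using K_subring curve_red_coeff_in[OF K_subring, of f] by (auto simp: xy_red_def coeff_monom_mult subring_setD)
  have "finite U" "finite V" by (auto simp: U_def V_def idx_finite)
  then obtain c where c: "\<And>u. u \<in> U \<Longrightarrow> c u \<in> K" "\<exists>u\<in>U. c u \<noteq> 0"
      "\<And>v. v \<in> V \<Longrightarrow> (\<Sum>u\<in>U. c u * poly.coeff (xy_red (low u) (snd v)) (fst v)) = 0"
    using nontrivial_linear_relation[OF K_subring, of U V "\<lambda>v u. poly.coeff (xy_red (low u) (snd v)) (fst v)"]
      finK card_VU inK unfolding K_def by blast
  have "(\<Sum>u\<in>U. Polynomial.smult (c u) (xy_red (low u) j)) = 0" if j: "j < q" for j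
  proof (rule poly_eqI)
    fix k
    have "(\<Sum>u\<in>U. c u * poly.coeff (xy_red (low u) j) k) = 0"
    proof (cases "(k, j) \<in> V")
      case True then show ?thesis using c(3)[of "(k, j)"] by simp
    next
      case False
      have "poly.coeff (xy_red (low u) j) k = 0" if "u \<in> U" for u
      proof (rule ccontr)
        assume "poly.coeff (xy_red (low u) j) k \<noteq> 0"
        then have "wt (k, j) \<le> wt (low u)" using xy_red_weight j by (simp add: wt_def)
        also have "\<dots> \<le> r * (r - 1) + M"
          using that unfolding wt_low U_def idx_def by (intro add_mono mult_left_mono) auto
        finally show False using False j by (simp add: V_def idx_def mult.commute)
      qed
      then show ?thesis by (intro sum.neutral) auto
    qed
    then show "poly.coeff (\<Sum>u\<in>U. Polynomial.smult (c u) (xy_red (low u) j)) k = poly.coeff 0 k"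
      by (simp add: coeff_sum)
  qed
  then show thesis using c that by blast
qed

text \<open>With the coefficients replaced by their \<open>r\<close>-th powers, the combination of
  the m n^r has an \<open>r\<close>-th power which agrees at the points over \<open>K\<close> with a
  function vanishing on the curve. So it vanishes at these points. It is not identically zero,
  because its monomials have distinct weights, and its weight bounds its number of zeros.\<close>

lemma stepanov_bound:
  "q * card {x \<in> K. \<exists>y\<in>K. y ^ q - y = poly f x} \<le> (r - 1) + r * (r + 2 * (q * d))"
proof -
  obtain c0 where c0: "\<And>u. u \<in> U \<Longrightarrow> c0 u \<in> K" "\<exists>u\<in>U. c0 u \<noteq> 0"
    "\<And>j. j < q \<Longrightarrow> (\<Sum>u\<in>U. Polynomial.smult (c0 u) (xy_red (low u) j)) = 0"
    using auxiliary_coefficients by blast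
  define c where "c u = c0 u ^ r" for u
  have c_r: "c u ^ r = c0 u" if "u \<in> U" for u
    using c0(1)[OF that] by (simp add: c_def K_def flip: power_mult)
  define B where "B j = (\<Sum>u\<in>U. Polynomial.smult (c u) (xy_red (high u) j))" for j
  have r0: "0 < r" using r_big by simp
  have finU: "finite U" by (auto simp: U_def idx_finite)
  \<comment> \<open>The weight of \<open>fst u\<close> is below \<open>r\<close>, so the two weights
    are the remainder and the quotient of \<open>wt (high u)\<close> on division by
    \<open>r\<close>.\<close>
  have inj: "inj_on (\<lambda>u. wt (high u)) U"
  proof (rule inj_onI)
    fix u v assume uv: "u \<in> U" "v \<in> U" "wt (high u) = wt (high v)"
    then have less: "wt (fst u) < r" "wt (fst v) < r" using r0 by (auto simp: U_def idx_def)
    have "wt (fst u) = wt (high u) mod r" "wt (snd u) = wt (high u) div r"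
      using less r0 by (simp_all add: wt_high)
    moreover have "wt (fst v) = wt (high v) mod r" "wt (snd v) = wt (high v) div r"
      using less r0 by (simp_all add: wt_high)
    ultimately have "wt (fst u) = wt (fst v)" "wt (snd u) = wt (snd v)" using uv by auto
    moreover have "fst u \<in> {z. snd z < q}" "snd u \<in> {z. snd z < q}" "fst v \<in> {z. snd z < q}"
      "snd v \<in> {z. snd z < q}" using uv(1,2) by (auto simp: U_def idx_def)
    ultimately have "fst u = fst v" "snd u = snd v" by (blast intro: inj_onD[OF wt_inj])+
    then show "u = v" by (rule prod_eqI)
  qed
  \<comment> \<open>The term of largest weight has a coefficient in a position whose weight no other
    term reaches.\<close>
  have "\<exists>j<q. B j \<noteq> 0"
  proof -
    let ?U = "{u \<in> U. c0 u \<noteq> 0}"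
    have "finite ?U" "?U \<noteq> {}" using finU c0 by auto
    then have "Max ((\<lambda>u. wt (high u)) ` ?U) \<in> (\<lambda>u. wt (high u)) ` ?U"
      by (intro Max_in) auto
    then obtain u0 where u0: "u0 \<in> ?U" "Max ((\<lambda>u. wt (high u)) ` ?U) = wt (high u0)"
      by (rule imageE)
    have u0_max: "wt (high u) \<le> wt (high u0)" if "u \<in> ?U" for u
      unfolding u0(2)[symmetric] using \<open>finite ?U\<close> that by (intro Max_ge finite_imageI imageI)
    obtain j k where jk: "j < q" "poly.coeff (xy_red (high u0) j) k \<noteq> 0" "q * k + d * j = wt (high u0)"
      using xy_red_top by blast
    have "poly.coeff (B j) k = (\<Sum>u\<in>U. c u * poly.coeff (xy_red (high u) j) k)"
      by (simp add: B_def coeff_sum)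
    also have "\<dots> = (\<Sum>u\<in>{u0}. c u * poly.coeff (xy_red (high u) j) k)"
    proof (intro sum.mono_neutral_right ballI)
      fix u assume u: "u \<in> U - {u0}"
      show "c u * poly.coeff (xy_red (high u) j) k = 0"
      proof (rule ccontr)
        assume nz: "c u * poly.coeff (xy_red (high u) j) k \<noteq> 0"
        then have "c0 u \<noteq> 0" using r0 by (auto simp: c_def)
        then have "wt (high u) \<le> wt (high u0)" using u0_max[of u] u by simp
        moreover have "wt (high u0) \<le> wt (high u)"
          using xy_red_weight[OF jk(1), of "high u" k] nz jk(3) by simp
        ultimately have "wt (high u) = wt (high u0)" by simp
        then show False using inj_onD[OF inj, of u u0] u u0(1) by auto
      qed
    qed (use finU u0 in auto)
    also have "\<dots> \<noteq> 0" using u0 jk by (auto simp: c_def)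
    finally show ?thesis using jk(1) by (intro exI[of _ j]) auto
  qed
  then obtain j where j: "j < q" "B j \<noteq> 0" by blast
  have deg: "q * degree (B j) \<le> (r - 1) + r * M"
  proof -
    have "poly.coeff (B j) (degree (B j)) \<noteq> 0" using j by simp
    then obtain u where u: "u \<in> U" "poly.coeff (xy_red (high u) j) (degree (B j)) \<noteq> 0"
      unfolding B_def by (subst (asm) coeff_sum) (auto elim!: sum.not_neutral_contains_not_neutral)
    then have "q * degree (B j) \<le> wt (high u)" using xy_red_weight[OF j(1) u(2)] by simp
    also have "\<dots> \<le> (r - 1) + r * M"
      using u unfolding wt_high by (intro add_mono mult_left_mono) (auto simp: U_def idx_def)
    finally show ?thesis .
  qed
  \<comment> \<open>On \<open>K\<close>, powers with exponent \<open>r * r\<close> reduce to first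
    powers. This turns the \<open>r\<close>-th power of \<open>E\<close> into the combination of the
    \<open>low u\<close> that was chosen to vanish on the curve.\<close>
  have vanish: "(\<Sum>j<q. poly (B j) x * y ^ j) = 0"
    if xy: "x \<in> K" "y \<in> K" "y ^ q = y + poly f x" for x y
  proof -
    define E where "E = (\<Sum>u\<in>U. c u * (x ^ fst (high u) * y ^ snd (high u)))"
    have pr: "(w ^ i) ^ r = w ^ (i * r)" for w :: 'b and i by (simp add: power_mult)
    have "E ^ r = (\<Sum>u\<in>U. (c u * (x ^ fst (high u) * y ^ snd (high u))) ^ r)"
      unfolding E_def using char by (intro freshmans_dream_sum'[of _ "a * m"]) (auto simp: r q power_mult)
    also have "\<dots> = (\<Sum>u\<in>U. c0 u * (x ^ fst (low u) * y ^ snd (low u)))"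
    proof (intro sum.cong refl)
      fix u assume u: "u \<in> U"
      have *: "w ^ ((i + i' * r) * r) = w ^ (i * r + i')" if "w \<in> K" for w :: 'b and i i'
      proof -
        have "w ^ ((i + i' * r) * r) = w ^ (i * r) * (w ^ (r * r)) ^ i'"
          by (simp add: algebra_simps power_add flip: power_mult)
        then show ?thesis using that by (simp add: K_def power_add)
      qed
      show "(c u * (x ^ fst (high u) * y ^ snd (high u))) ^ r = c0 u * (x ^ fst (low u) * y ^ snd (low u))"
        using c_r[OF u] *[OF xy(1)] *[OF xy(2)]
        by (simp add: power_mult_distrib pr high_def low_def)
    qed
    also have "\<dots> = (\<Sum>u\<in>U. \<Sum>j<q. c0 u * (poly (xy_red (low u) j) x * y ^ j))"
      by (subst xy_red_eval[OF xy(3)]) (simp add: sum_distrib_left)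
    also have "\<dots> = (\<Sum>j<q. \<Sum>u\<in>U. c0 u * (poly (xy_red (low u) j) x * y ^ j))"
      by (rule sum.swap)
    also have "\<dots> = (\<Sum>j<q. poly (\<Sum>u\<in>U. Polynomial.smult (c0 u) (xy_red (low u) j)) x * y ^ j)"
      by (simp add: poly_sum sum_distrib_left sum_distrib_right mult.assoc)
    also have "\<dots> = 0" using c0(3) by simp
    finally have "E = 0" using r0 by simp
    have "(\<Sum>j<q. poly (B j) x * y ^ j) = (\<Sum>j<q. \<Sum>u\<in>U. c u * (poly (xy_red (high u) j) x * y ^ j))"
      by (simp add: B_def poly_sum sum_distrib_left sum_distrib_right mult.assoc)
    also have "\<dots> = (\<Sum>u\<in>U. \<Sum>j<q. c u * (poly (xy_red (high u) j) x * y ^ j))"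
      by (rule sum.swap)
    also have "\<dots> = E"
      unfolding E_def by (subst xy_red_eval[OF xy(3)]) (simp add: sum_distrib_left)
    finally show ?thesis using \<open>E = 0\<close> by simp
  qed
  have fixK: "s \<in> K" if "s ^ q = s" for s :: 'b
  proof -
    have "s ^ (q ^ n) = s" for n
      using that by (induction n) (simp_all add: power_mult)
    moreover have "r * r = q ^ (2 * m)" by (simp add: r mult_2 power_add)
    ultimately show ?thesis unfolding K_def by simp
  qed
  \<comment> \<open>Above \<open>x\<close> lie, together with \<open>y\<close>, all its translates
    by the \<open>q\<close> solutions of \<open>s ^ q = s\<close>. The polynomial \<open>g\<close>
    has degree below \<open>q\<close> and vanishes at all of them, so each single coefficient
    \<open>poly (B j) x\<close> is zero.\<close>
  have root: "poly (B j) x = 0" if x: "x \<in> K" "y \<in> K" "y ^ q - y = poly f x" for x y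
  proof -
    define g where "g = (\<Sum>j<q. Polynomial.monom (poly (B j) x) j)"
    have "poly g (y + s) = 0" if s: "s ^ q = s" for s
    proof -
      have "y + s \<in> K" using x(2) fixK[OF s] K_subring by (auto intro: subring_setD)
      moreover have "(y + s) ^ q = (y + s) + poly f x"
        using x(3) s by (simp add: pow_add algebra_simps)
      ultimately have "(\<Sum>j<q. poly (B j) x * (y + s) ^ j) = 0" using vanish x(1) by blast
      then show ?thesis by (simp add: g_def poly_sum poly_monom)
    qed
    then have sub: "(+) y ` {s. s ^ q = s} \<subseteq> {z. poly g z = 0}" by auto
    have "g = 0"
    proof (rule ccontr)
      assume g: "g \<noteq> 0"
      have "degree g \<le> q - 1"
        unfolding g_def by (intro degree_sum_le) (auto intro: order_trans[OF degree_monom_le])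
      moreover have "q = card ((+) y ` {s. s ^ q = s})" using fixq by (simp add: card_image)
      moreover have "\<dots> \<le> card {z. poly g z = 0}" using g sub by (intro card_mono poly_roots_finite)
      moreover have "\<dots> \<le> degree g" using g by (rule card_poly_roots_bound)
      ultimately show False using q2 by linarith
    qed
    then have "poly.coeff g j = 0" by simp
    then show ?thesis using j(1) by (simp add: g_def coeff_sum if_distrib cong: if_cong)
  qed
  have "card {x \<in> K. \<exists>y\<in>K. y ^ q - y = poly f x} \<le> card {x. poly (B j) x = 0}"
    using root j(2) by (intro card_mono poly_roots_finite) auto
  also have "\<dots> \<le> degree (B j)" using j(2) by (rule card_poly_roots_bound)
  finally have "q * card {x \<in> K. \<exists>y\<in>K. y ^ q - y = poly f x} \<le> q * degree (B j)" by simp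
  also note deg
  finally show ?thesis by (simp add: M_def)
qed

end

section \<open>Additive characters of finite fields\<close>

definition additive_char :: "('a :: finite_field \<Rightarrow> complex) \<Rightarrow> bool" where
  "additive_char \<psi> \<longleftrightarrow> (\<forall>x y. \<psi> (x + y) = \<psi> x * \<psi> y) \<and> (\<forall>x. norm (\<psi> x) = 1)"

lemma additive_charD:
  assumes "additive_char \<psi>"
  shows "\<psi> (x + y) = \<psi> x * \<psi> y" "norm (\<psi> x) = 1" "\<psi> 0 = 1" "\<psi> (- x) = cnj (\<psi> x)" "\<psi> (x - y) = \<psi> x * cnj (\<psi> y)"
proof -
  show add: "\<psi> (x + y) = \<psi> x * \<psi> y" and n: "norm (\<psi> x) = 1" for x y
    using assms by (auto simp: additive_char_def)
  show 0: "\<psi> 0 = 1" using add[of 0 0] n[of 0] by force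
  show minus: "\<psi> (- x) = cnj (\<psi> x)" for x
  proof -
    have "\<psi> x * cnj (\<psi> x) = 1" using n[of x] by (simp add: complex_norm_square[symmetric])
    moreover have "\<psi> (- x) * \<psi> x = 1" using add[of "- x" x] 0 by simp
    ultimately show ?thesis by (metis mult.assoc mult.left_neutral mult.right_neutral)
  qed
  show "\<psi> (x - y) = \<psi> x * cnj (\<psi> y)" using add[of x "- y"] minus by simp
qed

definition additive_subgroup_set :: "'a :: ab_group_add set \<Rightarrow> bool" where
  "additive_subgroup_set V \<longleftrightarrow> 0 \<in> V \<and> (\<forall>x\<in>V. \<forall>y\<in>V. x - y \<in> V)"

lemma additive_subgroup_setD:
  assumes "additive_subgroup_set V"
  shows "0 \<in> V" "x \<in> V \<Longrightarrow> y \<in> V \<Longrightarrow> x - y \<in> V" "x \<in> V \<Longrightarrow> - x \<in> V" "x \<in> V \<Longrightarrow> y \<in> V \<Longrightarrow> x + y \<in> V"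
proof -
  show *: "0 \<in> V" "x \<in> V \<Longrightarrow> y \<in> V \<Longrightarrow> x - y \<in> V" for x y
    using assms by (auto simp: additive_subgroup_set_def)
  show neg: "x \<in> V \<Longrightarrow> - x \<in> V" for x using *(2)[OF *(1), of x] by simp
  show "x \<in> V \<Longrightarrow> y \<in> V \<Longrightarrow> x + y \<in> V" using *(2)[of x "- y"] neg by simp
qed

lemma additive_subgroup_set_of_nat:
  fixes v :: "'a :: comm_ring_1"
  assumes "additive_subgroup_set V" "v \<in> V"
  shows "of_nat n * v \<in> V"
  by (induction n) (auto simp: ring_distribs assms intro: additive_subgroup_setD[OF assms(1)])

lemma of_nat_unit_char:
  fixes n :: nat
  assumes "0 < n" "n < CHAR('a :: finite_field)"
  obtains m :: nat where "of_nat m * of_nat n = (1 :: 'a)"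
proof -
  have "coprime n CHAR('a)"
    using assms by (metis CHAR_prime coprime_commute nat_dvd_not_less prime_imp_coprime)
  then obtain m where "[n * m = 1] (mod CHAR('a))"
    by (metis cong_solve_coprime_nat One_nat_def)
  then have "(of_nat (n * m) :: 'a) = of_nat 1" by (simp only: of_nat_eq_iff_cong_CHAR)
  then show thesis using that[of m] by (simp add: mult.commute)
qed

text \<open>If two sums with different multiples of \<open>v\<close> agreed, a multiple of
  \<open>v\<close> by a number below the characteristic would lie in \<open>V\<close>. This number
  is invertible modulo the characteristic, so \<open>v\<close> itself would be in
  \<open>V\<close>.\<close>

lemma additive_subgroup_extend:
  fixes V :: "'a :: finite_field set"
  assumes V: "additive_subgroup_set V" and v: "v \<notin> V"
  defines "V' \<equiv> (\<lambda>(m, k). m + of_nat k * v) ` (V \<times> {..<CHAR('a)})"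
  shows "inj_on (\<lambda>(m, k). m + of_nat k * v) (V \<times> {..<CHAR('a)})" "additive_subgroup_set V'"
    "card V' = card V * CHAR('a)"
proof -
  have aux: False if h: "m \<in> V" "m' \<in> V" "m + of_nat k * v = m' + of_nat k' * v" "k < k'" "k' < CHAR('a)"
    for m m' and k k' :: nat
  proof -
    have "of_nat (k' - k) * v = m - m'"
      using h by (simp add: of_nat_diff algebra_simps)
    then have in_V: "of_nat (k' - k) * v \<in> V" using h V by (simp add: additive_subgroup_setD)
    have "0 < k' - k" "k' - k < CHAR('a)" using h by auto
    then obtain n where "of_nat n * of_nat (k' - k) = (1 :: 'a)"
      by (rule of_nat_unit_char)
    then have "v = of_nat n * (of_nat (k' - k) * v)" by (simp flip: mult.assoc)
    also have "\<dots> \<in> V" using V in_V by (rule additive_subgroup_set_of_nat)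
    finally show False using v by simp
  qed
  show inj: "inj_on (\<lambda>(m, k). m + of_nat k * v) (V \<times> {..<CHAR('a)})"
  proof (rule inj_onI, clarsimp)
    fix m k m' k' assume h: "m \<in> V" "k < CHAR('a)" "m' \<in> V" "k' < CHAR('a)"
      "m + of_nat k * v = m' + of_nat k' * v"
    then have "k = k'" using aux[of m m' k k'] aux[of m' m k' k] by (metis linorder_neqE_nat)
    then show "m = m' \<and> k = k'" using h by simp
  qed
  show "card V' = card V * CHAR('a)"
    unfolding V'_def by (simp add: card_image[OF inj] card_cartesian_product)
  have memV': "m + of_nat k * v \<in> V'" if "m \<in> V" for m and k :: nat
  proof -
    have "(of_nat k :: 'a) = of_nat (k mod CHAR('a))" by (simp add: of_nat_eq_iff_cong_CHAR cong_def)
    then show ?thesis unfolding V'_def using that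
      by (intro image_eqI[of _ _ "(m, k mod CHAR('a))"]) auto
  qed
  show "additive_subgroup_set V'"
    unfolding additive_subgroup_set_def
  proof (intro conjI ballI)
    show "0 \<in> V'" using memV'[of 0 0] V by (simp add: additive_subgroup_setD)
    fix x y assume "x \<in> V'" "y \<in> V'"
    then obtain m k m' k' where x: "x = m + of_nat k * v" "m \<in> V" and y: "y = m' + of_nat k' * v" "m' \<in> V" "k' < CHAR('a)"
      by (auto simp: V'_def)
    have "(of_nat (CHAR('a) - k') :: 'a) = - of_nat k'"
      using y by (simp add: of_nat_diff)
    then have "x - y = (m - m') + of_nat (k + (CHAR('a) - k')) * v"
      by (simp add: x y algebra_simps)
    moreover have "m - m' \<in> V" using x y V by (simp add: additive_subgroup_setD)
    ultimately show "x - y \<in> V'" using memV'[of "m - m'" "k + (CHAR('a) - k')"] by simp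
  qed
qed

text \<open>A largest subgroup whose order is a power of the characteristic is everything: a missing
  element would enlarge it by the factor \<open>CHAR('a)\<close>.\<close>

lemma card_finite_field: "\<exists>a. CARD('a :: finite_field) = CHAR('a) ^ a"
proof -
  let ?P = "\<lambda>V :: 'a set. additive_subgroup_set V \<and> (\<exists>a. card V = CHAR('a) ^ a)"
  have "?P {0}" by (auto simp: additive_subgroup_set_def intro!: exI[of _ 0])
  moreover have "\<forall>V. ?P V \<longrightarrow> card V < Suc (CARD('a))" by (simp add: card_mono less_Suc_eq_le)
  ultimately have "\<exists>V. ?P V \<and> (\<forall>W. ?P W \<longrightarrow> card W \<le> card V)"
    by (rule ex_has_greatest_nat)
  then obtain V where V: "?P V" "\<forall>W. ?P W \<longrightarrow> card W \<le> card V" by blast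
  have "V = UNIV"
  proof (rule ccontr)
    assume "V \<noteq> UNIV"
    then obtain v where v: "v \<notin> V" by auto
    obtain a where a: "card V = CHAR('a) ^ a" using V by auto
    have "additive_subgroup_set V" using V(1) by simp
    from additive_subgroup_extend(2,3)[OF this v]
    obtain W :: "'a set" where W: "additive_subgroup_set W" "card W = card V * CHAR('a)" by (rule that)
    then have "?P W" by (auto simp: a intro!: exI[of _ "Suc a"])
    then have "card V * CHAR('a) \<le> card V" using V(2)[rule_format, of W] W(2) by simp
    moreover have "0 < card V" by (simp add: a)
    moreover have "1 < CHAR('a)" using CHAR_prime prime_gt_1_nat by blast
    ultimately show False by simp
  qed
  then show ?thesis using V by auto
qed

text \<open>A largest proper subgroup \<open>V\<close> has index \<open>p\<close>, since adjoining
  any \<open>v\<close> outside it gives the whole field. The character sends an element of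
  \<open>V\<close> plus \<open>k\<close> times \<open>v\<close> to the \<open>k\<close>-th power of
  a primitive root of unity of order \<open>p\<close>.\<close>

lemma nontrivial_additive_char_exists:
  "\<exists>\<psi> :: 'a :: finite_field \<Rightarrow> complex. additive_char \<psi> \<and> (\<exists>x. \<psi> x \<noteq> 1)"
proof -
  let ?P = "\<lambda>V :: 'a set. additive_subgroup_set V \<and> V \<noteq> UNIV"
  define p where "p = CHAR('a)"
  have p: "1 < p" unfolding p_def using CHAR_prime prime_gt_1_nat by blast
  have "(1 :: 'a) \<notin> {0}" by simp
  then have "{0 :: 'a} \<noteq> UNIV" by blast
  then have "?P {0}" by (simp add: additive_subgroup_set_def)
  moreover have "\<forall>V. ?P V \<longrightarrow> card V < Suc (CARD('a))" by (simp add: card_mono less_Suc_eq_le)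
  ultimately have "\<exists>V. ?P V \<and> (\<forall>W. ?P W \<longrightarrow> card W \<le> card V)"
    by (rule ex_has_greatest_nat)
  then obtain V where V: "?P V" "\<forall>W. ?P W \<longrightarrow> card W \<le> card V" by blast
  obtain v where v: "v \<notin> V" using V by auto
  let ?g = "\<lambda>(m, k). m + of_nat k * v"
  have inj: "inj_on ?g (V \<times> {..<p})" and ext: "additive_subgroup_set (?g ` (V \<times> {..<p}))"
    and card: "card (?g ` (V \<times> {..<p})) = card V * p"
    using additive_subgroup_extend[OF conjunct1[OF V(1)] v] unfolding p_def by simp_all
  have "card V < card V * p"
  proof -
    have "card V > 0" using V by (auto simp: card_gt_0_iff additive_subgroup_set_def)
    then show ?thesis using p by simp
  qed
  then have UNIV: "?g ` (V \<times> {..<p}) = UNIV"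
    using V(2) ext card by (metis not_less)
  define k where "k x = snd (inv_into (V \<times> {..<p}) ?g x)" for x
  have k: "k (m + of_nat j * v) = j mod p" if "m \<in> V" for m j
  proof -
    have "(of_nat j :: 'a) = of_nat (j mod p)" unfolding p_def by (simp add: of_nat_eq_iff_cong_CHAR cong_def)
    then have "m + of_nat j * v = ?g (m, j mod p)" by simp
    moreover have "inv_into (V \<times> {..<p}) ?g (?g (m, j mod p)) = (m, j mod p)"
      using that p by (intro inv_into_f_f[OF inj]) auto
    ultimately show ?thesis unfolding k_def by (metis snd_conv)
  qed
  define \<psi> where "\<psi> x = cis (2 * pi * real (k x) / real p)" for x
  have \<psi>: "\<psi> (m + of_nat j * v) = cis (2 * pi * real j / real p)" if "m \<in> V" for m j
  proof -
    have "real j = real (j mod p) + real p * real (j div p)"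
      by (metis mod_mult_div_eq of_nat_add of_nat_mult)
    then have "2 * pi * real j / real p = 2 * pi * real (j mod p) / real p + 2 * pi * real (j div p)"
      using p by (simp add: field_simps)
    then have "cis (2 * pi * real j / real p) = cis (2 * pi * real (j mod p) / real p) * cis (2 * pi * real (j div p))"
      by (simp only: cis_mult)
    also have "cis (2 * pi * real (j div p)) = 1" by (rule cis_multiple_2pi) simp
    finally show ?thesis by (simp add: \<psi>_def k[OF that])
  qed
  have rep: "\<exists>m j. m \<in> V \<and> x = m + of_nat j * v" for x :: 'a
  proof -
    have "x \<in> ?g ` (V \<times> {..<p})" by (simp only: UNIV UNIV_I)
    then show ?thesis by auto
  qed
  have "\<psi> (x + y) = \<psi> x * \<psi> y" for x y
  proof -
    obtain m j where x: "m \<in> V" "x = m + of_nat j * v" using rep[of x] by blast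
    obtain m' j' where y: "m' \<in> V" "y = m' + of_nat j' * v" using rep[of y] by blast
    have "x + y = (m + m') + of_nat (j + j') * v" by (simp add: x y algebra_simps)
    moreover have "m + m' \<in> V" using V x y by (auto intro: additive_subgroup_setD)
    ultimately have "\<psi> (x + y) = cis (2 * pi * real (j + j') / real p)"
      using \<psi>[of "m + m'" "j + j'"] by simp
    moreover have "\<psi> x = cis (2 * pi * real j / real p)" "\<psi> y = cis (2 * pi * real j' / real p)"
      using \<psi> x y by auto
    ultimately show ?thesis by (simp add: cis_mult add_divide_distrib ring_distribs)
  qed
  moreover have "\<psi> v \<noteq> 1"
  proof
    assume "\<psi> v = 1"
    then have "cis (2 * pi / real p) = 1" using \<psi>[of 0 1] V by (simp add: additive_subgroup_set_def)
    then have "cos (2 * pi / real p) = 1" by (simp add: complex_eq_iff)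
    then obtain n :: int where n: "2 * pi / real p = of_int n * 2 * pi" using cos_one_2pi_int by auto
    then have "real_of_int n * real p = 1" using p by (simp add: field_simps)
    then have "n * int p = 1" by (metis of_int_eq_1_iff of_int_mult of_int_of_nat_eq)
    then show False using p by (auto simp: zmult_eq_1_iff)
  qed
  moreover have "norm (\<psi> x) = 1" for x by (simp add: \<psi>_def)
  ultimately show ?thesis unfolding additive_char_def by blast
qed

lemma additive_char_sum:
  assumes "additive_char \<psi>" "\<exists>x. \<psi> x \<noteq> 1"
  shows "(\<Sum>x\<in>UNIV. \<psi> x) = 0"
proof -
  obtain w where w: "\<psi> w \<noteq> 1" using assms by auto
  have "(\<Sum>x\<in>UNIV. \<psi> x) = (\<Sum>x\<in>UNIV. \<psi> (x + w))"
    by (rule sum.reindex_bij_witness[of _ "\<lambda>x. x + w" "\<lambda>x. x - w"]) auto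
  also have "\<dots> = (\<Sum>x\<in>UNIV. \<psi> x) * \<psi> w"
    using assms by (simp add: additive_charD sum_distrib_right)
  finally show ?thesis using w by simp
qed

section \<open>Exponential sums over the extensions of a finite field\<close>

lemma prime_CHAR_alg_closure [simp]: "prime CHAR('a :: finite_field alg_closure)"
  by simp

lemma alg_closure_power_card_add:
  fixes x y :: "'a :: finite_field alg_closure"
  shows "(x + y) ^ (CARD('a) ^ n) = x ^ (CARD('a) ^ n) + y ^ (CARD('a) ^ n)"
proof -
  obtain a where "CARD('a) = CHAR('a) ^ a" using card_finite_field by blast
  then show ?thesis by (intro freshmans_dream'[of _ "a * n"]) (simp_all add: power_mult)
qed

text \<open>For positive \<open>n\<close> this is the subfield with \<open>CARD('a) ^ n\<close>
  elements. For \<open>n = 0\<close> the equation is trivial and the set is the whole algebraic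
  closure, hence the assumption \<open>1 \<le> n\<close> in the counting lemmas.\<close>

definition ext_field :: "nat \<Rightarrow> 'a :: finite_field alg_closure set" where
  "ext_field n = {x. x ^ (CARD('a) ^ n) = x}"

lemma CARD_finite_field_ge2: "2 \<le> CARD('a :: finite_field)"
proof -
  have "card {0 :: 'a, 1} \<le> CARD('a)" by (intro card_mono) auto
  then show ?thesis by simp
qed

text \<open>The polynomial T^N - T has derivative -1, because \<open>N\<close> is zero in the field.
  So its roots are simple, and there are as many as its degree.\<close>

lemma card_ext_field:
  assumes "1 \<le> n"
  shows "finite (ext_field n :: 'a :: finite_field alg_closure set)"
    and "card (ext_field n :: 'a alg_closure set) = CARD('a) ^ n"
proof -
  define N where "N = CARD('a) ^ n"
  define p :: "'a alg_closure poly" where "p = Polynomial.monom 1 N - Polynomial.monom 1 1"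
  have N: "1 < N" unfolding N_def using CARD_finite_field_ge2[where 'a = 'a] assms
    by (metis One_nat_def Suc_1 Suc_le_lessD one_less_power zero_less_one_class.zero_less_one less_le_trans)
  have "of_nat (CARD('a)) = (0 :: 'a)"
  proof -
    obtain a where a: "CARD('a) = CHAR('a) ^ a" using card_finite_field by blast
    then have "a \<noteq> 0" using CARD_finite_field_ge2[where 'a = 'a] by (cases a) auto
    then show ?thesis by (simp add: a)
  qed
  then have N0: "of_nat N = (0 :: 'a alg_closure)"
    using assms by (simp add: N_def of_nat_eq_0_iff_char_dvd)
  have deg: "degree p = N" and lc: "p \<noteq> 0"
  proof -
    show "degree p = N" unfolding p_def diff_conv_add_uminus using N
      by (subst degree_add_eq_left) (auto simp: degree_monom_eq)
    then show "p \<noteq> 0" using N by auto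
  qed
  have "pderiv p = - 1"
    by (simp add: p_def pderiv_diff pderiv_monom N0 monom_0 one_pCons)
  then have sqf: "Polynomial.order x p = 1" if "poly p x = 0" for x
  proof -
    obtain g where g: "p = [:- x, 1:] * g" using \<open>poly p x = 0\<close> by (auto simp: poly_eq_0_iff_dvd)
    have "poly (pderiv p) x = poly g x" by (simp add: g pderiv_mult pderiv_pCons del: mult_pCons_left)
    then have "poly g x \<noteq> 0" using \<open>pderiv p = - 1\<close> by auto
    then have "Polynomial.order x g = 0" by (rule order_0I)
    moreover have "[:- x, 1:] * g \<noteq> 0" using lc g by metis
    moreover have "Polynomial.order x [:- x, 1:] = 1" using order_power_n_n[of x 1] by simp
    ultimately show ?thesis unfolding g by (metis add.right_neutral order_mult)
  qed
  have set: "ext_field n = {x. poly p x = 0}"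
    by (auto simp: ext_field_def p_def poly_monom N_def)
  show "finite (ext_field n :: 'a alg_closure set)"
    unfolding set using lc by (rule poly_roots_finite)
  have "Polynomial.lead_coeff p = 1"
    using N deg by (simp add: p_def)
  then have "N = size (proots p)" by (simp add: mset_poly_proots deg)
  also have "\<dots> = (\<Sum>x | poly p x = 0. Polynomial.order x p)"
    using lc by (simp add: size_multiset_overloaded_eq)
  also have "\<dots> = (\<Sum>x | poly p x = 0. 1)"
    using sqf by (intro sum.cong) auto
  also have "\<dots> = card {x. poly p x = 0}" by simp
  finally show "card (ext_field n :: 'a alg_closure set) = CARD('a) ^ n" by (simp add: set N_def)
qed

lemma ext_field_1: "ext_field 1 = range (to_ac :: 'a :: finite_field \<Rightarrow> 'a alg_closure)"
proof (rule sym, rule card_subset_eq)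
  show "finite (ext_field 1 :: 'a alg_closure set)" by (rule card_ext_field) simp
  show "range (to_ac :: 'a \<Rightarrow> _) \<subseteq> ext_field 1"
    by (auto simp: ext_field_def finite_field_power_card_eq_same simp flip: to_ac_power)
  show "card (range (to_ac :: 'a \<Rightarrow> _)) = card (ext_field 1 :: 'a alg_closure set)"
    using card_image[OF inj_to_ac] by (simp add: card_ext_field)
qed

lemma subring_ext_field: "subring_set (ext_field n :: 'a :: finite_field alg_closure set)"
proof -
  have "(x - y) ^ (CARD('a) ^ n) = x ^ (CARD('a) ^ n) - y ^ (CARD('a) ^ n)" for x y :: "'a alg_closure"
    using alg_closure_power_card_add[of "x - y" y n] by (simp add: algebra_simps)
  then show ?thesis by (auto simp: subring_set_def ext_field_def power_mult_distrib)
qed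

lemma ext_field_1_subset: "ext_field 1 \<subseteq> ext_field n"
proof
  fix x :: "'a alg_closure" assume "x \<in> ext_field 1"
  then have x: "x ^ CARD('a) = x" by (simp add: ext_field_def)
  have "x ^ (CARD('a) ^ n) = x" by (induction n) (simp_all add: x power_mult)
  then show "x \<in> ext_field n" by (simp add: ext_field_def)
qed

lemma to_ac_in_ext_field [simp]: "to_ac c \<in> ext_field n"
  using ext_field_1_subset ext_field_1 by blast

definition frob :: "'a :: finite_field alg_closure \<Rightarrow> 'a alg_closure" where
  "frob x = x ^ CARD('a)"

lemma frob_simps [simp]:
  fixes x y :: "'a :: finite_field alg_closure"
  shows "frob (0 :: 'a alg_closure) = 0" "frob (1 :: 'a alg_closure) = 1" "frob (x + y) = frob x + frob y"
    "frob (x * y) = frob x * frob y" "frob (- x) = - frob x"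
proof -
  show add: "frob (x + y) = frob x + frob y" for x y :: "'a alg_closure"
    using alg_closure_power_card_add[of x y 1] by (simp add: frob_def)
  show 0: "frob (0 :: 'a alg_closure) = 0" by (simp add: frob_def)
  show "frob (- x) = - frob x" for x :: "'a alg_closure"
    using add[of x "- x"] 0 by (simp add: add_eq_0_iff)
qed (auto simp: frob_def power_mult_distrib)

lemma frob_power: "frob (x ^ k) = frob x ^ k"
  by (simp add: frob_def mult.commute flip: power_mult)

lemma frob_sum: "frob (sum f A) = (\<Sum>i\<in>A. frob (f i))"
  by (induction A rule: infinite_finite_induct) auto

lemma frob_funpow: "(frob ^^ n) (x :: 'a :: finite_field alg_closure) = x ^ (CARD('a) ^ n)"
  by (induction n) (simp_all add: frob_def flip: power_mult add: mult.commute)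

lemma frob_funpow_fixed: "(frob ^^ n) x = x \<longleftrightarrow> x \<in> ext_field n"
  by (simp add: frob_funpow ext_field_def)

lemma inj_frob: "inj frob"
proof (rule injI)
  fix x y :: "'a alg_closure" assume "frob x = frob y"
  then have "frob (x + - y) = 0" by (simp del: add_uminus_conv_diff)
  then show "x = y" by (simp add: frob_def)
qed

lemma frob_fixed: "frob x = x \<longleftrightarrow> x \<in> range to_ac"
  unfolding ext_field_1[symmetric] by (simp add: ext_field_def frob_def)

lemma frob_to_ac [simp]: "frob (to_ac c) = to_ac c"
  using frob_fixed by blast

lemma map_poly_frob_mult: "map_poly frob (p * q) = map_poly frob p * map_poly frob q"
  by (rule poly_eqI) (simp add: coeff_map_poly coeff_mult frob_sum)

lemma map_poly_frob_mset_poly: "map_poly frob (mset_poly D) = mset_poly (image_mset frob D)"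
proof (induction D)
  case (add x D)
  have "mset_poly (add_mset y E) = [:- y, 1:] * mset_poly E" for y and E :: "'a alg_closure multiset"
    by (simp add: mset_poly_def)
  then show ?case using add
    by (simp del: mult_pCons_left add: map_poly_frob_mult) (simp add: map_poly_pCons)
qed (simp add: mset_poly_def)

lemma poly_frob:
  assumes "\<And>i. poly.coeff F i \<in> range to_ac"
  shows "poly F (frob x) = frob (poly F x)"
proof -
  have "frob (poly.coeff F i) = poly.coeff F i" for i using assms[of i] by (simp add: frob_fixed)
  then show ?thesis by (simp add: poly_altdef frob_sum frob_power)
qed

section \<open>The L-function of an exponential sum\<close>

locale exponential_sum =
  fixes \<psi> :: "'a :: finite_field \<Rightarrow> complex" and f :: "'a poly"
  assumes \<psi>: "additive_char \<psi>" and \<psi>_nontrivial: "\<exists>x. \<psi> x \<noteq> 1"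
    and deg_nonzero: "of_nat (degree f) \<noteq> (0 :: 'a)"
begin

definition F where "F = map_poly to_ac f"
definition tr where "tr D = (\<Sum>x\<in>#D. poly F x)"
definition chr where "chr D = \<psi> (of_ac (tr D))"
text \<open>As root multisets, these correspond to the monic polynomials of degree \<open>n\<close>
  over the base field, that is, to the effective divisors of degree \<open>n\<close> on the affine
  line.\<close>

definition stable where "stable n = {D :: 'a alg_closure multiset. size D = n \<and> image_mset frob D = D}"
definition S where "S n = (\<Sum>x\<in>ext_field n. chr (orbit_mset frob n x))"
text \<open>The coefficients of the L-function; \<open>S\<close> collects the coefficients of its
  logarithmic derivative, as \<open>a_recursion\<close> shows.\<close>

definition a where "a n = (\<Sum>D\<in>stable n. chr D)"

lemma degree_F [simp]: "degree F = degree f"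
  by (simp add: F_def degree_map_poly)

lemma degree_pos: "1 \<le> degree f"
  using deg_nonzero by (cases "degree f") auto

lemma coeff_F: "poly.coeff F i = to_ac (poly.coeff f i)"
  by (simp add: F_def coeff_map_poly)

lemma poly_F_frob: "poly F (frob x) = frob (poly F x)"
  by (rule poly_frob) (simp add: coeff_F)

lemma tr_add: "tr (D + E) = tr D + tr E"
  by (simp add: tr_def)

text \<open>Frobenius commutes with \<open>F\<close>, whose coefficients come from the base field,
  and it permutes the entries of \<open>D\<close>, so it fixes the sum.\<close>

lemma tr_stable:
  assumes "image_mset frob D = D"
  shows "tr D \<in> range to_ac"
proof -
  have "frob (tr D) = tr (image_mset frob D)"
    unfolding tr_def by (induction D) (auto simp: poly_F_frob)
  then show ?thesis using assms by (simp add: frob_fixed[symmetric])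
qed

lemma chr_add:
  assumes "image_mset frob D = D" "image_mset frob E = E"
  shows "chr (D + E) = chr D * chr E"
proof -
  obtain x y where "tr D = to_ac x" "tr E = to_ac y"
    using tr_stable[OF assms(1)] tr_stable[OF assms(2)] by blast
  then show ?thesis using \<psi>
    by (simp add: chr_def tr_add additive_charD flip: to_ac_add)
qed

lemma orbit_stable: "x \<in> ext_field n \<Longrightarrow> image_mset frob (orbit_mset frob n x) = orbit_mset frob n x"
  by (rule image_orbit_mset) (simp add: frob_funpow_fixed)

text \<open>Every entry has a Frobenius period of at most \<open>n\<close>, so it lies in one of
  finitely many finite fields.\<close>

lemma finite_stable: "finite (stable n)"
proof (rule finite_subset)
  let ?A = "\<Union>k\<in>{1..n}. ext_field k :: 'a alg_closure set"
  show "stable n \<subseteq> mset ` {xs. set xs \<subseteq> ?A \<and> length xs = n}"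
  proof
    fix D assume D: "D \<in> stable n"
    obtain xs where xs: "D = mset xs" by (metis ex_mset)
    have "image_mset frob D = D" using D by (simp add: stable_def)
    have "x \<in> ?A" if x: "x \<in># D" for x
    proof -
      obtain k where "1 \<le> k" "k \<le> size D" "(frob ^^ k) x = x"
        using stable_mset_periodic[OF inj_frob \<open>image_mset frob D = D\<close> x] by blast
      then show ?thesis using D by (auto simp: stable_def frob_funpow_fixed)
    qed
    then show "D \<in> mset ` {xs. set xs \<subseteq> ?A \<and> length xs = n}"
      using D xs by (intro image_eqI[of _ _ xs]) (auto simp: stable_def)
  qed
  have "finite ?A" using card_ext_field(1) by (intro finite_UN_I) auto
  then show "finite (mset ` {xs. set xs \<subseteq> ?A \<and> length xs = n})"
    by (intro finite_imageI finite_lists_length_eq)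
qed

lemma a_0: "a 0 = 1"
proof -
  have "stable 0 = {{#}}" by (auto simp: stable_def)
  then show ?thesis using \<psi> by (simp add: a_def chr_def tr_def additive_charD)
qed

text \<open>With L the generating function of \<open>a\<close>, this says that L' is L times the
  series with coefficients S(k + 1). A closed walk can be marked in a stable multiset of size
  \<open>n\<close> in exactly \<open>n\<close> ways, and removing it leaves an arbitrary stable
  multiset of the remaining size.\<close>

lemma a_recursion: "of_nat n * a n = (\<Sum>k=1..n. S k * a (n - k))"
proof -
  have st: "image_mset frob D = D" "size D = n" if "D \<in> stable n" for D n
    using that by (auto simp: stable_def)
  let ?Z = "Sigma {1..n} (\<lambda>k. (ext_field k :: 'a alg_closure set) \<times> stable (n - k))"
  let ?join = "\<lambda>(k, x :: 'a alg_closure, E). (orbit_mset frob k x + E, (k, x))"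
  let ?split = "\<lambda>(D, (k, x :: 'a alg_closure)). (k, x, D - orbit_mset frob k x)"
  have fin: "finite (ext_field k :: 'a alg_closure set)" if "k \<in> {1..n}" for k
    using that by (intro card_ext_field) auto
  have "of_nat n * a n = (\<Sum>D\<in>stable n. \<Sum>z\<in>orbits_in frob D. chr D)"
    unfolding a_def sum_distrib_left
    by (intro sum.cong) (simp_all add: st card_orbits_in(2)[OF inj_frob])
  also have "\<dots> = (\<Sum>(D, z)\<in>Sigma (stable n) (orbits_in frob). chr D)"
    using card_orbits_in(1)[OF inj_frob st(1)] finite_stable by (intro sum.Sigma) auto
  also have "\<dots> = (\<Sum>(k, x, E)\<in>?Z.
      chr (orbit_mset frob k x) * chr E)"
  proof (rule sum.reindex_bij_witness[of _ ?join ?split])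
    fix z assume "z \<in> Sigma (stable n) (orbits_in frob)"
    then obtain D k x where z: "z = (D, (k, x))" and D: "D \<in> stable n" and kx: "(k, x) \<in> orbits_in frob D"
      by auto
    have k: "1 \<le> k" "k \<le> n" and x: "x \<in> ext_field k" and sub: "orbit_mset frob k x \<subseteq># D"
      using kx orbits_in_bounds[OF kx] st[OF D] by (auto simp: orbits_in_def frob_funpow_fixed)
    have "image_mset frob (D - orbit_mset frob k x) = D - orbit_mset frob k x"
      using st[OF D] orbit_stable[OF x] sub by (simp add: image_mset_Diff)
    then have E: "D - orbit_mset frob k x \<in> stable (n - k)"
      using st[OF D] sub by (simp add: stable_def size_Diff_submset)
    show "?join (?split z) = z"
      using sub by (simp add: z)
    show "?split z \<in> ?Z"
      using k x E by (simp add: z)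
    have "chr D = chr (orbit_mset frob k x + (D - orbit_mset frob k x))" using sub by simp
    also have "\<dots> = chr (orbit_mset frob k x) * chr (D - orbit_mset frob k x)"
      using orbit_stable[OF x] st(1)[OF E] by (rule chr_add)
    finally show "(case ?split z of (k, x, E) \<Rightarrow>
        chr (orbit_mset frob k x) * chr E) = (case z of (D, z) \<Rightarrow> chr D)"
      by (simp add: z)
  next
    fix z assume "z \<in> ?Z"
    then obtain k x E where z: "z = (k, x, E)" and k: "1 \<le> k" "k \<le> n"
      and x: "x \<in> ext_field k" and E: "E \<in> stable (n - k)"
      by auto
    show "?split (?join z) = z"
      by (simp add: z)
    show "?join z \<in> Sigma (stable n) (orbits_in frob)"
      using k x st[OF E] orbit_stable[OF x] by (auto simp: z stable_def orbits_in_def frob_funpow_fixed)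
  qed
  also have "\<dots> = (\<Sum>k=1..n. \<Sum>(x, E)\<in>ext_field k \<times> stable (n - k). chr (orbit_mset frob k x) * chr E)"
    using fin finite_stable by (subst sum.Sigma) auto
  also have "\<dots> = (\<Sum>k=1..n. S k * a (n - k))"
    by (intro sum.cong refl) (simp add: S_def a_def sum_product sum.cartesian_product)
  finally show ?thesis .
qed

lemma S_1: "S 1 = (\<Sum>x\<in>UNIV. \<psi> (poly f x))"
proof -
  have "chr (orbit_mset frob 1 (to_ac x)) = \<psi> (poly f x)" for x
  proof -
    have "poly F (to_ac x) = to_ac (poly f x)"
      by (simp add: poly_altdef coeff_F to_ac_sum)
    then show ?thesis by (simp add: chr_def tr_def orbit_mset_def lessThan_Suc)
  qed
  then show ?thesis
    unfolding S_def ext_field_1 by (subst sum.reindex[OF inj_to_ac]) simp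
qed

lemma tr_power_sum: "tr D = (\<Sum>k\<le>degree f. poly.coeff F k * power_sum k D)"
  unfolding tr_def power_sum_def
  by (induction D) (auto simp: poly_altdef sum.distrib ring_distribs)

text \<open>The coefficient that is moved enters the power sum of order \<open>degree f\<close>
  linearly and does not enter the power sums of lower order.\<close>

definition shift where
  "shift t D = proots (mset_poly D + Polynomial.monom (to_ac t) (size D - degree f))"

text \<open>The trace is a combination of power sums of order at most \<open>degree f\<close>, and
  only the last of these changes. Stability is preserved because \<open>t\<close> belongs to the
  base field, so the new polynomial is still fixed by Frobenius.\<close>

lemma shift_props:
  assumes "degree f \<le> n" "D \<in> stable n"
  shows "shift t D \<in> stable n"
    and "mset_poly (shift t D) = mset_poly D + Polynomial.monom (to_ac t) (n - degree f)"
    and "tr (shift t D) = tr D - to_ac (lead_coeff f * of_nat (degree f) * t)"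
proof -
  define m where "m = Polynomial.monom (to_ac t) (n - degree f)"
  have D: "size D = n" "image_mset frob D = D" using assms by (auto simp: stable_def)
  have m: "degree m < n" unfolding m_def
    using degree_pos assms degree_monom_le[of "to_ac t" "n - degree f"] by linarith
  then have deg: "degree (mset_poly D + m) = n"
    using D by (subst degree_add_eq_left) (auto simp: mset_poly_monic)
  have "poly.coeff m n = 0" using m by (rule coeff_eq_0)
  then have lc: "lead_coeff (mset_poly D + m) = 1"
    using mset_poly_monic[of D] D unfolding deg by simp
  show mp: "mset_poly (shift t D) = mset_poly D + Polynomial.monom (to_ac t) (n - degree f)"
    unfolding shift_def D using mset_poly_proots(1)[OF lc] by (simp add: m_def)
  have size: "size (shift t D) = n"
    unfolding shift_def D using mset_poly_proots(2)[OF lc] deg by (simp add: m_def)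
  have "mset_poly (image_mset frob (shift t D)) = map_poly frob (mset_poly D + m)"
    using mp by (simp add: map_poly_frob_mset_poly[symmetric] m_def)
  also have "\<dots> = map_poly frob (mset_poly D) + map_poly frob m"
    by (rule poly_eqI) (simp add: coeff_map_poly)
  also have "\<dots> = mset_poly D + m"
    by (simp add: map_poly_frob_mset_poly D m_def map_poly_monom)
  finally have "mset_poly (image_mset frob (shift t D)) = mset_poly (shift t D)"
    using mp by (simp add: m_def)
  then show "shift t D \<in> stable n" using size
    by (simp add: stable_def) (metis proots_mset_poly)
  have ps: "k < degree f \<Longrightarrow> power_sum k (shift t D) = power_sum k D"
      "power_sum (degree f) (shift t D) = power_sum (degree f) D - of_nat (degree f) * to_ac t" for k
    using power_sum_shift[of "degree f" D "shift t D" "to_ac t"] mp size D assms degree_pos by auto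
  have "tr (shift t D) = (\<Sum>k<degree f. poly.coeff F k * power_sum k (shift t D))
      + poly.coeff F (degree f) * power_sum (degree f) (shift t D)"
    by (simp add: tr_power_sum flip: lessThan_Suc_atMost)
  also have "\<dots> = (\<Sum>k<degree f. poly.coeff F k * power_sum k D)
      + poly.coeff F (degree f) * (power_sum (degree f) D - of_nat (degree f) * to_ac t)"
    by (simp add: ps)
  also have "\<dots> = tr D - poly.coeff F (degree f) * of_nat (degree f) * to_ac t"
    by (simp add: tr_power_sum right_diff_distrib mult.assoc flip: lessThan_Suc_atMost)
  finally show "tr (shift t D) = tr D - to_ac (lead_coeff f * of_nat (degree f) * t)"
    by (simp add: coeff_F)
qed

lemma shift_inverse:
  assumes "degree f \<le> n" "D \<in> stable n"
  shows "shift (- t) (shift t D) = D"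
proof -
  have s: "size (shift t D) = n" using shift_props(1)[OF assms] by (simp add: stable_def)
  have "mset_poly (shift t D) + Polynomial.monom (to_ac (- t)) (n - degree f) = mset_poly D"
    using shift_props(2)[OF assms, of t] by (simp add: minus_monom[symmetric])
  then show ?thesis unfolding shift_def[of "- t"] s by simp
qed

text \<open>The translation permutes the stable multisets and multiplies each \<open>chr D\<close>
  by \<open>\<psi> w\<close>, which differs from 1. Solving for \<open>t\<close> requires the degree
  of \<open>f\<close> to be invertible in the field.\<close>

lemma a_eq_0:
  assumes "degree f \<le> n"
  shows "a n = 0"
proof -
  obtain w where w: "\<psi> w \<noteq> 1" using \<psi>_nontrivial by blast
  have nz: "lead_coeff f * of_nat (degree f) \<noteq> 0" using deg_nonzero degree_pos by auto
  define t where "t = - w / (lead_coeff f * of_nat (degree f))"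
  have t: "lead_coeff f * of_nat (degree f) * t = - w" using nz by (simp add: t_def)
  have "a n = (\<Sum>D\<in>stable n. chr (shift t D))"
    unfolding a_def
  proof (rule sum.reindex_bij_witness[of _ "shift t" "shift (- t)"])
    fix D assume D: "D \<in> stable n"
    show "shift (- t) (shift t D) = D" "shift t (shift (- t) D) = D"
      using shift_inverse[OF assms D, of t] shift_inverse[OF assms D, of "- t"] by auto
    show "shift t D \<in> stable n" "shift (- t) D \<in> stable n"
      using shift_props(1)[OF assms D] by auto
    then show "chr (shift t (shift (- t) D)) = chr D"
      using shift_inverse[OF assms D, of "- t"] by simp
  qed
  also have "chr (shift t D) = \<psi> w * chr D" if D: "D \<in> stable n" for D
  proof -
    obtain x where x: "tr D = to_ac x" using tr_stable D by (auto simp: stable_def)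
    have "tr (shift t D) = to_ac (x + w)"
      using shift_props(3)[OF assms D, of t] by (simp add: x t)
    then show ?thesis using \<psi> by (simp add: chr_def x additive_charD mult.commute del: to_ac_add)
  qed
  then have "(\<Sum>D\<in>stable n. chr (shift t D)) = \<psi> w * a n"
    by (simp add: a_def sum_distrib_left)
  finally show ?thesis using w by simp
qed

end

section \<open>Traces, and the bound for the sums over extensions of even degree\<close>

context exponential_sum
begin

definition trace where "trace n y = (\<Sum>i<n. y ^ (CARD('a) ^ i))" for y :: "'a alg_closure"

lemma trace_in_range:
  assumes "y \<in> ext_field n"
  shows "trace n y \<in> range to_ac"
proof -
  have "trace n y = (\<Sum>z\<in>#orbit_mset frob n y. z)"
    unfolding trace_def orbit_mset_def frob_funpow by (simp add: sum_unfold_sum_mset)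
  moreover have "frob (\<Sum>z\<in>#D. z) = (\<Sum>z\<in>#image_mset frob D. z)" for D :: "'a alg_closure multiset"
    by (induction D) auto
  ultimately have "frob (trace n y) = trace n y"
    using orbit_stable[OF assms] by metis
  then show ?thesis by (simp add: frob_fixed)
qed

lemma trace_add: "trace n (x + y) = trace n x + trace n y"
  by (simp add: trace_def alg_closure_power_card_add sum.distrib)

lemma trace_scale: "c \<in> range to_ac \<Longrightarrow> trace n (c * y) = c * trace n y"
proof -
  assume "c \<in> range to_ac"
  then have "c \<in> ext_field i" for i using ext_field_1_subset[of i] ext_field_1 by blast
  then have "c ^ (CARD('a) ^ i) = c" for i by (simp add: ext_field_def)
  then show ?thesis by (simp add: trace_def power_mult_distrib sum_distrib_left)
qed

text \<open>On the extension of degree \<open>n\<close>, raising to the power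
  \<open>CARD('a)\<close> only permutes the summands of the trace cyclically.\<close>

lemma trace_artin_schreier:
  assumes "y \<in> ext_field n"
  shows "trace n (y ^ CARD('a) - y) = 0"
proof -
  have "trace n (y ^ CARD('a) - y) + trace n y = trace n (y ^ CARD('a))"
    by (simp flip: trace_add)
  also have "\<dots> = (\<Sum>i<n. y ^ (CARD('a) ^ Suc i))"
    by (simp add: trace_def flip: power_mult)
  also have "\<dots> = trace n y"
  proof (cases n)
    case (Suc m)
    have "(\<Sum>i<n. y ^ (CARD('a) ^ Suc i)) = (\<Sum>i<m. y ^ (CARD('a) ^ Suc i)) + y"
      using assms by (simp add: Suc ext_field_def)
    also have "\<dots> = trace n y"
      unfolding trace_def Suc by (subst sum.lessThan_Suc_shift) simp
    finally show ?thesis .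
  qed (simp add: trace_def)
  finally show ?thesis by simp
qed

text \<open>The trace is a nonzero polynomial function of degree at most
  \<open>CARD('a) ^ (n - 1)\<close>, too small to vanish on the whole extension. Scaling by elements
  of the base field then reaches every value.\<close>

lemma trace_surj:
  assumes "1 \<le> n"
  obtains y where "y \<in> ext_field n" "trace n y = to_ac u"
proof -
  define p :: "'a alg_closure poly" where "p = (\<Sum>i<n. Polynomial.monom 1 (CARD('a) ^ i))"
  have q: "2 \<le> CARD('a)" by (rule CARD_finite_field_ge2)
  have "poly.coeff p 1 = (\<Sum>i<n. if i = 0 then 1 else 0)"
    unfolding p_def coeff_sum
  proof (intro sum.cong refl)
    fix i
    have "CARD('a) ^ i = 1 \<longleftrightarrow> i = 0" using q by auto
    then show "poly.coeff (Polynomial.monom 1 (CARD('a) ^ i)) 1 = (if i = 0 then 1 else (0 :: 'a alg_closure))"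
      by simp
  qed
  then have "p \<noteq> 0" using assms by auto
  have "degree p \<le> CARD('a) ^ (n - 1)"
    unfolding p_def
  proof (rule degree_sum_le)
    fix i assume "i \<in> {..<n}"
    then have "CARD('a) ^ i \<le> CARD('a) ^ (n - 1)" using q by (intro power_increasing) auto
    then show "degree (Polynomial.monom (1 :: 'a alg_closure) (CARD('a) ^ i)) \<le> CARD('a) ^ (n - 1)"
      using degree_monom_le order_trans by blast
  qed simp
  also have "\<dots> < CARD('a) ^ n" using q assms by (intro power_strict_increasing) auto
  also have "\<dots> = card (ext_field n :: 'a alg_closure set)" using assms by (simp add: card_ext_field)
  finally have "\<not> ext_field n \<subseteq> {x. poly p x = 0}"
    using card_poly_roots_bound[OF \<open>p \<noteq> 0\<close>] card_mono[OF poly_roots_finite[OF \<open>p \<noteq> 0\<close>]]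
    by (meson le_trans not_le)
  then obtain x where x: "x \<in> ext_field n" "poly p x \<noteq> 0" by blast
  have tx: "trace n x \<noteq> 0" using x(2) by (simp add: p_def poly_sum poly_monom trace_def)
  obtain b where b: "trace n x = to_ac b" using trace_in_range[OF x(1)] by blast
  show thesis
  proof (rule that[of "to_ac (u / b) * x"])
    have "to_ac (u / b) \<in> ext_field n" by (rule to_ac_in_ext_field)
    then show "to_ac (u / b) * x \<in> ext_field n"
      using x(1) subring_ext_field by (rule subring_setD(4)[rotated])
    have "b \<noteq> 0" using tx b by auto
    then show "trace n (to_ac (u / b) * x) = to_ac u"
      by (simp add: trace_scale b del: to_ac_divide flip: to_ac_mult)
  qed
qed

definition ext_char where "ext_char n y = \<psi> (of_ac (trace n y))"

lemma ext_char_add: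
  assumes "x \<in> ext_field n" "y \<in> ext_field n"
  shows "ext_char n (x + y) = ext_char n x * ext_char n y"
proof -
  obtain s t where "trace n x = to_ac s" "trace n y = to_ac t"
    using trace_in_range assms by blast
  then show ?thesis using \<psi> by (simp add: ext_char_def trace_add additive_charD flip: to_ac_add)
qed

lemma ext_char_sum:
  assumes "1 \<le> n"
  shows "(\<Sum>x\<in>ext_field n. ext_char n x) = 0"
proof -
  obtain u where u: "\<psi> u \<noteq> 1" using \<psi>_nontrivial by blast
  obtain w where w: "w \<in> ext_field n" "trace n w = to_ac u" using trace_surj[OF assms] by blast
  have "(\<Sum>x\<in>ext_field n. ext_char n x) = (\<Sum>x\<in>ext_field n. ext_char n (x + w))"
    by (rule sum.reindex_bij_witness[of _ "\<lambda>x. x + w" "\<lambda>x. x - w"])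
       (use w in \<open>auto intro: subring_setD[OF subring_ext_field]\<close>)
  also have "\<dots> = (\<Sum>x\<in>ext_field n. ext_char n x) * ext_char n w"
    using w by (simp add: ext_char_add sum_distrib_right)
  finally show ?thesis using w u by (simp add: ext_char_def)
qed

lemma poly_F_in: "x \<in> ext_field n \<Longrightarrow> poly F x \<in> ext_field n"
proof -
  assume x: "x \<in> ext_field n"
  have "poly.coeff F i \<in> ext_field n" for i
    by (simp add: coeff_F)
  moreover have "x ^ k \<in> ext_field n" for k
    using x by (induction k) (auto intro: subring_setD[OF subring_ext_field])
  ultimately show ?thesis
    unfolding poly_altdef by (intro subring_set_sum subring_ext_field subring_setD(4)) auto
qed

text \<open>Along the Frobenius walk of \<open>x\<close> the values of \<open>F\<close> are the
  conjugates of \<open>poly F x\<close>, so that their sum is a trace.\<close>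

lemma S_altdef: "S n = (\<Sum>x\<in>ext_field n. ext_char n (poly F x))"
proof -
  have "poly F ((frob ^^ i) x) = poly F x ^ (CARD('a) ^ i)" for i x
    by (induction i) (simp_all add: poly_F_frob, simp add: frob_def mult.commute flip: power_mult)
  then show ?thesis
    unfolding S_def chr_def ext_char_def tr_def trace_def orbit_mset_def
    by (simp add: sum_unfold_sum_mset image_mset.compositionality comp_def)
qed

lemma coprime_degree_card: "coprime (degree f) CARD('a)"
proof -
  obtain a where a: "CARD('a) = CHAR('a) ^ a" using card_finite_field by blast
  have "\<not> CHAR('a) dvd degree f" using deg_nonzero by (simp add: of_nat_eq_0_iff_char_dvd)
  then have "coprime CHAR('a) (degree f)" by (intro prime_imp_coprime) auto
  then show ?thesis unfolding a by (simp add: coprime_commute)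
qed

text \<open>Stepanov's bound for \<open>F - [:w:]\<close> counts the values of \<open>x\<close> that
  occur, and each of them carries at most \<open>q\<close> points. The bound does not depend on
  \<open>w\<close>.\<close>

lemma artin_schreier_count:
  fixes m :: nat
  defines "q \<equiv> CARD('a)" and "r \<equiv> CARD('a) ^ m"
  assumes big: "(q * degree f + 2)\<^sup>2 \<le> r" and w: "w \<in> ext_field (2 * m)"
  shows "card {(x, y). x \<in> ext_field (2 * m) \<and> y \<in> ext_field (2 * m) \<and> y ^ q - y = poly F x - w}
    \<le> (r - 1) + r * (r + 2 * (q * degree f))"
proof -
  obtain a where a: "q = CHAR('a) ^ a" unfolding q_def using card_finite_field by blast
  have q2: "2 \<le> q" unfolding q_def by (rule CARD_finite_field_ge2)
  have rr: "r * r = CARD('a) ^ (2 * m)" by (simp add: r_def mult_2 power_add)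
  have m: "1 \<le> m" using big q2 by (cases m) (auto simp: r_def power2_eq_square)
  have K: "ext_field (2 * m) = {x :: 'a alg_closure. x ^ (r * r) = x}"
    by (simp add: ext_field_def rr)
  define g where "g = F - [:w:]"
  have deg_g: "degree g = degree f"
  proof -
    have "degree [:w:] < degree F" using degree_pos by simp
    then show ?thesis unfolding g_def diff_conv_add_uminus by (subst degree_add_eq_left) auto
  qed
  have "poly.coeff g i \<in> ext_field (2 * m)" for i
  proof -
    have "poly.coeff F i \<in> ext_field (2 * m)" by (simp add: coeff_F)
    then show ?thesis using w subring_setD(1,3)[OF subring_ext_field]
      by (auto simp: g_def coeff_pCons split: nat.splits)
  qed
  then have coeff: "poly.coeff g i ^ (r * r) = poly.coeff g i" for i by (simp add: K)
  have fixed: "card {s :: 'a alg_closure. s ^ q = s} = q"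
    using card_ext_field(2)[of 1, where 'a = 'a] by (simp add: ext_field_def q_def)
  have q_char: "q = CHAR('a alg_closure) ^ a" using a by simp
  have r_q: "r = q ^ m" by (simp add: r_def q_def)
  have cop: "coprime (degree f) q" unfolding q_def by (rule coprime_degree_card)
  have fin: "finite {x :: 'a alg_closure. x ^ (r * r) = x}"
    using card_ext_field(1)[of "2 * m", where 'a = 'a] m by (simp add: K)
  interpret artin_schreier g q r "degree f" a m
    by unfold_locales (fact prime_CHAR_alg_closure q_char q2 fixed r_q deg_g[symmetric] cop fin coeff big)+
  let ?T = "{x \<in> K. \<exists>y\<in>K. y ^ q - y = poly g x}"
  let ?Y = "\<lambda>x. {y. y ^ q - y = poly g x}"
  have K': "K = ext_field (2 * m)" by (simp add: K K_def)
  have finT: "finite ?T" using card_ext_field(1)[of "2 * m", where 'a = 'a] m by (simp add: K')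
  have Y: "finite (?Y x) \<and> card (?Y x) \<le> q" for x
  proof -
    define h where "h = Polynomial.monom 1 q - [:poly g x, 1:]"
    have "degree h = q" unfolding h_def diff_conv_add_uminus using q2
      by (subst degree_add_eq_left) (auto simp: degree_monom_eq)
    then have "h \<noteq> 0" using q2 by auto
    moreover have "?Y x = {y. poly h y = 0}" by (auto simp: h_def poly_monom algebra_simps)
    ultimately show ?thesis using poly_roots_finite card_poly_roots_bound \<open>degree h = q\<close> by metis
  qed
  have "card {(x, y). x \<in> ext_field (2 * m) \<and> y \<in> ext_field (2 * m) \<and> y ^ q - y = poly F x - w}
    \<le> card (Sigma ?T ?Y)"
    using finT Y by (intro card_mono finite_SigmaI) (auto simp: K' g_def)
  also have "\<dots> = (\<Sum>x\<in>?T. card (?Y x))" using finT Y by simp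
  also have "\<dots> \<le> card ?T * q" using sum_bounded_above[of ?T "\<lambda>x. card (?Y x)" q] Y by simp
  also have "\<dots> \<le> (r - 1) + r * (r + 2 * (q * degree f))" using stepanov_bound by (simp add: mult.commute)
  finally show ?thesis .
qed

text \<open>The character is trivial on \<open>y ^ q - y\<close>, so \<open>r * r\<close> times the
  exponential sum is the sum over \<open>w\<close> of \<open>n w\<close> times the character.
  Subtracting the constant \<open>B\<close> from \<open>n w\<close> changes nothing, as the
  character sums to zero. Now \<open>B - n w\<close> is nonnegative and its total is known, so the
  triangle inequality needs only the upper bound for the counts.\<close>

lemma S_even_bound:
  fixes m :: nat
  defines "q \<equiv> CARD('a)"
  assumes big: "(q * degree f + 2)\<^sup>2 \<le> q ^ m"
  shows "norm (S (2 * m)) \<le> (2 * q * degree f + 1) * q ^ m"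
proof -
  define r where "r = q ^ m"
  define K where "K = (ext_field (2 * m) :: 'a alg_closure set)"
  define n where "n w = card {(x, y). x \<in> K \<and> y \<in> K \<and> y ^ q - y = poly F x - w}" for w
  define B where "B = (r - 1) + r * (r + 2 * (q * degree f))"
  have q2: "2 \<le> q" unfolding q_def by (rule CARD_finite_field_ge2)
  have m: "1 \<le> m" using big q2 by (cases m) (auto simp: power2_eq_square)
  have finK: "finite K" and cardK: "card K = r * r"
    unfolding K_def using m by (simp_all add: card_ext_field r_def q_def mult_2 power_add)
  have r1: "1 \<le> r" unfolding r_def using q2 by simp
  have ring: "subring_set K" unfolding K_def by (rule subring_ext_field)
  have yq: "y ^ q - y \<in> K" if "y \<in> K" for y
  proof -
    have "y ^ k \<in> K" for k using that by (induction k) (auto intro: subring_setD[OF ring])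
    then show ?thesis using that by (auto intro: subring_setD[OF ring])
  qed
  have FK: "poly F x \<in> K" if "x \<in> K" for x using poly_F_in that by (simp add: K_def)
  have nB: "n w \<le> B" if "w \<in> K" for w
    using artin_schreier_count[of m w] big that by (simp add: n_def B_def r_def q_def K_def)
  have sum_n: "(\<Sum>w\<in>K. of_nat (n w) * h w) = (\<Sum>(x, y)\<in>K \<times> K. h (poly F x - (y ^ q - y)))"
    for h :: "'a alg_closure \<Rightarrow> complex"
  proof -
    let ?g = "\<lambda>(x, y). poly F x - (y ^ q - y)"
    have "(\<Sum>z\<in>K \<times> K. h (?g z)) = (\<Sum>w\<in>K. \<Sum>z\<in>{z \<in> K \<times> K. ?g z = w}. h (?g z))"
      using finK FK yq by (intro sum.group[symmetric]) (auto intro: subring_setD[OF ring])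
    also have "\<dots> = (\<Sum>w\<in>K. of_nat (n w) * h w)"
    proof (intro sum.cong refl)
      fix w
      have "{z \<in> K \<times> K. ?g z = w} = {(x, y). x \<in> K \<and> y \<in> K \<and> y ^ q - y = poly F x - w}"
        by (auto simp: algebra_simps)
      then have "of_nat (n w) * h w = (\<Sum>z\<in>{z \<in> K \<times> K. ?g z = w}. h w)"
        by (simp add: n_def)
      also have "\<dots> = (\<Sum>z\<in>{z \<in> K \<times> K. ?g z = w}. h (?g z))"
        by (intro sum.cong) auto
      finally show "(\<Sum>z\<in>{z \<in> K \<times> K. ?g z = w}. h (?g z)) = of_nat (n w) * h w" by (rule sym)
    qed
    finally show ?thesis by (simp add: case_prod_beta)
  qed
  \<comment> \<open>Every pair in \<open>K \<times> K\<close> lies on the curve of exactly one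
    \<open>w\<close>.\<close>
  have "complex_of_nat (\<Sum>w\<in>K. n w) = of_nat (card (K \<times> K))"
    using sum_n[of "\<lambda>_. 1"] by (simp add: case_prod_beta)
  then have tot: "(\<Sum>w\<in>K. n w) = r * r * (r * r)"
    unfolding of_nat_eq_iff by (simp add: card_cartesian_product cardK)
  have "(\<Sum>w\<in>K. of_nat (n w) * ext_char (2 * m) w) = (\<Sum>(x, y)\<in>K \<times> K. ext_char (2 * m) (poly F x))"
    unfolding sum_n
  proof (intro sum.cong refl, clarify)
    fix x y assume xy: "x \<in> K" "y \<in> K"
    have "ext_char (2 * m) (poly F x) =
      ext_char (2 * m) (poly F x - (y ^ q - y)) * ext_char (2 * m) (y ^ q - y)"
      using xy FK yq by (subst ext_char_add[symmetric]) (auto simp: K_def[symmetric] intro: subring_setD[OF ring])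
    moreover have "ext_char (2 * m) (y ^ q - y) = 1"
      using xy \<psi> by (simp add: ext_char_def trace_artin_schreier q_def K_def additive_charD)
    ultimately show "ext_char (2 * m) (poly F x - (y ^ q - y)) = ext_char (2 * m) (poly F x)" by simp
  qed
  also have "\<dots> = of_nat (r * r) * S (2 * m)"
    by (simp add: S_altdef K_def[symmetric] sum.cartesian_product[symmetric] cardK sum_distrib_left)
  finally have main: "of_nat (r * r) * S (2 * m) = (\<Sum>w\<in>K. (of_nat (n w) - of_nat B) * ext_char (2 * m) w)"
    using ext_char_sum[of "2 * m"] m
    by (simp add: left_diff_distrib sum_subtractf K_def[symmetric] sum_distrib_left[symmetric])
  have "real (r * r) * norm (S (2 * m)) = norm (of_nat (r * r) * S (2 * m))"
    by (simp add: norm_mult)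
  also have "\<dots> \<le> (\<Sum>w\<in>K. real B - real (n w))"
    unfolding main
  proof (rule sum_norm_le)
    fix w assume "w \<in> K"
    then have "norm (complex_of_nat (n w) - of_nat B) = real B - real (n w)"
      using nB[of w] by (metis abs_minus_commute abs_of_nonneg diff_ge_0_iff_ge norm_of_real of_nat_le_iff of_real_diff of_real_of_nat_eq)
    then show "norm ((complex_of_nat (n w) - of_nat B) * ext_char (2 * m) w) \<le> real B - real (n w)"
      using \<psi> by (simp add: norm_mult ext_char_def additive_charD)
  qed
  also have "\<dots> = real (r * r) * (real B - real (r * r))"
    by (simp add: sum_subtractf cardK of_nat_sum[symmetric] tot right_diff_distrib del: of_nat_sum)
  finally have "norm (S (2 * m)) \<le> real B - real (r * r)"
    using r1 by (simp add: mult_le_cancel_left_pos)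
  also have "\<dots> \<le> (2 * real q * real (degree f) + 1) * real r"
    using r1 by (simp add: B_def of_nat_diff algebra_simps)
  finally show ?thesis by (simp add: r_def algebra_simps)
qed

lemma S_even_bound_all: "\<exists>C. \<forall>m\<ge>1. norm (S (2 * m)) \<le> C * real (CARD('a)) ^ m"
proof -
  let ?q = "CARD('a)"
  define N where "N = (?q * degree f + 2)\<^sup>2"
  have "norm (S (2 * m)) \<le> (real N + (2 * ?q * degree f + 1)) * real ?q ^ m" if "m \<ge> 1" for m
  proof (cases "N \<le> ?q ^ m")
    case True
    then have "norm (S (2 * m)) \<le> (2 * ?q * degree f + 1) * ?q ^ m"
      using S_even_bound[of m] by (simp add: N_def)
    also have "\<dots> \<le> (real N + (2 * ?q * degree f + 1)) * real ?q ^ m"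
      by (simp add: algebra_simps)
    finally show ?thesis .
  next
    case False
    have "norm (S (2 * m)) \<le> (\<Sum>x\<in>(ext_field (2 * m) :: 'a alg_closure set). 1)"
      unfolding S_altdef by (rule sum_norm_le) (use \<psi> in \<open>simp add: ext_char_def additive_charD\<close>)
    also have "\<dots> = real ?q ^ m * real ?q ^ m"
      using that card_ext_field(2)[of "2 * m", where 'a = 'a] by (simp add: mult_2 power_add)
    also have "\<dots> \<le> real N * real ?q ^ m"
      using False by (intro mult_right_mono) (simp_all flip: of_nat_power)
    also have "\<dots> \<le> (real N + (2 * ?q * degree f + 1)) * real ?q ^ m"
      by (intro mult_right_mono) auto
    finally show ?thesis .
  qed
  then show ?thesis by blast
qed

end

section \<open>From power sums to the first coefficient\<close>

text \<open>For nonzero roots, the quotient of the two coefficients is up to sign the sum of the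
  reciprocals of the roots, each of which is at most \<open>1 / \<rho>\<close> in absolute
  value.\<close>

lemma mset_poly_coeff_bound:
  fixes A :: "complex multiset"
  assumes "\<And>x. x \<in># A \<Longrightarrow> \<rho> \<le> norm x" "0 < \<rho>"
  shows "norm (poly.coeff (mset_poly A) 1) \<le> real (size A) / \<rho> * norm (poly.coeff (mset_poly A) 0)"
  using assms(1)
proof (induction A)
  case empty
  then show ?case by (simp add: mset_poly_def)
next
  case (add x A)
  let ?p = "\<lambda>i. poly.coeff (mset_poly A) i"
  have eq: "mset_poly (add_mset x A) = [:- x, 1:] * mset_poly A"
    by (simp add: mset_poly_def)
  have IH: "norm (?p 1) \<le> real (size A) / \<rho> * norm (?p 0)" using add by simp
  have x: "1 \<le> norm x / \<rho>" using add.prems[of x] assms(2) by simp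
  have c0: "poly.coeff (mset_poly (add_mset x A)) 0 = - (x * ?p 0)"
    and c1: "poly.coeff (mset_poly (add_mset x A)) 1 = ?p 0 - x * ?p 1"
    by (simp_all add: eq coeff_pCons)
  have "norm (?p 0 - x * ?p 1) \<le> norm (?p 0) + norm x * norm (?p 1)"
    by (metis norm_mult norm_triangle_ineq4)
  also have "\<dots> \<le> norm x / \<rho> * norm (?p 0) + norm x * (real (size A) / \<rho> * norm (?p 0))"
    using IH x mult_right_mono[OF x, of "norm (?p 0)"] by (intro add_mono mult_left_mono) auto
  also have "\<dots> = real (size (add_mset x A)) / \<rho> * norm (- (x * ?p 0))"
    using assms(2) by (simp add: norm_mult field_simps)
  finally show ?case unfolding c0 c1 .
qed

text \<open>Let L be the generating polynomial of \<open>a\<close>. The logarithmic derivative of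
  L(z) L(-z) converges for |z| < 1 / sqrt q by the growth of the even sums. So the product is a
  nonzero constant times an exponential there, and L has no zero in this disc. As
  \<open>a 0 = 1\<close>, the number \<open>S 1 = a 1\<close> is minus the sum of the reciprocals of
  at most \<open>d - 1\<close> roots.\<close>

lemma first_power_sum_bound:
  fixes a S :: "nat \<Rightarrow> complex" and d :: nat and q :: real
  assumes a0: "a 0 = 1" and rec: "\<And>n. of_nat n * a n = (\<Sum>k=1..n. S k * a (n - k))"
    and vanish: "\<And>n. d \<le> n \<Longrightarrow> a n = 0" and d: "1 \<le> d" and q: "0 < q"
    and bound: "\<And>m. 1 \<le> m \<Longrightarrow> norm (S (2 * m)) \<le> C * q ^ m"
  shows "norm (S 1) \<le> real (d - 1) * sqrt q"
proof -
  define L where "L = (\<Sum>k<d. Polynomial.monom (a k) k)"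
  define M where "M = pcompose L [:0, - 1:]"
  define s where "s = Abs_fps (\<lambda>n. S (Suc n))"
  define t where "t = Abs_fps (\<lambda>n. (- 1) ^ n * S (Suc n))"
  define R where "R = 1 / sqrt q"
  have R: "0 < R" using q by (simp add: R_def)
  have coeff_L: "poly.coeff L k = a k" for k
    using vanish[of k] by (auto simp: L_def coeff_sum if_distrib cong: if_cong)
  have coeff_M: "poly.coeff M k = (- 1) ^ k * a k" for k
  proof -
    have "M = (\<Sum>k<d. Polynomial.monom ((- 1) ^ k * a k) k)"
      unfolding M_def L_def
      by (rule poly_ext) (simp add: poly_pcompose poly_sum poly_monom power_minus' mult_ac)
    then show ?thesis using vanish[of k] by (auto simp: coeff_sum if_distrib cong: if_cong)
  qed
  have rec': "of_nat (Suc n) * a (Suc n) = (\<Sum>i=0..n. a i * S (Suc (n - i)))" for n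
  proof -
    have "of_nat (Suc n) * a (Suc n) = (\<Sum>k=1..Suc n. S k * a (Suc n - k))" by (rule rec)
    also have "\<dots> = (\<Sum>i=0..n. a i * S (Suc (n - i)))"
      by (rule sum.reindex_bij_witness[of _ "\<lambda>i. Suc (n - i)" "\<lambda>k. Suc n - k"]) auto
    finally show ?thesis .
  qed
  have dL: "fps_deriv (fps_of_poly L) = fps_of_poly L * s"
    by (rule fps_ext) (simp add: fps_mult_nth coeff_L s_def rec'[simplified])
  have dM: "fps_deriv (fps_of_poly M) = - (fps_of_poly M * t)"
  proof (rule fps_ext)
    fix n
    have "fps_nth (fps_of_poly M * t) n = (\<Sum>i=0..n. (- 1) ^ n * (a i * S (Suc (n - i))))"
      unfolding fps_mult_nth
    proof (intro sum.cong refl)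
      fix i assume "i \<in> {0..n}"
      then have "(- 1 :: complex) ^ n = (- 1) ^ i * (- 1) ^ (n - i)" by (simp flip: power_add)
      then show "fps_nth (fps_of_poly M) i * fps_nth t (n - i) = (- 1) ^ n * (a i * S (Suc (n - i)))"
        by (simp add: coeff_M t_def)
    qed
    also have "\<dots> = (- 1) ^ n * (of_nat (Suc n) * a (Suc n))"
      by (simp only: rec' sum_distrib_left)
    finally show "fps_nth (fps_deriv (fps_of_poly M)) n = fps_nth (- (fps_of_poly M * t)) n"
      by (simp add: coeff_M)
  qed
  define c where "c = s - t"
  have "fps_deriv (fps_of_poly (L * M)) = fps_of_poly (L * M) * c"
    by (simp add: fps_of_poly_mult dL dM c_def algebra_simps)
  then have dLM: "fps_of_poly (pderiv (L * M)) = fps_of_poly (L * M) * c"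
    by (simp add: fps_of_poly_pderiv)
  \<comment> \<open>For even \<open>n\<close> the two coefficients cancel; for odd \<open>n\<close>
    they add up to twice \<open>S (n + 1)\<close>, whose index is even.\<close>
  have c_bound: "norm (fps_nth c n) \<le> 2 * \<bar>C\<bar> * sqrt q * sqrt q ^ n" for n
  proof (cases "even n")
    case True
    then show ?thesis using q by (simp add: c_def s_def t_def)
  next
    case False
    then obtain m where m: "n = 2 * m + 1" by (auto elim: oddE)
    have "norm (fps_nth c n) = 2 * norm (S (2 * Suc m))"
      by (simp add: c_def s_def t_def m norm_mult flip: mult_2)
    also have "\<dots> \<le> 2 * (\<bar>C\<bar> * q ^ Suc m)"
      using bound[of "Suc m"] q by (smt (verit) mult_right_mono le_add1 plus_1_eq_Suc zero_less_power)
    also have "q ^ Suc m = sqrt q * sqrt q ^ n"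
    proof -
      have "q ^ Suc m = (sqrt q ^ 2) ^ Suc m" using q by simp
      also have "\<dots> = sqrt q ^ (2 * Suc m)" by (simp only: power_mult)
      also have "\<dots> = sqrt q * sqrt q ^ n" by (simp add: m)
      finally show ?thesis .
    qed
    finally show ?thesis by simp
  qed
  have conv: "fps_conv_radius h \<ge> ereal R" if h: "\<And>n. norm (fps_nth h n) \<le> B * sqrt q ^ n"
    for h :: "complex fps" and B
    unfolding fps_conv_radius_def
  proof (rule conv_radius_geI_ex')
    fix r :: real assume r: "0 < r" "ereal r < ereal R"
    have "r * sqrt q < 1" using r q by (simp add: R_def field_simps)
    then have "summable (\<lambda>n. B * (r * sqrt q) ^ n)"
      using r q by (intro summable_mult summable_geometric) auto
    moreover have "norm (fps_nth h n * of_real r ^ n) \<le> B * (r * sqrt q) ^ n" for n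
      using mult_right_mono[OF h[of n], of "r ^ n"] r
      by (simp add: norm_mult norm_power power_mult_distrib mult_ac)
    ultimately show "summable (\<lambda>n. fps_nth h n * of_real r ^ n)"
      by (rule summable_comparison_test'[where N = 0])
  qed
  have conv_c: "fps_conv_radius c \<ge> ereal R" using c_bound by (rule conv)
  define g where "g = eval_fps (fps_integral0 c)"
  have conv_int: "fps_conv_radius (fps_integral0 c) \<ge> ereal R"
  proof (rule conv)
    fix n show "norm (fps_nth (fps_integral0 c) n) \<le> 2 * \<bar>C\<bar> * sqrt q ^ n"
    proof (cases n)
      case (Suc k)
      have "norm (fps_nth (fps_integral0 c) n) = norm (fps_nth c k) / real (Suc k)"
        by (simp add: Suc fps_integral_def norm_mult norm_inverse divide_inverse mult.commute del: of_nat_Suc)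
      also have "\<dots> \<le> norm (fps_nth c k)"
        using divide_left_mono[of 1 "real (Suc k)" "norm (fps_nth c k)"] by simp
      also note c_bound[of k]
      finally show ?thesis by (simp add: Suc mult.assoc)
    qed simp
  qed
  \<comment> \<open>The product divided by the exponential of the integral of its logarithmic
    derivative: it is constant on the disc and nonzero at the origin.\<close>
  define W where "W z = poly (L * M) z * exp (- g z)" for z
  have "\<exists>k. \<forall>z\<in>ball 0 R. W z = k"
  proof (rule has_field_derivative_zero_constant)
    fix z :: complex assume "z \<in> ball 0 R"
    then have "ereal (norm z) < ereal R" by simp
    then have z: "ereal (norm z) < fps_conv_radius c" "ereal (norm z) < fps_conv_radius (fps_integral0 c)"
      using conv_c conv_int by (blast intro: less_le_trans)+
    have g': "(g has_field_derivative eval_fps c z) (at z within ball 0 R)"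
      unfolding g_def using has_field_derivative_eval_fps[OF z(2)] by (simp add: fps_deriv_fps_integral)
    have "poly (pderiv (L * M)) z = poly (L * M) z * eval_fps c z"
      using arg_cong[OF dLM, of "\<lambda>f. eval_fps f z"] z by (simp add: eval_fps_mult)
    then have "poly (pderiv (L * M)) z * exp (- g z) + poly (L * M) z * (exp (- g z) * - eval_fps c z) = 0"
      by simp
    moreover have "(W has_field_derivative
      poly (pderiv (L * M)) z * exp (- g z) + poly (L * M) z * (exp (- g z) * - eval_fps c z)) (at z within ball 0 R)"
    proof -
      have "((\<lambda>z. exp (- g z)) has_field_derivative exp (- g z) * - eval_fps c z) (at z within ball 0 R)"
        by (intro derivative_intros g')
      from DERIV_mult[OF has_field_derivative_at_within[OF poly_DERIV[of "L * M"]] this]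
      show ?thesis
        unfolding W_def by (rule DERIV_cong) (simp only: mult_ac)
    qed
    ultimately show "(W has_field_derivative 0) (at z within ball 0 R)" by simp
  qed simp
  then obtain k where k: "\<And>z. z \<in> ball 0 R \<Longrightarrow> W z = k" by blast
  have "k = W 0" using k[of 0] R by simp
  moreover have "W 0 \<noteq> 0"
    using a0 coeff_L[of 0] coeff_M[of 0] by (simp add: W_def poly_0_coeff_0 coeff_mult)
  ultimately have nonzero: "poly L z \<noteq> 0" if "norm z < R" for z
    using k[of z] that by (auto simp: W_def)
  have "L \<noteq> 0" using coeff_L[of 0] a0 by auto
  then obtain A where A: "size A = degree L" "L = smult (lead_coeff L) (\<Prod>x\<in>#A. [:- x, 1:])"
    using alg_closed_imp_factorization by blast
  then have L: "L = smult (lead_coeff L) (mset_poly A)" by (simp add: mset_poly_def)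
  have "R \<le> norm x" if "x \<in># A" for x
  proof -
    have "poly (mset_poly A) x = 0"
      using that set_count_proots[of "mset_poly A"] by auto
    then have "poly L x = 0" by (subst L) simp
    then show ?thesis using nonzero[of x] by force
  qed
  then have "norm (poly.coeff (mset_poly A) 1) \<le> real (size A) / R * norm (poly.coeff (mset_poly A) 0)"
    using R by (intro mset_poly_coeff_bound)
  then have "norm (lead_coeff L) * norm (poly.coeff (mset_poly A) 1) \<le>
      norm (lead_coeff L) * (real (size A) / R * norm (poly.coeff (mset_poly A) 0))"
    by (intro mult_left_mono) auto
  also have "\<dots> = real (size A) / R * (norm (lead_coeff L) * norm (poly.coeff (mset_poly A) 0))"
    by (simp only: mult_ac)
  finally have "norm (lead_coeff L) * norm (poly.coeff (mset_poly A) 1) \<le>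
    real (size A) / R * (norm (lead_coeff L) * norm (poly.coeff (mset_poly A) 0))" .
  moreover have "norm (lead_coeff L) * norm (poly.coeff (mset_poly A) i) = norm (a i)" for i
  proof -
    have "a i = poly.coeff (smult (lead_coeff L) (mset_poly A)) i"
      by (simp only: coeff_L[symmetric] L[symmetric])
    then show ?thesis by (simp add: norm_mult)
  qed
  ultimately have "norm (a 1) \<le> real (size A) / R * norm (a 0)"
    by simp
  also have "\<dots> = real (degree L) * sqrt q" by (simp add: A(1) R_def a0)
  also have "\<dots> \<le> real (d - 1) * sqrt q"
  proof -
    have "degree L \<le> d - 1"
      unfolding L_def by (intro degree_sum_le) (auto intro: order_trans[OF degree_monom_le])
    then show ?thesis using q by (intro mult_right_mono) auto
  qed
  finally show ?thesis using rec[of 1] a0 by simp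
qed

theorem weil_exponential_sum:
  fixes f :: "'a :: finite_field poly"
  assumes "additive_char \<psi>" "\<exists>x. \<psi> x \<noteq> 1" "of_nat (degree f) \<noteq> (0 :: 'a)"
  shows "norm (\<Sum>x\<in>UNIV. \<psi> (poly f x)) \<le> real (degree f - 1) * sqrt (real CARD('a))"
proof -
  interpret exponential_sum \<psi> f using assms by unfold_locales
  obtain C where "\<forall>m\<ge>1. norm (S (2 * m)) \<le> C * real (CARD('a)) ^ m" using S_even_bound_all by blast
  then have "norm (S 1) \<le> real (degree f - 1) * sqrt (real CARD('a))"
    using a_0 a_recursion a_eq_0 degree_pos CARD_finite_field_ge2[where 'a = 'a]
    by (intro first_power_sum_bound[of a S "degree f" "real CARD('a)" C]) auto
  then show ?thesis by (simp only: S_1)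
qed

section \<open>An incidence bound\<close>

lemma additive_char_scale:
  assumes "additive_char \<psi>"
  shows "additive_char (\<lambda>x. \<psi> (t * x))"
  using assms by (simp add: additive_char_def ring_distribs)

lemma additive_char_scale_nontrivial:
  assumes "\<exists>x. \<psi> x \<noteq> 1" "t \<noteq> (0 :: 'a :: finite_field)"
  shows "\<exists>x. \<psi> (t * x) \<noteq> 1"
proof -
  obtain w where "\<psi> w \<noteq> 1" using assms by blast
  then show ?thesis using assms by (intro exI[of _ "w / t"]) simp
qed

lemma additive_char_orthogonality:
  assumes "additive_char \<psi>" "\<exists>x. \<psi> x \<noteq> 1"
  shows "(\<Sum>t\<in>UNIV. \<psi> (t * (x :: 'a :: finite_field))) = (if x = 0 then of_nat CARD('a) else 0)"
proof (cases "x = 0")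
  case True
  then show ?thesis using assms by (simp add: additive_charD)
next
  case False
  have "(\<Sum>t\<in>UNIV. \<psi> (x * t)) = 0"
    using additive_char_sum[OF additive_char_scale[OF assms(1)] additive_char_scale_nontrivial[OF assms(2) False]] .
  then show ?thesis using False by (simp add: mult.commute)
qed

lemma additive_char_parseval:
  fixes A :: "'i set" and h :: "'i \<Rightarrow> 'a :: finite_field"
  assumes "additive_char \<psi>" "\<exists>x. \<psi> x \<noteq> 1" "finite A" "inj_on h A"
  shows "(\<Sum>t\<in>UNIV. (norm (\<Sum>w\<in>A. \<psi> (t * h w)))\<^sup>2) = real CARD('a) * real (card A)"
proof -
  have "complex_of_real (\<Sum>t\<in>UNIV. (norm (\<Sum>w\<in>A. \<psi> (t * h w)))\<^sup>2) =
    (\<Sum>t\<in>UNIV. \<Sum>w\<in>A. \<Sum>w'\<in>A. \<psi> (t * (h w - h w')))"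
    using assms(1)
    by (simp add: complex_norm_square sum_product additive_charD right_diff_distrib del: of_real_power)
  also have "\<dots> = (\<Sum>w\<in>A. \<Sum>t\<in>UNIV. \<Sum>w'\<in>A. \<psi> (t * (h w - h w')))"
    by (rule sum.swap)
  also have "\<dots> = (\<Sum>w\<in>A. \<Sum>w'\<in>A. \<Sum>t\<in>UNIV. \<psi> (t * (h w - h w')))"
    by (intro sum.cong refl sum.swap)
  also have "\<dots> = (\<Sum>w\<in>A. \<Sum>w'\<in>A. if w = w' then of_nat CARD('a) else 0)"
    using assms(4) by (intro sum.cong refl)
      (auto simp: additive_char_orthogonality[OF assms(1,2)] inj_on_def)
  also have "\<dots> = complex_of_real (real CARD('a) * real (card A))"
    using assms(3) by simp
  finally show ?thesis by (simp only: of_real_eq_iff)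
qed

text \<open>Cauchy-Schwarz over \<open>y\<close> separates the weights \<open>bt\<close>, of which
  only the square sum is known, from the kernel. Expanding the other square leaves the correlations
  between the rows of \<open>k\<close>, to which the assumption \<open>diag\<close> applies.\<close>

lemma bilinear_sum_bound:
  fixes k :: "'x \<Rightarrow> 'y \<Rightarrow> complex"
  assumes fin: "finite X" "finite Y"
    and diag: "\<And>x. x \<in> X \<Longrightarrow> (\<Sum>x'\<in>X. norm (\<Sum>y\<in>Y. k x y * cnj (k x' y))) \<le> B"
    and u: "\<And>x. x \<in> X \<Longrightarrow> norm (u x) \<le> 1"
  shows "(norm (\<Sum>y\<in>Y. bt y * (\<Sum>x\<in>X. u x * k x y)))\<^sup>2 \<le> (\<Sum>y\<in>Y. (norm (bt y))\<^sup>2) * (real (card X) * B)"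
proof -
  let ?s = "\<lambda>y. \<Sum>x\<in>X. u x * k x y"
  have "norm (\<Sum>y\<in>Y. bt y * ?s y) \<le> (\<Sum>y\<in>Y. norm (bt y) * norm (?s y))"
    by (rule order_trans[OF norm_sum]) (simp add: norm_mult)
  then have "(norm (\<Sum>y\<in>Y. bt y * ?s y))\<^sup>2 \<le> (\<Sum>y\<in>Y. norm (bt y) * norm (?s y))\<^sup>2"
    by (intro power_mono) auto
  also have "\<dots> \<le> (\<Sum>y\<in>Y. (norm (bt y))\<^sup>2) * (\<Sum>y\<in>Y. (norm (?s y))\<^sup>2)"
    by (rule Cauchy_Schwarz_ineq_sum)
  also have "\<dots> \<le> (\<Sum>y\<in>Y. (norm (bt y))\<^sup>2) * (real (card X) * B)"
  proof (rule mult_left_mono)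
    have "complex_of_real (\<Sum>y\<in>Y. (norm (?s y))\<^sup>2) =
      (\<Sum>y\<in>Y. \<Sum>x\<in>X. \<Sum>x'\<in>X. u x * cnj (u x') * (k x y * cnj (k x' y)))"
      by (simp add: complex_norm_square sum_product mult_ac del: of_real_power)
    also have "\<dots> = (\<Sum>x\<in>X. \<Sum>y\<in>Y. \<Sum>x'\<in>X. u x * cnj (u x') * (k x y * cnj (k x' y)))"
      by (rule sum.swap)
    also have "\<dots> = (\<Sum>x\<in>X. \<Sum>x'\<in>X. \<Sum>y\<in>Y. u x * cnj (u x') * (k x y * cnj (k x' y)))"
      by (intro sum.cong refl sum.swap)
    also have "\<dots> = (\<Sum>x\<in>X. \<Sum>x'\<in>X. u x * cnj (u x') * (\<Sum>y\<in>Y. k x y * cnj (k x' y)))"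
      by (simp add: sum_distrib_left)
    finally have eq: "complex_of_real (\<Sum>y\<in>Y. (norm (?s y))\<^sup>2) = \<dots>" .
    have "(\<Sum>y\<in>Y. (norm (?s y))\<^sup>2) = norm (complex_of_real (\<Sum>y\<in>Y. (norm (?s y))\<^sup>2))"
      unfolding norm_of_real by (intro abs_of_nonneg[symmetric] sum_nonneg) auto
    also have "\<dots> \<le> (\<Sum>x\<in>X. \<Sum>x'\<in>X. norm (\<Sum>y\<in>Y. k x y * cnj (k x' y)))"
      unfolding eq
    proof (intro sum_norm_le)
      fix x x' assume x: "x \<in> X" "x' \<in> X"
      have "norm (u x) * norm (u x') \<le> 1"
        using u[OF x(1)] u[OF x(2)] by (simp add: mult_le_one)
      then show "norm (u x * cnj (u x') * (\<Sum>y\<in>Y. k x y * cnj (k x' y))) \<le> norm (\<Sum>y\<in>Y. k x y * cnj (k x' y))"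
        by (simp add: norm_mult mult_left_le_one_le)
    qed
    also have "\<dots> \<le> (\<Sum>x\<in>X. B)" using diag by (intro sum_mono)
    finally show "(\<Sum>y\<in>Y. (norm (?s y))\<^sup>2) \<le> real (card X) * B" by simp
  qed (auto intro: sum_nonneg)
  finally show ?thesis .
qed

text \<open>Both indices start at 1: what depends on one variable alone is absorbed into the
  summands \<open>b\<close> and \<open>J x\<close> of the incidence problem.\<close>

definition mixed_form :: "nat \<Rightarrow> (nat \<Rightarrow> nat \<Rightarrow> 'a) \<Rightarrow> 'a \<Rightarrow> 'a \<Rightarrow> 'a :: comm_ring_1" where
  "mixed_form d f x a = (\<Sum>i=1..d. \<Sum>k=1..d. f i k * x ^ i * a ^ k)"

text \<open>The difference is a polynomial in \<open>a\<close> without constant term. If it is not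
  zero, its degree is the exponent of a monomial of \<open>f\<close>, hence nonzero in the field,
  and Weil's bound gives d sqrt q. It is zero for at most \<open>d\<close> values of x', and the
  trivial bound q for these costs no more than the main term d q^(3/2).\<close>

lemma mixed_form_correlation:
  fixes f :: "nat \<Rightarrow> nat \<Rightarrow> 'a :: finite_field"
  assumes \<psi>: "additive_char \<psi>" "\<exists>x. \<psi> x \<noteq> 1"
    and f: "i0 \<in> {1..d}" "k0 \<in> {1..d}" "f i0 k0 \<noteq> 0"
    and char: "\<And>i k. i \<in> {1..d} \<Longrightarrow> k \<in> {1..d} \<Longrightarrow> f i k \<noteq> 0 \<Longrightarrow> of_nat k \<noteq> (0 :: 'a)"
  shows "(\<Sum>x'\<in>UNIV. norm (\<Sum>a\<in>UNIV. \<psi> (mixed_form d f x a - mixed_form d f x' a)))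
    \<le> 2 * real d * real CARD('a) * sqrt (real CARD('a))"
proof -
  let ?q = "real CARD('a)"
  define c where "c x k = (\<Sum>i=1..d. f i k * x ^ i)" for x k
  define Bad where "Bad = {x'. \<forall>k\<in>{1..d}. c x' k = c x k}"
  have form: "mixed_form d f x a = (\<Sum>k=1..d. c x k * a ^ k)" for x a
    unfolding mixed_form_def c_def by (subst sum.swap) (simp add: sum_distrib_right)
  have q1: "1 \<le> ?q" using CARD_finite_field_ge2[where 'a = 'a] by simp
  have good: "norm (\<Sum>a\<in>UNIV. \<psi> (mixed_form d f x a - mixed_form d f x' a)) \<le> real d * sqrt ?q"
    if "x' \<notin> Bad" for x'
  proof -
    define p where "p = (\<Sum>k=1..d. Polynomial.monom (c x k - c x' k) k)"
    have coeff_p: "poly.coeff p k = (if k \<in> {1..d} then c x k - c x' k else 0)" for k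
      by (simp add: p_def coeff_sum if_distrib cong: if_cong)
    have poly_p: "poly p a = mixed_form d f x a - mixed_form d f x' a" for a
      by (simp add: p_def form poly_sum poly_monom left_diff_distrib sum_subtractf)
    obtain k where "k \<in> {1..d}" "c x' k \<noteq> c x k" using \<open>x' \<notin> Bad\<close> by (auto simp: Bad_def)
    then have "poly.coeff p k \<noteq> 0" by (simp add: coeff_p)
    then have "p \<noteq> 0" by auto
    then have "poly.coeff p (degree p) \<noteq> 0" by simp
    then have deg: "degree p \<in> {1..d}" "c x (degree p) \<noteq> c x' (degree p)"
      by (auto simp: coeff_p split: if_splits)
    then have "\<exists>i\<in>{1..d}. f i (degree p) \<noteq> 0"
      unfolding c_def by (metis (no_types, lifting) mult_zero_left sum.cong)
    then have "of_nat (degree p) \<noteq> (0 :: 'a)" using char deg(1) by blast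
    then have "norm (\<Sum>a\<in>UNIV. \<psi> (poly p a)) \<le> real (degree p - 1) * sqrt ?q"
      using \<psi> by (intro weil_exponential_sum)
    also have "\<dots> \<le> real d * sqrt ?q" using deg(1) by (intro mult_right_mono) auto
    finally show ?thesis by (simp add: poly_p)
  qed
  have bad: "norm (\<Sum>a\<in>UNIV. \<psi> (mixed_form d f x a - mixed_form d f x' a)) \<le> ?q" for x'
  proof -
    have "norm (\<Sum>a\<in>UNIV. \<psi> (mixed_form d f x a - mixed_form d f x' a)) \<le> (\<Sum>a\<in>(UNIV :: 'a set). 1)"
      by (intro sum_norm_le) (simp only: additive_charD(2)[OF \<psi>(1)] order_refl)
    then show ?thesis by simp
  qed
  have "card Bad \<le> d"
  proof -
    \<comment> \<open>Since \<open>i0 \<ge> 1\<close>, the subtracted constant does not touch the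
      coefficient \<open>f i0 k0\<close>, so \<open>g\<close> is not zero.\<close>
    define g where "g = (\<Sum>i=1..d. Polynomial.monom (f i k0) i) - [:c x k0:]"
    have "poly.coeff g i0 \<noteq> 0"
      using f by (auto simp: g_def coeff_sum if_distrib coeff_pCons split: nat.splits cong: if_cong)
    then have "g \<noteq> 0" by auto
    have "degree g \<le> d"
      unfolding g_def
      by (intro degree_diff_le degree_sum_le) (auto intro: order_trans[OF degree_monom_le])
    have "Bad \<subseteq> {x'. poly g x' = 0}"
      using f by (auto simp: Bad_def g_def poly_sum poly_monom c_def)
    then have "card Bad \<le> card {x'. poly g x' = 0}" by (intro card_mono) auto
    also have "\<dots> \<le> d" using card_poly_roots_bound[OF \<open>g \<noteq> 0\<close>] \<open>degree g \<le> d\<close> by simp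
    finally show ?thesis .
  qed
  have "(\<Sum>x'\<in>UNIV. norm (\<Sum>a\<in>UNIV. \<psi> (mixed_form d f x a - mixed_form d f x' a)))
    \<le> (\<Sum>x'\<in>UNIV. (if x' \<in> Bad then ?q else 0) + real d * sqrt ?q)"
  proof (rule sum_mono)
    fix x'
    have "0 \<le> real d * sqrt ?q" by simp
    show "norm (\<Sum>a\<in>UNIV. \<psi> (mixed_form d f x a - mixed_form d f x' a))
      \<le> (if x' \<in> Bad then ?q else 0) + real d * sqrt ?q"
    proof (cases "x' \<in> Bad")
      case True
      with \<open>0 \<le> real d * sqrt ?q\<close> show ?thesis
        unfolding if_P[OF True] using bad[of x'] by linarith
    next
      case False
      then show ?thesis unfolding if_not_P[OF False] using good[of x'] by linarith
    qed
  qed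
  also have "\<dots> = real (card Bad) * ?q + ?q * (real d * sqrt ?q)"
    by (simp add: sum.distrib sum.If_cases)
  also have "\<dots> \<le> real d * ?q * sqrt ?q + ?q * (real d * sqrt ?q)"
  proof -
    have "real (card Bad) * ?q \<le> real d * ?q * 1" using \<open>card Bad \<le> d\<close> by simp
    also have "\<dots> \<le> real d * ?q * sqrt ?q" using q1 by (intro mult_left_mono) auto
    finally show ?thesis by simp
  qed
  finally show ?thesis by (simp add: algebra_simps)
qed

text \<open>The frequency 0 contributes the product M of the cardinalities, and the other
  frequencies have to cancel it. Cauchy-Schwarz is applied over \<open>a\<close> for each frequency,
  then over the frequencies. Parseval for \<open>W\<close> and for the fibres of \<open>P\<close>
  gives M^2 at most M q^2 B with B = 2 d q^(3/2).\<close>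

theorem no_incidence_bound:
  fixes f :: "nat \<Rightarrow> nat \<Rightarrow> 'a :: finite_field" and X W :: "'a set" and P :: "('a \<times> 'a) set"
  assumes f: "i0 \<in> {1..d}" "k0 \<in> {1..d}" "f i0 k0 \<noteq> 0"
    and char: "\<And>i k. i \<in> {1..d} \<Longrightarrow> k \<in> {1..d} \<Longrightarrow> f i k \<noteq> 0 \<Longrightarrow> of_nat k \<noteq> (0 :: 'a)"
    and none: "\<And>x a b. x \<in> X \<Longrightarrow> (a, b) \<in> P \<Longrightarrow> mixed_form d f x a + b + J x \<notin> W"
  shows "real (card X) * real (card W) * real (card P) \<le> 2 * real d * real CARD('a) ^ 3 * sqrt (real CARD('a))"
proof -
  let ?q = "real CARD('a)"
  have q1: "1 \<le> ?q" using CARD_finite_field_ge2[where 'a = 'a] by simp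
  obtain \<psi> :: "'a \<Rightarrow> complex" where \<psi>: "additive_char \<psi>" "\<exists>x. \<psi> x \<noteq> 1"
    using nontrivial_additive_char_exists by blast
  have add: "\<psi> (x + y) = \<psi> x * \<psi> y" for x y using \<psi>(1) by (rule additive_charD)
  \<comment> \<open>The points of \<open>P\<close> are grouped by the first coordinate, the only one
    on which the mixed form depends. In each group the second coordinates are distinct, as Parseval
    requires.\<close>
  define bt where "bt t a = (\<Sum>b | (a, b) \<in> P. \<psi> (t * b))" for t a
  define Wh where "Wh t = (\<Sum>w\<in>W. \<psi> (t * (- w)))" for t
  define T where "T t = (\<Sum>a\<in>UNIV. bt t a * (\<Sum>x\<in>X. \<psi> (t * J x) * \<psi> (t * mixed_form d f x a)))" for t
  have T_eq: "T t = (\<Sum>x\<in>X. \<Sum>(a, b)\<in>P. \<psi> (t * (mixed_form d f x a + b + J x)))" for t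
  proof -
    have "T t = (\<Sum>a\<in>UNIV. \<Sum>b | (a, b) \<in> P. \<Sum>x\<in>X. \<psi> (t * (mixed_form d f x a + b + J x)))"
      unfolding T_def bt_def
      by (simp add: sum_product add ring_distribs mult_ac)
    also have "\<dots> = (\<Sum>(a, b)\<in>Sigma UNIV (\<lambda>a. {b. (a, b) \<in> P}). \<Sum>x\<in>X. \<psi> (t * (mixed_form d f x a + b + J x)))"
      by (subst sum.Sigma) auto
    also have "Sigma UNIV (\<lambda>a. {b. (a, b) \<in> P}) = P" by auto
    also have "(\<Sum>(a, b)\<in>P. \<Sum>x\<in>X. \<psi> (t * (mixed_form d f x a + b + J x))) =
      (\<Sum>x\<in>X. \<Sum>(a, b)\<in>P. \<psi> (t * (mixed_form d f x a + b + J x)))"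
      by (simp add: case_prod_beta sum.swap[of _ X P])
    finally show ?thesis .
  qed
  have "(\<Sum>t\<in>UNIV. Wh t * T t) = (\<Sum>t\<in>UNIV. \<Sum>w\<in>W. \<Sum>x\<in>X. \<Sum>(a, b)\<in>P. \<psi> (t * (mixed_form d f x a + b + J x - w)))"
  proof (intro sum.cong refl)
    fix t
    have "\<psi> (t * (- w)) * \<psi> (t * s) = \<psi> (t * (s - w))" for w s
      by (simp add: algebra_simps flip: add)
    then show "Wh t * T t = (\<Sum>w\<in>W. \<Sum>x\<in>X. \<Sum>(a, b)\<in>P. \<psi> (t * (mixed_form d f x a + b + J x - w)))"
      unfolding Wh_def T_eq sum_product by (simp add: sum_distrib_left case_prod_beta del: mult_minus_right)
  qed
  also have "\<dots> = (\<Sum>w\<in>W. \<Sum>x\<in>X. \<Sum>(a, b)\<in>P. \<Sum>t\<in>UNIV. \<psi> (t * (mixed_form d f x a + b + J x - w)))"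
    by (simp add: case_prod_beta sum.swap[of _ _ UNIV])
  also have "\<dots> = 0"
    using none by (intro sum.neutral ballI) (auto simp: additive_char_orthogonality[OF \<psi>])
  finally have total: "(\<Sum>t\<in>UNIV. Wh t * T t) = 0" .
  have "Wh 0 * T 0 = of_nat (card W) * (of_nat (card X) * of_nat (card P))"
    using \<psi>(1) by (simp add: Wh_def T_eq additive_charD case_prod_beta)
  then have "real (card X) * real (card W) * real (card P) = norm (Wh 0 * T 0)"
    by (simp add: norm_mult)
  also have "\<dots> = norm (\<Sum>t\<in>UNIV - {0}. Wh t * T t)"
  proof -
    have "(\<Sum>t\<in>UNIV. Wh t * T t) = Wh 0 * T 0 + (\<Sum>t\<in>UNIV - {0}. Wh t * T t)"
      by (rule sum.remove) auto
    then have "Wh 0 * T 0 = - (\<Sum>t\<in>UNIV - {0}. Wh t * T t)"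
      using total by (simp add: add_eq_0_iff2)
    then show ?thesis by simp
  qed
  also have "\<dots> \<le> (\<Sum>t\<in>UNIV - {0}. norm (Wh t) * norm (T t))"
    by (rule order_trans[OF norm_sum]) (simp add: norm_mult)
  finally have le: "real (card X) * real (card W) * real (card P) \<le> (\<Sum>t\<in>UNIV - {0}. norm (Wh t) * norm (T t))" .
  let ?M = "real (card X) * real (card W) * real (card P)"
  define B where "B = 2 * real d * ?q * sqrt ?q"
  have T_bound: "(norm (T t))\<^sup>2 \<le> (\<Sum>a\<in>UNIV. (norm (bt t a))\<^sup>2) * (real (card X) * B)" if "t \<noteq> 0" for t
    unfolding T_def
  proof (rule bilinear_sum_bound)
    fix x assume "x \<in> X"
    show "norm (\<psi> (t * J x)) \<le> 1" using \<psi>(1) by (simp add: additive_charD)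
    have "(\<Sum>x'\<in>X. norm (\<Sum>a\<in>UNIV. \<psi> (t * mixed_form d f x a) * cnj (\<psi> (t * mixed_form d f x' a))))
      = (\<Sum>x'\<in>X. norm (\<Sum>a\<in>UNIV. \<psi> (t * (mixed_form d f x a - mixed_form d f x' a))))"
      using \<psi>(1) by (simp add: additive_charD right_diff_distrib)
    also have "\<dots> \<le> (\<Sum>x'\<in>UNIV. norm (\<Sum>a\<in>UNIV. \<psi> (t * (mixed_form d f x a - mixed_form d f x' a))))"
      by (intro sum_mono2) auto
    also have "\<dots> \<le> B"
      unfolding B_def
      using f char additive_char_scale[OF \<psi>(1)] additive_char_scale_nontrivial[OF \<psi>(2) that]
      by (intro mixed_form_correlation) auto
    finally show "(\<Sum>x'\<in>X. norm (\<Sum>a\<in>UNIV. \<psi> (t * mixed_form d f x a) * cnj (\<psi> (t * mixed_form d f x' a)))) \<le> B" .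
  qed auto
  have "(\<Sum>t\<in>UNIV - {0}. (norm (T t))\<^sup>2) \<le> (\<Sum>t\<in>UNIV - {0}. (\<Sum>a\<in>UNIV. (norm (bt t a))\<^sup>2) * (real (card X) * B))"
    using T_bound by (intro sum_mono) auto
  also have "\<dots> \<le> (\<Sum>t\<in>UNIV. (\<Sum>a\<in>UNIV. (norm (bt t a))\<^sup>2) * (real (card X) * B))"
    by (intro sum_mono2) (auto simp: B_def intro!: mult_nonneg_nonneg sum_nonneg)
  also have "\<dots> = (\<Sum>a\<in>UNIV. \<Sum>t\<in>UNIV. (norm (bt t a))\<^sup>2) * (real (card X) * B)"
    by (subst sum.swap) (simp add: sum_distrib_right)
  also have "(\<Sum>a\<in>UNIV. \<Sum>t\<in>UNIV. (norm (bt t a))\<^sup>2) = (\<Sum>a\<in>UNIV. ?q * real (card {b. (a, b) \<in> P}))"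
    unfolding bt_def by (intro sum.cong refl additive_char_parseval \<psi>) auto
  also have "\<dots> = ?q * real (card P)"
  proof -
    have "card P = card (Sigma UNIV (\<lambda>a. {b. (a, b) \<in> P}))" by (rule arg_cong[of _ _ card]) auto
    then show ?thesis by (simp add: sum_distrib_left)
  qed
  finally have T2: "(\<Sum>t\<in>UNIV - {0}. (norm (T t))\<^sup>2) \<le> ?q * real (card P) * (real (card X) * B)" .
  have W2: "(\<Sum>t\<in>UNIV - {0}. (norm (Wh t))\<^sup>2) \<le> ?q * real (card W)"
  proof -
    have "(\<Sum>t\<in>UNIV - {0}. (norm (Wh t))\<^sup>2) \<le> (\<Sum>t\<in>UNIV. (norm (Wh t))\<^sup>2)"
      by (intro sum_mono2) auto
    also have "\<dots> = ?q * real (card W)"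
      unfolding Wh_def by (intro additive_char_parseval \<psi>) (auto intro: inj_onI)
    finally show ?thesis .
  qed
  have "?M\<^sup>2 \<le> (\<Sum>t\<in>UNIV - {0}. norm (Wh t) * norm (T t))\<^sup>2"
    using le by (intro power_mono) auto
  also have "\<dots> \<le> (\<Sum>t\<in>UNIV - {0}. (norm (Wh t))\<^sup>2) * (\<Sum>t\<in>UNIV - {0}. (norm (T t))\<^sup>2)"
    by (rule Cauchy_Schwarz_ineq_sum)
  also have "\<dots> \<le> (?q * real (card W)) * (?q * real (card P) * (real (card X) * B))"
    using W2 T2 by (intro mult_mono sum_nonneg) auto
  also have "\<dots> = ?M * (?q ^ 2 * B)" by (simp add: power2_eq_square)
  finally have "?M * ?M \<le> ?M * (?q ^ 2 * B)" by (simp add: power2_eq_square)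
  then have "?M \<le> ?q ^ 2 * B"
  proof (cases "?M = 0")
    case True
    have "0 \<le> ?q ^ 2 * B" by (simp add: B_def)
    then show ?thesis using True by linarith
  next
    case False
    then have "0 < ?M" by (simp add: less_le)
    then show ?thesis using \<open>?M * ?M \<le> ?M * (?q ^ 2 * B)\<close> by (rule mult_left_le_imp_le[rotated])
  qed
  also have "\<dots> = 2 * real d * ?q ^ 3 * sqrt ?q" by (simp add: B_def power2_eq_square power3_eq_cube)
  finally show ?thesis .
qed

section \<open>Transfer to finite fields given by a carrier set\<close>

text \<open>The sums are nested and start at 0 as in \<open>eval2_expand\<close>, because this form
  has to agree with the value of a polynomial. In \<open>incidence_property\<close> the coefficients
  with an index 0 vanish, which leads back to \<open>mixed_form\<close>.\<close>

definition carrier_mixed_form :: "'a ring \<Rightarrow> nat \<Rightarrow> (nat \<Rightarrow> nat \<Rightarrow> 'a) \<Rightarrow> 'a \<Rightarrow> 'a \<Rightarrow> 'a" where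
  "carrier_mixed_form R d f x a =
    (\<Oplus>\<^bsub>R\<^esub>k\<in>{..d}. (\<Oplus>\<^bsub>R\<^esub>i\<in>{..d}. f i k \<otimes>\<^bsub>R\<^esub> x [^]\<^bsub>R\<^esub> i) \<otimes>\<^bsub>R\<^esub> a [^]\<^bsub>R\<^esub> k)"

text \<open>A predicate on rings, so that the bound can be moved along isomorphisms between rings of
  different types.\<close>

definition incidence_property :: "'a ring \<Rightarrow> bool" where
  "incidence_property R \<longleftrightarrow> (\<forall>d f i0 k0 X W P J.
     f i0 k0 \<noteq> \<zero>\<^bsub>R\<^esub> \<longrightarrow>
     (\<forall>i k. f i k \<in> carrier R \<and> (f i k \<noteq> \<zero>\<^bsub>R\<^esub> \<longrightarrow>
        i \<in> {1..d} \<and> k \<in> {1..d} \<and> [k] \<cdot>\<^bsub>R\<^esub> \<one>\<^bsub>R\<^esub> \<noteq> \<zero>\<^bsub>R\<^esub>)) \<longrightarrow>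
     X \<subseteq> carrier R \<longrightarrow> W \<subseteq> carrier R \<longrightarrow> P \<subseteq> carrier R \<times> carrier R \<longrightarrow> J \<in> carrier R \<rightarrow> carrier R \<longrightarrow>
     (\<forall>x\<in>X. \<forall>(a, b)\<in>P. carrier_mixed_form R d f x a \<oplus>\<^bsub>R\<^esub> b \<oplus>\<^bsub>R\<^esub> J x \<notin> W) \<longrightarrow>
     real (card X) * real (card W) * real (card P) \<le> 2 * real d * real (order R) ^ 3 * sqrt (real (order R)))"

lemma incidence_property_type: "incidence_property (ring_of_type_algebra :: 'a :: finite_field ring)"
proof -
  let ?R = "ring_of_type_algebra :: 'a ring"
  interpret R: field ?R by (rule field_from_type_algebra)
  have [simp]: "carrier ?R = UNIV" "\<zero>\<^bsub>?R\<^esub> = 0" "\<one>\<^bsub>?R\<^esub> = 1" "x \<oplus>\<^bsub>?R\<^esub> y = x + y" "x \<otimes>\<^bsub>?R\<^esub> y = x * y" for x y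
    by (simp_all add: ring_of_type_algebra_def)
  have [simp]: "x [^]\<^bsub>?R\<^esub> n = x ^ n" for x and n :: nat
    by (induction n) (simp_all add: mult.commute)
  have [simp]: "[n] \<cdot>\<^bsub>?R\<^esub> 1 = (of_nat n :: 'a)" for n :: nat
  proof (induction n)
    case 0
    then show ?case using R.add.nat_pow_0[of 1] by simp
  next
    case (Suc n)
    then show ?case using R.add.nat_pow_Suc[of n 1] by (simp add: add.commute)
  qed
  have [simp]: "finsum ?R g A = sum g A" for g :: "nat \<Rightarrow> 'a" and A
  proof (induction A rule: infinite_finite_induct)
    case (infinite A)
    then show ?case using R.finsum_infinite[of A g] by simp
  next
    case empty
    then show ?case using R.finsum_empty by simp
  next
    case (insert x A)
    then show ?case by (subst R.finsum_insert) auto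
  qed
  have form: "carrier_mixed_form ?R d f x a = mixed_form d f x a"
    if "\<And>i k. f i k \<noteq> 0 \<Longrightarrow> i \<in> {1..d} \<and> k \<in> {1..d}" for d f x a
  proof -
    have "mixed_form d f x a = (\<Sum>i\<le>d. \<Sum>k\<le>d. f i k * x ^ i * a ^ k)"
    proof -
      have z: "f i k = 0" if "\<not> (i \<in> {1..d} \<and> k \<in> {1..d})" for i k
        using that \<open>\<And>i k. f i k \<noteq> 0 \<Longrightarrow> i \<in> {1..d} \<and> k \<in> {1..d}\<close> by blast
      show ?thesis
        unfolding mixed_form_def
        by (intro sum.mono_neutral_cong_left) (auto intro!: sum.mono_neutral_left sum.neutral simp: z)
    qed
    also have "\<dots> = (\<Sum>k\<le>d. \<Sum>i\<le>d. f i k * x ^ i * a ^ k)" by (rule sum.swap)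
    finally show ?thesis by (simp add: carrier_mixed_form_def sum_distrib_right)
  qed
  show ?thesis
    unfolding incidence_property_def
  proof (intro allI impI)
    fix d f i0 k0 X W P J
    assume nz: "f i0 k0 \<noteq> \<zero>\<^bsub>?R\<^esub>"
      and f: "\<forall>i k. f i k \<in> carrier ?R \<and> (f i k \<noteq> \<zero>\<^bsub>?R\<^esub> \<longrightarrow>
        i \<in> {1..d} \<and> k \<in> {1..d} \<and> [k] \<cdot>\<^bsub>?R\<^esub> \<one>\<^bsub>?R\<^esub> \<noteq> \<zero>\<^bsub>?R\<^esub>)"
      and none: "\<forall>x\<in>X. \<forall>(a, b)\<in>P. carrier_mixed_form ?R d f x a \<oplus>\<^bsub>?R\<^esub> b \<oplus>\<^bsub>?R\<^esub> J x \<notin> W"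
    have f': "i \<in> {1..d} \<and> k \<in> {1..d} \<and> of_nat k \<noteq> (0 :: 'a)" if "f i k \<noteq> 0" for i k
      using f that by simp
    have "real (card X) * real (card W) * real (card P) \<le> 2 * real d * real CARD('a) ^ 3 * sqrt (real CARD('a))"
    proof (rule no_incidence_bound[of i0 d k0 f X P J])
      show "mixed_form d f x a + b + J x \<notin> W" if "x \<in> X" "(a, b) \<in> P" for x a b
        using none that f' form[of f d x a] by fastforce
    qed (use f' nz in auto)
    then show "real (card X) * real (card W) * real (card P) \<le> 2 * real d * real (order ?R) ^ 3 * sqrt (real (order ?R))"
      by (simp add: Coset.order_def)
  qed
qed

lemma incidence_property_iso:
  fixes R :: "'a ring" and S :: "'b ring"
  assumes "field R" "field S" "finite (carrier R)" "h \<in> ring_iso R S" "incidence_property S"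
  shows "incidence_property R"
proof -
  interpret R: field R by fact
  interpret S: field S by fact
  have hom: "h \<in> ring_hom R S" and bij: "bij_betw h (carrier R) (carrier S)"
    using assms(4) by (auto simp: ring_iso_def)
  interpret h: ring_hom_cring R S h
    using hom R.is_cring S.is_cring by (simp add: ring_hom_cring_def ring_hom_cring_axioms_def)
  have inj: "inj_on h (carrier R)" using bij by (rule bij_betw_imp_inj_on)
  have order: "order R = order S" using bij by (simp add: Coset.order_def bij_betw_same_card)
  have h0: "h x = \<zero>\<^bsub>S\<^esub> \<longleftrightarrow> x = \<zero>\<^bsub>R\<^esub>" if "x \<in> carrier R" for x
    using inj_onD[OF inj, of x "\<zero>\<^bsub>R\<^esub>"] that by auto
  have h_nat: "h ([n] \<cdot>\<^bsub>R\<^esub> \<one>\<^bsub>R\<^esub>) = [n] \<cdot>\<^bsub>S\<^esub> \<one>\<^bsub>S\<^esub>" for n :: nat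
    by (induction n) simp_all
  show ?thesis
    unfolding incidence_property_def
  proof (intro allI impI)
    fix d f i0 k0 X W P J
    assume nz: "f i0 k0 \<noteq> \<zero>\<^bsub>R\<^esub>"
      and f: "\<forall>i k. f i k \<in> carrier R \<and> (f i k \<noteq> \<zero>\<^bsub>R\<^esub> \<longrightarrow>
        i \<in> {1..d} \<and> k \<in> {1..d} \<and> [k] \<cdot>\<^bsub>R\<^esub> \<one>\<^bsub>R\<^esub> \<noteq> \<zero>\<^bsub>R\<^esub>)"
      and sub: "X \<subseteq> carrier R" "W \<subseteq> carrier R" "P \<subseteq> carrier R \<times> carrier R" and J: "J \<in> carrier R \<rightarrow> carrier R"
      and none: "\<forall>x\<in>X. \<forall>(a, b)\<in>P. carrier_mixed_form R d f x a \<oplus>\<^bsub>R\<^esub> b \<oplus>\<^bsub>R\<^esub> J x \<notin> W"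
    define g where "g = inv_into (carrier R) h"
    have gh: "g (h x) = x" if "x \<in> carrier R" for x using inj that by (simp add: g_def)
    let ?f = "\<lambda>i k. h (f i k)" and ?P = "map_prod h h ` P"
    have inner: "(\<Oplus>\<^bsub>R\<^esub>i\<in>{..d}. f i k \<otimes>\<^bsub>R\<^esub> x [^]\<^bsub>R\<^esub> i) \<in> carrier R"
      "h (\<Oplus>\<^bsub>R\<^esub>i\<in>{..d}. f i k \<otimes>\<^bsub>R\<^esub> x [^]\<^bsub>R\<^esub> i) = (\<Oplus>\<^bsub>S\<^esub>i\<in>{..d}. ?f i k \<otimes>\<^bsub>S\<^esub> h x [^]\<^bsub>S\<^esub> i)"
      if "x \<in> carrier R" for x k
      using f that by (auto intro!: R.finsum_closed S.finsum_cong')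
    have form_in: "carrier_mixed_form R d f x a \<in> carrier R" if "x \<in> carrier R" "a \<in> carrier R" for x a
      unfolding carrier_mixed_form_def using inner that by (intro R.finsum_closed) auto
    have form: "carrier_mixed_form S d ?f (h x) (h a) = h (carrier_mixed_form R d f x a)"
      if "x \<in> carrier R" "a \<in> carrier R" for x a
      unfolding carrier_mixed_form_def using inner that
      by (subst h.hom_finsum) (auto intro!: S.finsum_cong' simp flip: inner(2))
    have "real (card (h ` X)) * real (card (h ` W)) * real (card ?P)
      \<le> 2 * real d * real (order S) ^ 3 * sqrt (real (order S))"
    proof (rule assms(5)[unfolded incidence_property_def, rule_format])
      show "?f i0 k0 \<noteq> \<zero>\<^bsub>S\<^esub>" using nz f h0 by blast
      show "h ` X \<subseteq> carrier S" "h ` W \<subseteq> carrier S" "?P \<subseteq> carrier S \<times> carrier S"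
        using sub by auto
      show "h \<circ> J \<circ> g \<in> carrier S \<rightarrow> carrier S"
      proof
        fix y assume "y \<in> carrier S"
        then have "g y \<in> carrier R" unfolding g_def using bij by (metis bij_betw_def inv_into_into)
        then show "(h \<circ> J \<circ> g) y \<in> carrier S" using J by auto
      qed
      fix i k
      have "f i k \<in> carrier R \<and> (f i k \<noteq> \<zero>\<^bsub>R\<^esub> \<longrightarrow>
        i \<in> {1..d} \<and> k \<in> {1..d} \<and> [k] \<cdot>\<^bsub>R\<^esub> \<one>\<^bsub>R\<^esub> \<noteq> \<zero>\<^bsub>R\<^esub>)" using f by blast
      then show "?f i k \<in> carrier S \<and> (?f i k \<noteq> \<zero>\<^bsub>S\<^esub> \<longrightarrow>
        i \<in> {1..d} \<and> k \<in> {1..d} \<and> [k] \<cdot>\<^bsub>S\<^esub> \<one>\<^bsub>S\<^esub> \<noteq> \<zero>\<^bsub>S\<^esub>)"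
        using h0 by (auto simp flip: h_nat)
    next
      fix y z assume "y \<in> h ` X" "z \<in> ?P"
      then obtain x a b where y: "y = h x" "x \<in> X" and z: "z = (h a, h b)" "(a, b) \<in> P" by auto
      have c: "x \<in> carrier R" "a \<in> carrier R" "b \<in> carrier R" "J x \<in> carrier R"
        using sub J y z by auto
      let ?v = "carrier_mixed_form R d f x a \<oplus>\<^bsub>R\<^esub> b \<oplus>\<^bsub>R\<^esub> J x"
      have v: "?v \<in> carrier R" using c form_in by simp
      have "carrier_mixed_form S d ?f (h x) (h a) \<oplus>\<^bsub>S\<^esub> h b \<oplus>\<^bsub>S\<^esub> (h \<circ> J \<circ> g) (h x) = h ?v"
        using c form_in by (simp add: form gh)
      moreover have "h ?v \<notin> h ` W"
      proof
        assume "h ?v \<in> h ` W"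
        then obtain w where w: "w \<in> W" "h ?v = h w" by auto
        then have "?v = w" using inj_onD[OF inj w(2) v] sub by blast
        then show False using none y z w by blast
      qed
      ultimately show "case z of (a, b) \<Rightarrow>
        carrier_mixed_form S d ?f y a \<oplus>\<^bsub>S\<^esub> b \<oplus>\<^bsub>S\<^esub> (h \<circ> J \<circ> g) y \<notin> h ` W"
        by (simp add: y z)
    qed
    moreover have "card (h ` X) = card X" "card (h ` W) = card W"
      using sub by (auto intro!: card_image inj_on_subset[OF inj])
    moreover have "card ?P = card P"
      by (intro card_image inj_on_subset[OF map_prod_inj_on[OF inj inj]] sub)
    ultimately show "real (card X) * real (card W) * real (card P)
      \<le> 2 * real d * real (order R) ^ 3 * sqrt (real (order R))"
      by (simp add: order)
  qed
qed

text \<open>A finite carrier injects into the integers, so rings of one fixed type represent all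
  finite fields.\<close>

lemma finite_field_copy:
  fixes R :: "'a ring"
  assumes "field R" "finite (carrier R)"
  obtains S :: "int ring" and h where "field S" "finite (carrier S)" "h \<in> ring_iso R S"
proof -
  obtain e :: "'a \<Rightarrow> nat" where "inj_on e (carrier R)"
    using assms(2) finite_imp_inj_to_nat_seg by blast
  then have inj: "inj_on (int \<circ> e) (carrier R)" by (intro comp_inj_on) auto
  show thesis
  proof (rule that)
    show "field (image_ring (int \<circ> e) R)" using assms(1) inj by (rule field.inj_imp_image_ring_is_field)
    show "finite (carrier (image_ring (int \<circ> e) R))" using assms(2) by (simp add: image_ring_carrier)
    show "int \<circ> e \<in> ring_iso R (image_ring (int \<circ> e) R)" using inj by (rule inj_imp_image_ring_iso)
  qed
qed

text \<open>
  The Weil bound is proved in terms of type classes, whereas the theorem quantifies over rings with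
  a carrier set.  To get from one to the other, the carrier of a hypothetical counterexample (or of an
  arbitrary finite field if there is none) is made into a type.
\<close>

definition critical_field :: "int ring" where
  "critical_field = (SOME R. field R \<and> finite (carrier R) \<and>
     ((\<exists>S :: int ring. field S \<and> finite (carrier S) \<and> \<not> incidence_property S) \<longrightarrow> \<not> incidence_property R))"

lemma critical_field:
  "field critical_field \<and> finite (carrier critical_field) \<and>
   ((\<exists>S :: int ring. field S \<and> finite (carrier S) \<and> \<not> incidence_property S) \<longrightarrow> \<not> incidence_property critical_field)"
  unfolding critical_field_def
proof (rule someI_ex, cases "\<exists>S :: int ring. field S \<and> finite (carrier S) \<and> \<not> incidence_property S")
  case False
  \<comment> \<open>The field with two elements only witnesses that there is a finite field to
    choose.\<close>
  have "field (ring_of_type_algebra :: gf2 ring)" by (rule field_from_type_algebra)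
  moreover have "finite (carrier (ring_of_type_algebra :: gf2 ring))"
    by (simp add: ring_of_type_algebra_def)
  ultimately obtain S :: "int ring" and h where "field S" "finite (carrier S)"
      "h \<in> ring_iso (ring_of_type_algebra :: gf2 ring) S"
    by (rule finite_field_copy)
  then show "\<exists>R :: int ring. field R \<and> finite (carrier R) \<and>
     ((\<exists>S :: int ring. field S \<and> finite (carrier S) \<and> \<not> incidence_property S) \<longrightarrow> \<not> incidence_property R)"
    using False by blast
qed blast

text \<open>A type cannot depend on a ring that is fixed within a proof. Hence one closed term has
  to stand for all possible counterexamples at once.\<close>

typedef critical = "carrier critical_field"
proof -
  have "ring critical_field" using critical_field by (intro field.is_ring) simp
  then have "\<zero>\<^bsub>critical_field\<^esub> \<in> carrier critical_field" by (rule ring.ring_simprules(2))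
  then show ?thesis by blast
qed

setup_lifting type_definition_critical

interpretation critical_field: cring critical_field
  by (rule fieldE(1)) (simp add: critical_field)

lemma critical_field_Units: "Units critical_field = carrier critical_field - {\<zero>\<^bsub>critical_field\<^esub>}"
  by (rule field.field_Units) (simp add: critical_field)

instantiation critical :: field
begin

lift_definition zero_critical :: critical is "\<zero>\<^bsub>critical_field\<^esub>" by simp
lift_definition one_critical :: critical is "\<one>\<^bsub>critical_field\<^esub>" by simp
lift_definition plus_critical :: "critical \<Rightarrow> critical \<Rightarrow> critical" is "\<lambda>x y. x \<oplus>\<^bsub>critical_field\<^esub> y" by simp
lift_definition times_critical :: "critical \<Rightarrow> critical \<Rightarrow> critical" is "\<lambda>x y. x \<otimes>\<^bsub>critical_field\<^esub> y" by simp
lift_definition uminus_critical :: "critical \<Rightarrow> critical" is "\<lambda>x. \<ominus>\<^bsub>critical_field\<^esub> x" by simp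
lift_definition minus_critical :: "critical \<Rightarrow> critical \<Rightarrow> critical" is "\<lambda>x y. x \<ominus>\<^bsub>critical_field\<^esub> y" by simp
lift_definition inverse_critical :: "critical \<Rightarrow> critical" is
  "\<lambda>x. if x = \<zero>\<^bsub>critical_field\<^esub> then \<zero>\<^bsub>critical_field\<^esub> else inv\<^bsub>critical_field\<^esub> x"
  using critical_field.Units_inv_closed critical_field_Units by auto

definition divide_critical :: "critical \<Rightarrow> critical \<Rightarrow> critical" where
  "divide_critical x y = x * inverse y"

instance
proof
  fix a b c :: critical
  show "a + b + c = a + (b + c)" by transfer (rule critical_field.a_assoc)
  show "a + b = b + a" by transfer (rule critical_field.a_comm)
  show "0 + a = a" by transfer (rule critical_field.l_zero)
  show "- a + a = 0" by transfer (rule critical_field.l_neg)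
  show "a - b = a + - b" by transfer (simp add: a_minus_def)
  show "a * b * c = a * (b * c)" by transfer (rule critical_field.m_assoc)
  show "a * b = b * a" by transfer (rule critical_field.m_comm)
  show "1 * a = a" by transfer (rule critical_field.l_one)
  show "(a + b) * c = a * c + b * c" by transfer (rule critical_field.l_distr)
  show "(0 :: critical) \<noteq> 1" by transfer (use domain.one_not_zero[OF field.axioms(1)[of critical_field]] critical_field in simp)
  show "inverse a * a = 1" if "a \<noteq> 0" using that
    by transfer (use critical_field_Units critical_field.Units_l_inv in auto)
  show "a div b = a * inverse b" by (rule divide_critical_def)
  show "inverse (0 :: critical) = 0" by transfer simp
qed

end

instance critical :: finite_field
proof
  have "(UNIV :: critical set) = Abs_critical ` carrier critical_field"
    using type_definition.Abs_image[OF type_definition_critical] by simp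
  then show "finite (UNIV :: critical set)"
    by (rule ssubst) (rule finite_imageI, simp add: critical_field)
qed

text \<open>The bound holds for the type \<open>critical\<close>, so the critical field is not a
  counterexample. By the way it was chosen there is none among the rings of integers, and every
  finite field has an isomorphic copy among them.\<close>

theorem incidence_property_finite_field:
  fixes R :: "'a ring"
  assumes "field R" "finite (carrier R)"
  shows "incidence_property R"
proof -
  have "Abs_critical \<in> ring_iso critical_field (ring_of_type_algebra :: critical ring)"
  proof (rule ring_iso_memI)
    show "bij_betw Abs_critical (carrier critical_field) (carrier (ring_of_type_algebra :: critical ring))"
      using type_definition.Abs_image[OF type_definition_critical]
      by (auto simp: bij_betw_def ring_of_type_algebra_def inj_on_def Abs_critical_inject)
  qed (auto simp: ring_of_type_algebra_def plus_critical.abs_eq times_critical.abs_eq one_critical_def eq_onp_def)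
  then have "incidence_property critical_field"
    by (rule incidence_property_iso[rotated 3])
       (simp_all add: critical_field field_from_type_algebra incidence_property_type)
  then have all: "incidence_property S" if "field S" "finite (carrier S)" for S :: "int ring"
    using conjunct2[OF conjunct2[OF critical_field]] that by blast
  obtain S :: "int ring" and h where "field S" "finite (carrier S)" "h \<in> ring_iso R S"
    by (rule finite_field_copy[OF assms])
  then show ?thesis using incidence_property_iso[OF assms(1) _ assms(2) _ all] by simp
qed

section \<open>Bivariate polynomials over a ring with a carrier\<close>

lemma finsum_commute:
  assumes "abelian_monoid G" "finite A" "finite B" "\<And>a b. a \<in> A \<Longrightarrow> b \<in> B \<Longrightarrow> f a b \<in> carrier G"
  shows "finsum G (\<lambda>a. finsum G (f a) B) A = finsum G (\<lambda>b. finsum G (\<lambda>a. f a b) A) B"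
proof -
  interpret abelian_monoid G by fact
  show ?thesis
    using assms(2,4)
  proof (induction A)
    case empty
    then show ?case by (simp add: finsum_zero)
  next
    case (insert a A)
    have "finsum G (\<lambda>a. finsum G (f a) B) (insert a A) =
      finsum G (f a) B \<oplus>\<^bsub>G\<^esub> finsum G (\<lambda>b. finsum G (\<lambda>a. f a b) A) B"
      using insert by (subst finsum_insert) (auto intro!: finsum_closed)
    also have "\<dots> = finsum G (\<lambda>b. f a b \<oplus>\<^bsub>G\<^esub> finsum G (\<lambda>a. f a b) A) B"
      using insert by (intro finsum_addf[symmetric]) (auto intro!: finsum_closed)
    also have "\<dots> = finsum G (\<lambda>b. finsum G (\<lambda>a. f a b) (insert a A)) B"
      using insert by (intro finsum_cong') (auto intro!: finsum_closed)
    finally show ?case .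
  qed
qed

section \<open>Coefficients and substitution for polynomials in one variable\<close>

lemma UP_carrier_iff:
  "p \<in> carrier (UP R) \<longleftrightarrow> (\<forall>n. p n \<in> carrier R) \<and> (\<exists>N. \<forall>n>N. p n = \<zero>\<^bsub>R\<^esub>)"
  by (auto simp: UP_def up_def bound_def)

lemma UP_carrierD: "p \<in> carrier (UP R) \<Longrightarrow> p n \<in> carrier R"
  by (simp add: UP_carrier_iff)

lemma UP_coeff [simp]: "p \<in> carrier (UP R) \<Longrightarrow> up_ring.coeff (UP R) p = p"
  by (auto simp: UP_def)

lemma UP_zero_apply [simp]: "\<zero>\<^bsub>UP R\<^esub> n = \<zero>\<^bsub>R\<^esub>"
  by (simp add: UP_def)

lemma UP_one_apply: "\<one>\<^bsub>UP R\<^esub> n = (if n = 0 then \<one>\<^bsub>R\<^esub> else \<zero>\<^bsub>R\<^esub>)"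
  by (simp add: UP_def)

lemma UP_add_apply:
  "p \<in> carrier (UP R) \<Longrightarrow> q \<in> carrier (UP R) \<Longrightarrow> (p \<oplus>\<^bsub>UP R\<^esub> q) n = p n \<oplus>\<^bsub>R\<^esub> q n"
  by (simp add: UP_def)

lemma UP_mult_apply:
  "p \<in> carrier (UP R) \<Longrightarrow> q \<in> carrier (UP R) \<Longrightarrow>
    (p \<otimes>\<^bsub>UP R\<^esub> q) n = (\<Oplus>\<^bsub>R\<^esub>i\<in>{..n}. p i \<otimes>\<^bsub>R\<^esub> q (n - i))"
  by (simp add: UP_def)

lemma UP_smult_apply:
  "c \<in> carrier R \<Longrightarrow> p \<in> carrier (UP R) \<Longrightarrow> (c \<odot>\<^bsub>UP R\<^esub> p) n = c \<otimes>\<^bsub>R\<^esub> p n"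
  by (simp add: UP_def)

lemma UP_monom_apply: "a \<in> carrier R \<Longrightarrow> up_ring.monom (UP R) a n i = (if i = n then a else \<zero>\<^bsub>R\<^esub>)"
  by (simp add: UP_def)

lemma cring_UP: "cring R \<Longrightarrow> cring (UP R)"
  by (intro UP_cring.UP_cring UP_cring.intro)

lemma domain_UP: "domain R \<Longrightarrow> domain (UP R)"
  by (intro UP_domain.UP_domain UP_domain.intro)

lemma UP_monom_closed: "cring R \<Longrightarrow> a \<in> carrier R \<Longrightarrow> up_ring.monom (UP R) a n \<in> carrier (UP R)"
  by (intro UP_ring.monom_closed UP_ring.intro cring.axioms(1))

lemma UP_finsum_apply:
  assumes "cring R" "finite A" "\<And>i. i \<in> A \<Longrightarrow> p i \<in> carrier (UP R)"
  shows "finsum (UP R) p A n = finsum R (\<lambda>i. p i n) A"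
proof -
  interpret UP_ring R "UP R" using assms(1) by (intro UP_ring.intro cring.axioms(1)) simp
  have "finsum (UP R) p A \<in> carrier (UP R)"
    using assms by (intro P.finsum_closed) auto
  then have "finsum (UP R) p A n = up_ring.coeff (UP R) (finsum (UP R) p A) n" by simp
  also have "\<dots> = finsum R (\<lambda>i. up_ring.coeff (UP R) (p i) n) A"
    using assms by (intro coeff_finsum) auto
  also have "\<dots> = finsum R (\<lambda>i. p i n) A"
    using assms by (intro R.finsum_cong') (auto intro: UP_carrierD)
  finally show ?thesis .
qed

lemma UP_mult_const_apply:
  assumes "cring R" "p \<in> carrier (UP R)" "c \<in> carrier R"
  shows "(up_ring.monom (UP R) c 0 \<otimes>\<^bsub>UP R\<^esub> p) n = c \<otimes>\<^bsub>R\<^esub> p n"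
proof -
  interpret UP_ring R "UP R" using assms(1) by (intro UP_ring.intro cring.axioms(1)) simp
  have "up_ring.monom (UP R) c 0 \<otimes>\<^bsub>UP R\<^esub> p = c \<odot>\<^bsub>UP R\<^esub> p"
    using assms by (intro monom_mult_is_smult)
  then show ?thesis using assms by (simp add: UP_smult_apply)
qed

lemma UP_map_hom:
  assumes "ring_hom_cring A B h"
  shows "(\<lambda>p. h \<circ> p) \<in> ring_hom (UP A) (UP B)"
proof -
  interpret ring_hom_cring A B h by fact
  have closed: "h \<circ> p \<in> carrier (UP B)" if p: "p \<in> carrier (UP A)" for p
  proof -
    obtain N where "\<forall>n>N. p n = \<zero>\<^bsub>A\<^esub>" using p by (auto simp: UP_carrier_iff)
    then have "\<forall>n>N. (h \<circ> p) n = \<zero>\<^bsub>B\<^esub>" by simp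
    then show ?thesis using p by (auto simp: UP_carrier_iff)
  qed
  interpret A: cring "UP A" by (rule cring_UP) (rule R.is_cring)
  show ?thesis
  proof (rule ring_hom_memI)
    fix p q assume pq: "p \<in> carrier (UP A)" "q \<in> carrier (UP A)"
    show "h \<circ> (p \<otimes>\<^bsub>UP A\<^esub> q) = (h \<circ> p) \<otimes>\<^bsub>UP B\<^esub> (h \<circ> q)"
    proof
      fix n
      have "(h \<circ> (p \<otimes>\<^bsub>UP A\<^esub> q)) n = (\<Oplus>\<^bsub>B\<^esub>i\<in>{..n}. h (p i \<otimes>\<^bsub>A\<^esub> q (n - i)))"
        using pq by (simp add: UP_mult_apply UP_carrierD comp_def)
      also have "\<dots> = (\<Oplus>\<^bsub>B\<^esub>i\<in>{..n}. (h \<circ> p) i \<otimes>\<^bsub>B\<^esub> (h \<circ> q) (n - i))"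
        using pq by (intro S.finsum_cong') (auto simp: UP_carrierD)
      finally show "(h \<circ> (p \<otimes>\<^bsub>UP A\<^esub> q)) n = ((h \<circ> p) \<otimes>\<^bsub>UP B\<^esub> (h \<circ> q)) n"
        using closed pq by (simp add: UP_mult_apply)
    qed
    show "h \<circ> (p \<oplus>\<^bsub>UP A\<^esub> q) = (h \<circ> p) \<oplus>\<^bsub>UP B\<^esub> (h \<circ> q)"
      using closed pq by (auto simp: UP_add_apply UP_carrierD)
  qed (auto simp: closed UP_one_apply)
qed

lemma UP_map_monom:
  assumes "ring_hom_cring A B h" "a \<in> carrier A"
  shows "h \<circ> up_ring.monom (UP A) a n = up_ring.monom (UP B) (h a) n"
proof -
  interpret ring_hom_cring A B h by fact
  show ?thesis using assms(2) by (auto simp: UP_monom_apply)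
qed

lemma const_hom: "cring R \<Longrightarrow> ring_hom_cring R (UP R) (\<lambda>r. up_ring.monom (UP R) r 0)"
  by (intro ring_hom_cringI cring_UP UP_ring.const_ring_hom UP_ring.intro cring.axioms(1))

lemma ring_hom_cring_comp:
  assumes "ring_hom_cring A B g" "ring_hom_cring B C h"
  shows "ring_hom_cring A C (h \<circ> g)"
proof -
  interpret g: ring_hom_cring A B g by fact
  interpret h: ring_hom_cring B C h by fact
  show ?thesis
    by (intro ring_hom_cringI g.R.is_cring h.S.is_cring ring_hom_trans[OF g.homh h.homh])
qed

lemma eval_hom:
  assumes "ring_hom_cring R S h" "s \<in> carrier S"
  shows "ring_hom_cring (UP R) S (UnivPoly.eval R S h s)"
proof -
  interpret ring_hom_cring R S h by fact
  have "UP_pre_univ_prop R S h" by (intro UP_pre_univ_propI R.is_cring S.is_cring homh)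
  then have "UnivPoly.eval R S h s \<in> ring_hom (UP R) S"
    using assms(2) by (rule UP_pre_univ_prop.eval_ring_hom)
  then show ?thesis by (intro ring_hom_cringI cring_UP R.is_cring S.is_cring)
qed

lemma eval_monom_gen:
  assumes "ring_hom_cring R S h" "s \<in> carrier S" "r \<in> carrier R"
  shows "UnivPoly.eval R S h s (up_ring.monom (UP R) r n) = h r \<otimes>\<^bsub>S\<^esub> s [^]\<^bsub>S\<^esub> n"
proof -
  interpret ring_hom_cring R S h by fact
  have "UP_pre_univ_prop R S h" by (intro UP_pre_univ_propI R.is_cring S.is_cring homh)
  then show ?thesis using assms by (intro UP_pre_univ_prop.eval_monom)
qed

lemma eval_const_gen:
  assumes "ring_hom_cring R S h" "s \<in> carrier S" "r \<in> carrier R"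
  shows "UnivPoly.eval R S h s (up_ring.monom (UP R) r 0) = h r"
proof -
  interpret ring_hom_cring R S h by fact
  show ?thesis using assms(2,3) by (simp add: eval_monom_gen[OF assms])
qed

lemma UP_monom_repr:
  assumes "cring R" "p \<in> carrier (UP R)" "\<And>i. i > n \<Longrightarrow> p i = \<zero>\<^bsub>R\<^esub>"
  shows "p = (\<Oplus>\<^bsub>UP R\<^esub>i\<in>{..n}. up_ring.monom (UP R) (p i) i)"
proof -
  interpret UP_ring R "UP R" using assms(1) by (intro UP_ring.intro cring.axioms(1)) simp
  have "deg R p \<le> n" using assms by (intro deg_aboveI) auto
  then show ?thesis using up_repr_le[of p n] assms(2) by simp
qed

lemma eval_expand:
  assumes h: "ring_hom_cring R S h" and s: "s \<in> carrier S" and p: "p \<in> carrier (UP R)"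
    and n: "\<And>i. i > n \<Longrightarrow> p i = \<zero>\<^bsub>R\<^esub>"
  shows "UnivPoly.eval R S h s p = (\<Oplus>\<^bsub>S\<^esub>i\<in>{..n}. h (p i) \<otimes>\<^bsub>S\<^esub> s [^]\<^bsub>S\<^esub> i)"
proof -
  interpret h: ring_hom_cring R S h by fact
  interpret E: ring_hom_cring "UP R" S "UnivPoly.eval R S h s" using h s by (rule eval_hom)
  have "UnivPoly.eval R S h s p = UnivPoly.eval R S h s (\<Oplus>\<^bsub>UP R\<^esub>i\<in>{..n}. up_ring.monom (UP R) (p i) i)"
    by (rule arg_cong[OF UP_monom_repr[OF h.R.is_cring p n]])
  also have "\<dots> = (\<Oplus>\<^bsub>S\<^esub>i\<in>{..n}. UnivPoly.eval R S h s (up_ring.monom (UP R) (p i) i))"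
  proof -
    have "up_ring.monom (UP R) (p i) i \<in> carrier (UP R)" for i
      by (rule UP_monom_closed[OF h.R.is_cring UP_carrierD[OF p]])
    then show ?thesis by (subst E.hom_finsum) (simp_all add: comp_def)
  qed
  also have "\<dots> = (\<Oplus>\<^bsub>S\<^esub>i\<in>{..n}. h (p i) \<otimes>\<^bsub>S\<^esub> s [^]\<^bsub>S\<^esub> i)"
    using p s by (intro h.S.finsum_cong') (auto simp: eval_monom_gen[OF h] UP_carrierD)
  finally show ?thesis .
qed

lemma UP_bound_obtain:
  assumes "p \<in> carrier (UP R)"
  obtains n where "\<And>i. i > n \<Longrightarrow> p i = \<zero>\<^bsub>R\<^esub>"
  using assms by (auto simp: UP_carrier_iff)

text \<open>Both sides expand to the same finite sum. Identities between nested substitutions are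
  later reduced through this lemma to their values at variables and constants; \<open>h'\<close>
  need only agree with the composition on the carrier.\<close>

lemma eval_natural:
  assumes h: "ring_hom_cring R S h" and g: "ring_hom_cring S T g" and s: "s \<in> carrier S" and p: "p \<in> carrier (UP R)"
    and eq: "\<And>r. r \<in> carrier R \<Longrightarrow> h' r = g (h r)"
  shows "g (UnivPoly.eval R S h s p) = UnivPoly.eval R T h' (g s) p"
proof -
  interpret h: ring_hom_cring R S h by fact
  interpret g: ring_hom_cring S T g by fact
  have gh: "ring_hom_cring R T (g \<circ> h)" using h g by (rule ring_hom_cring_comp)
  have h': "ring_hom_cring R T h'"
  proof (intro ring_hom_cringI h.R.is_cring g.S.is_cring)
    show "h' \<in> ring_hom R T" by (rule ring_hom_memI) (simp_all add: eq)
  qed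
  obtain n where n: "\<And>i. i > n \<Longrightarrow> p i = \<zero>\<^bsub>R\<^esub>" using UP_bound_obtain[OF p] by blast
  have "g (UnivPoly.eval R S h s p) = (\<Oplus>\<^bsub>T\<^esub>i\<in>{..n}. g (h (p i) \<otimes>\<^bsub>S\<^esub> s [^]\<^bsub>S\<^esub> i))"
    using p s by (subst eval_expand[OF h s p n], simp, subst g.hom_finsum) (auto simp: comp_def UP_carrierD)
  also have "\<dots> = (\<Oplus>\<^bsub>T\<^esub>i\<in>{..n}. h' (p i) \<otimes>\<^bsub>T\<^esub> g s [^]\<^bsub>T\<^esub> i)"
    using p s by (intro g.S.finsum_cong') (auto simp: UP_carrierD eq)
  also have "\<dots> = UnivPoly.eval R T h' (g s) p"
    using s by (intro eval_expand[OF h' _ p n, symmetric]) auto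
  finally show ?thesis .
qed

lemma eval_cong:
  assumes h: "ring_hom_cring R S h" and s: "s \<in> carrier S" and p: "p \<in> carrier (UP R)"
    and eq: "\<And>r. r \<in> carrier R \<Longrightarrow> h' r = h r"
  shows "UnivPoly.eval R S h' s p = UnivPoly.eval R S h s p"
proof -
  interpret h: ring_hom_cring R S h by fact
  have "ring_hom_cring S S id" by (rule ring_hom_cringI[OF h.S.is_cring h.S.is_cring]) (rule ring_hom_memI; simp)
  then have "id (UnivPoly.eval R S h s p) = UnivPoly.eval R S h' (id s) p"
    by (rule eval_natural[OF h _ s p]) (simp add: eq)
  then show ?thesis by simp
qed

lemma eval_id:
  assumes "cring R" "p \<in> carrier (UP R)"
  shows "UnivPoly.eval R (UP R) (\<lambda>r. up_ring.monom (UP R) r 0) (up_ring.monom (UP R) \<one>\<^bsub>R\<^esub> 1) p = p"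
proof -
  interpret UP_cring R "UP R" using assms(1) by (intro UP_cring.intro) simp
  obtain n where n: "\<And>i. i > n \<Longrightarrow> p i = \<zero>\<^bsub>R\<^esub>" using UP_bound_obtain[OF assms(2)] by blast
  have "UnivPoly.eval R (UP R) (\<lambda>r. up_ring.monom (UP R) r 0) (up_ring.monom (UP R) \<one>\<^bsub>R\<^esub> 1) p =
    (\<Oplus>\<^bsub>UP R\<^esub>i\<in>{..n}. up_ring.monom (UP R) (p i) 0 \<otimes>\<^bsub>UP R\<^esub> up_ring.monom (UP R) \<one>\<^bsub>R\<^esub> 1 [^]\<^bsub>UP R\<^esub> i)"
    using assms n by (intro eval_expand const_hom) auto
  also have "\<dots> = (\<Oplus>\<^bsub>UP R\<^esub>i\<in>{..n}. up_ring.monom (UP R) (p i) i)"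
    using assms by (intro P.finsum_cong') (auto simp: monom_pow UP_carrierD simp flip: monom_mult)
  also have "\<dots> = p" by (rule UP_monom_repr[OF assms n, symmetric])
  finally show ?thesis .
qed

section \<open>Substitution for polynomials in two variables\<close>

lemma X2_closed: "cring R \<Longrightarrow> X2 R \<in> carrier (UP2 R)"
  unfolding X2_def by (intro UP_monom_closed cring_UP) (auto intro: cring.cring_simprules)

lemma Y2_closed: "cring R \<Longrightarrow> Y2 R \<in> carrier (UP2 R)"
  unfolding Y2_def by (intro UP_monom_closed cring_UP cring.cring_simprules(6))

lemma const2_hom: "cring R \<Longrightarrow> ring_hom_cring R (UP2 R) (const2 R)"
  using ring_hom_cring_comp[OF const_hom const_hom[OF cring_UP], of R]
  by (simp add: comp_def const2_def[abs_def])

lemma const2_closed: "cring R \<Longrightarrow> r \<in> carrier R \<Longrightarrow> const2 R r \<in> carrier (UP2 R)"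
  unfolding const2_def by (intro UP_monom_closed cring_UP)

lemma const2_mult_apply:
  assumes "cring R" "p \<in> carrier (UP2 R)" "r \<in> carrier R"
  shows "(const2 R r \<otimes>\<^bsub>UP2 R\<^esub> p) k j = r \<otimes>\<^bsub>R\<^esub> p k j"
  unfolding const2_def using assms
  by (simp add: UP_mult_const_apply cring_UP UP_monom_closed UP_carrierD)

lemma eval2_hom:
  assumes "ring_hom_cring R S h" "a \<in> carrier S" "b \<in> carrier S"
  shows "ring_hom_cring (UP2 R) S (eval2 R S h a b)"
proof -
  have "eval2 R S h a b = UnivPoly.eval (UP R) S (UnivPoly.eval R S h a) b" by (rule ext) (simp add: eval2_def)
  then show ?thesis using eval_hom[OF eval_hom[OF assms(1,2)] assms(3)] by simp
qed

lemma eval2_const: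
  assumes h: "ring_hom_cring R S h" "a \<in> carrier S" "b \<in> carrier S" and r: "r \<in> carrier R"
  shows "eval2 R S h a b (const2 R r) = h r"
proof -
  interpret ring_hom_cring R S h by fact
  show ?thesis using assms
    by (simp add: eval2_def const2_def eval_const_gen[OF eval_hom] eval_const_gen UP_monom_closed R.is_cring)
qed

lemma eval2_X2:
  assumes h: "ring_hom_cring R S h" "a \<in> carrier S" "b \<in> carrier S"
  shows "eval2 R S h a b (X2 R) = a"
proof -
  interpret ring_hom_cring R S h by fact
  show ?thesis using assms
    by (simp add: eval2_def X2_def eval_const_gen[OF eval_hom] eval_monom_gen UP_monom_closed R.is_cring)
qed

lemma eval2_Y2:
  assumes h: "ring_hom_cring R S h" "a \<in> carrier S" "b \<in> carrier S"
  shows "eval2 R S h a b (Y2 R) = b"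
proof -
  interpret ring_hom_cring R S h by fact
  interpret U: cring "UP R" by (rule cring_UP[OF R.is_cring])
  interpret E: ring_hom_cring "UP R" S "UnivPoly.eval R S h a" using h(1,2) by (rule eval_hom)
  show ?thesis using assms
    by (simp add: eval2_def Y2_def eval_monom_gen[OF eval_hom])
qed

lemma eval2_natural:
  assumes h: "ring_hom_cring R S h" and g: "ring_hom_cring S T g" and ab: "a \<in> carrier S" "b \<in> carrier S"
    and p: "p \<in> carrier (UP2 R)" and eq: "\<And>r. r \<in> carrier R \<Longrightarrow> h' r = g (h r)"
  shows "g (eval2 R S h a b p) = eval2 R T h' (g a) (g b) p"
  unfolding eval2_def
  by (rule eval_natural[OF eval_hom[OF h ab(1)] g ab(2) p]) (rule eval_natural[OF h g ab(1) _ eq, symmetric])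

lemma eval2_id:
  assumes R: "cring R" and p: "p \<in> carrier (UP2 R)"
  shows "eval2 R (UP2 R) (const2 R) (X2 R) (Y2 R) p = p"
proof -
  have "UnivPoly.eval R (UP2 R) (const2 R) (X2 R) c = up_ring.monom (UP2 R) c 0" if c: "c \<in> carrier (UP R)" for c
  proof -
    have "up_ring.monom (UP2 R) (UnivPoly.eval R (UP R) (\<lambda>r. up_ring.monom (UP R) r 0) (up_ring.monom (UP R) \<one>\<^bsub>R\<^esub> 1) c) 0 =
      UnivPoly.eval R (UP2 R) (const2 R) (up_ring.monom (UP2 R) (up_ring.monom (UP R) \<one>\<^bsub>R\<^esub> 1) 0) c"
      using R c by (intro eval_natural[where g = "\<lambda>c. up_ring.monom (UP2 R) c 0"] const_hom cring_UP UP_monom_closed)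
        (auto simp: const2_def intro: cring.cring_simprules)
    then show ?thesis by (simp only: eval_id[OF R c] X2_def)
  qed
  then have "eval2 R (UP2 R) (const2 R) (X2 R) (Y2 R) p =
    UnivPoly.eval (UP R) (UP2 R) (\<lambda>c. up_ring.monom (UP2 R) c 0) (Y2 R) p"
    unfolding eval2_def using R p by (intro eval_cong const_hom cring_UP Y2_closed)
  also have "\<dots> = p" unfolding Y2_def using R p by (intro eval_id cring_UP)
  finally show ?thesis .
qed

lemma UP2_carrierD: "p \<in> carrier (UP2 R) \<Longrightarrow> p k j \<in> carrier R"
  by (rule UP_carrierD[OF UP_carrierD])

lemma UP2_apply:
  assumes "cring R" "p \<in> carrier (UP2 R)" "q \<in> carrier (UP2 R)"
  shows "(p \<oplus>\<^bsub>UP2 R\<^esub> q) k j = p k j \<oplus>\<^bsub>R\<^esub> q k j"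
    and "(p \<otimes>\<^bsub>UP2 R\<^esub> q) k j = (\<Oplus>\<^bsub>R\<^esub>s\<in>{..k}. \<Oplus>\<^bsub>R\<^esub>i\<in>{..j}. p s i \<otimes>\<^bsub>R\<^esub> q (k - s) (j - i))"
proof -
  interpret R: cring R by fact
  interpret U: cring "UP R" by (rule cring_UP) fact
  show "(p \<oplus>\<^bsub>UP2 R\<^esub> q) k j = p k j \<oplus>\<^bsub>R\<^esub> q k j"
    using assms by (simp add: UP_add_apply UP_carrierD)
  have "(p \<otimes>\<^bsub>UP2 R\<^esub> q) k j = (\<Oplus>\<^bsub>R\<^esub>s\<in>{..k}. (p s \<otimes>\<^bsub>UP R\<^esub> q (k - s)) j)"
    using assms by (simp add: UP_mult_apply UP_finsum_apply UP_carrierD)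
  also have "\<dots> = (\<Oplus>\<^bsub>R\<^esub>s\<in>{..k}. \<Oplus>\<^bsub>R\<^esub>i\<in>{..j}. p s i \<otimes>\<^bsub>R\<^esub> q (k - s) (j - i))"
    using assms by (intro R.finsum_cong') (auto simp: UP_mult_apply UP_carrierD intro!: R.finsum_closed)
  finally show "(p \<otimes>\<^bsub>UP2 R\<^esub> q) k j = (\<Oplus>\<^bsub>R\<^esub>s\<in>{..k}. \<Oplus>\<^bsub>R\<^esub>i\<in>{..j}. p s i \<otimes>\<^bsub>R\<^esub> q (k - s) (j - i))" .
qed

text \<open>A bound for the degree in each variable separately. Unlike a bound for the total degree
  it leaves a full square of free coefficients, which makes counting easy. The first index
  \<open>k\<close> is the exponent of the second variable.\<close>

definition bideg_le :: "('a, 'm) ring_scheme \<Rightarrow> nat \<Rightarrow> (nat \<Rightarrow> nat \<Rightarrow> 'a) set" where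
  "bideg_le R e = {p. (\<forall>k j. p k j \<in> carrier R) \<and> (\<forall>k j. k > e \<or> j > e \<longrightarrow> p k j = \<zero>\<^bsub>R\<^esub>)}"

lemma bideg_le_closed: "p \<in> bideg_le R e \<Longrightarrow> p \<in> carrier (UP2 R)"
proof -
  assume p: "p \<in> bideg_le R e"
  have row: "p k \<in> carrier (UP R)" for k
    using p by (auto simp: bideg_le_def UP_carrier_iff intro!: exI[of _ e])
  have "p k = \<zero>\<^bsub>UP R\<^esub>" if "k > e" for k
    using p that by (auto simp: bideg_le_def)
  then show ?thesis using row by (auto simp: UP_carrier_iff[of p] intro!: exI[of _ e])
qed

lemma bideg_le_obtain:
  assumes p: "p \<in> carrier (UP2 R)"
  obtains e where "p \<in> bideg_le R e"
proof -
  obtain n where n: "\<And>k. k > n \<Longrightarrow> p k = \<zero>\<^bsub>UP R\<^esub>" using UP_bound_obtain[OF p] by blast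
  have "\<exists>m. \<forall>j>m. p k j = \<zero>\<^bsub>R\<^esub>" for k
    using UP_carrierD[OF p, of k] by (simp add: UP_carrier_iff)
  then obtain m where m: "\<And>k j. j > m k \<Longrightarrow> p k j = \<zero>\<^bsub>R\<^esub>" by metis
  define e where "e = Max (insert n (m ` {..n}))"
  have "n \<le> e" "\<And>k. k \<le> n \<Longrightarrow> m k \<le> e" unfolding e_def by (rule Max_ge; simp)+
  then have "p k j = \<zero>\<^bsub>R\<^esub>" if "k > e \<or> j > e" for k j
  proof (cases "k \<le> n")
    case True
    then have "m k \<le> e" "k \<le> e" using \<open>n \<le> e\<close> \<open>\<And>k. k \<le> n \<Longrightarrow> m k \<le> e\<close>[of k] by auto
    then show ?thesis using that m[of k j] by auto
  next
    case False
    then show ?thesis using n[of k] by simp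
  qed
  then show thesis using p that[of e] by (simp add: bideg_le_def UP2_carrierD)
qed

lemma bideg_le_mono: "p \<in> bideg_le R e \<Longrightarrow> e \<le> e' \<Longrightarrow> p \<in> bideg_le R e'"
  by (auto simp: bideg_le_def)

lemma bideg_le_add:
  assumes "cring R" "p \<in> bideg_le R e" "q \<in> bideg_le R e"
  shows "p \<oplus>\<^bsub>UP2 R\<^esub> q \<in> bideg_le R e"
proof -
  interpret cring R by fact
  show ?thesis using assms bideg_le_closed[OF assms(2)] bideg_le_closed[OF assms(3)]
    by (auto simp: bideg_le_def UP2_apply)
qed

lemma bideg_le_zero: "cring R \<Longrightarrow> \<zero>\<^bsub>UP2 R\<^esub> \<in> bideg_le R e"
  by (auto simp: bideg_le_def intro: cring.cring_simprules)

lemma bideg_le_finsum: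
  assumes R: "cring R" and p: "\<And>i. i \<in> A \<Longrightarrow> p i \<in> bideg_le R e"
  shows "finsum (UP2 R) p A \<in> bideg_le R e"
proof -
  interpret U: cring "UP2 R" by (intro cring_UP R)
  show ?thesis
    using p
  proof (induction A rule: infinite_finite_induct)
    case (insert a A)
    then show ?case
      by (subst U.finsum_insert) (auto intro: bideg_le_closed bideg_le_add[OF R])
  qed (simp_all add: bideg_le_zero[OF R])
qed

lemma bideg_le_mult:
  assumes R: "cring R" and pq: "p \<in> bideg_le R e" "q \<in> bideg_le R e'"
  shows "p \<otimes>\<^bsub>UP2 R\<^esub> q \<in> bideg_le R (e + e')"
proof -
  interpret cring R by fact
  have c: "p \<in> carrier (UP2 R)" "q \<in> carrier (UP2 R)" using pq bideg_le_closed by blast+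
  have pc: "p s i \<in> carrier R" "q s i \<in> carrier R" for s i using pq by (auto simp: bideg_le_def)
  have "(p \<otimes>\<^bsub>UP2 R\<^esub> q) k j = \<zero>\<^bsub>R\<^esub>" if kj: "k > e + e' \<or> j > e + e'" for k j
  proof -
    have "p s i \<otimes>\<^bsub>R\<^esub> q (k - s) (j - i) = \<zero>\<^bsub>R\<^esub>" for s i
    proof -
      have "s > e \<or> i > e \<or> k - s > e' \<or> j - i > e'" using kj by arith
      then have "p s i = \<zero>\<^bsub>R\<^esub> \<or> q (k - s) (j - i) = \<zero>\<^bsub>R\<^esub>" using pq by (auto simp: bideg_le_def)
      then show ?thesis using pc by auto
    qed
    then show ?thesis by (simp add: UP2_apply[OF R c] finsum_zero)
  qed
  moreover have "(p \<otimes>\<^bsub>UP2 R\<^esub> q) k j \<in> carrier R" for k j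
    by (simp add: UP2_apply[OF R c] pc finsum_closed)
  ultimately show ?thesis by (auto simp: bideg_le_def)
qed

lemma bideg_le_const2: "cring R \<Longrightarrow> r \<in> carrier R \<Longrightarrow> const2 R r \<in> bideg_le R 0"
  by (auto simp: bideg_le_def const2_def UP_monom_apply UP_monom_closed cring.cring_simprules)

lemma bideg_le_pow:
  assumes R: "cring R" and p: "p \<in> bideg_le R e"
  shows "p [^]\<^bsub>UP2 R\<^esub> n \<in> bideg_le R (n * e)"
proof -
  interpret U: cring "UP2 R" by (intro cring_UP R)
  interpret R: cring R by fact
  have one: "\<one>\<^bsub>UP2 R\<^esub> = const2 R \<one>\<^bsub>R\<^esub>"
    using ring_hom_cring.axioms(3)[OF const2_hom[OF R]] by (simp add: ring_hom_cring_axioms_def ring_hom_one)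
  show ?thesis
  proof (induction n)
    case 0
    then show ?case using bideg_le_const2[OF R] by (simp add: one)
  next
    case (Suc n)
    then show ?case using bideg_le_mult[OF R Suc.IH p] by (simp add: add.commute)
  qed
qed

lemma eval2_expand:
  assumes h: "ring_hom_cring R S h" and ab: "a \<in> carrier S" "b \<in> carrier S" and p: "p \<in> bideg_le R n"
  shows "eval2 R S h a b p =
    (\<Oplus>\<^bsub>S\<^esub>k\<in>{..n}. (\<Oplus>\<^bsub>S\<^esub>j\<in>{..n}. h (p k j) \<otimes>\<^bsub>S\<^esub> a [^]\<^bsub>S\<^esub> j) \<otimes>\<^bsub>S\<^esub> b [^]\<^bsub>S\<^esub> k)"
proof -
  interpret ring_hom_cring R S h by fact
  have c: "p \<in> carrier (UP2 R)" using p by (rule bideg_le_closed)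
  have "eval2 R S h a b p = (\<Oplus>\<^bsub>S\<^esub>k\<in>{..n}. UnivPoly.eval R S h a (p k) \<otimes>\<^bsub>S\<^esub> b [^]\<^bsub>S\<^esub> k)"
    unfolding eval2_def using p by (intro eval_expand[OF eval_hom[OF h ab(1)] ab(2) c]) (auto simp: bideg_le_def)
  also have "\<dots> = (\<Oplus>\<^bsub>S\<^esub>k\<in>{..n}. (\<Oplus>\<^bsub>S\<^esub>j\<in>{..n}. h (p k j) \<otimes>\<^bsub>S\<^esub> a [^]\<^bsub>S\<^esub> j) \<otimes>\<^bsub>S\<^esub> b [^]\<^bsub>S\<^esub> k)"
  proof (rule S.finsum_cong')
    show "(\<lambda>k. (\<Oplus>\<^bsub>S\<^esub>j\<in>{..n}. h (p k j) \<otimes>\<^bsub>S\<^esub> a [^]\<^bsub>S\<^esub> j) \<otimes>\<^bsub>S\<^esub> b [^]\<^bsub>S\<^esub> k) \<in> {..n} \<rightarrow> carrier S"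
      using ab c by (auto intro!: S.finsum_closed simp: UP2_carrierD)
    fix k
    have "UnivPoly.eval R S h a (p k) = (\<Oplus>\<^bsub>S\<^esub>j\<in>{..n}. h (p k j) \<otimes>\<^bsub>S\<^esub> a [^]\<^bsub>S\<^esub> j)"
      using p by (intro eval_expand[OF h ab(1) UP_carrierD[OF c]]) (auto simp: bideg_le_def)
    then show "UnivPoly.eval R S h a (p k) \<otimes>\<^bsub>S\<^esub> b [^]\<^bsub>S\<^esub> k = (\<Oplus>\<^bsub>S\<^esub>j\<in>{..n}. h (p k j) \<otimes>\<^bsub>S\<^esub> a [^]\<^bsub>S\<^esub> j) \<otimes>\<^bsub>S\<^esub> b [^]\<^bsub>S\<^esub> k"
      by simp
  qed simp
  finally show ?thesis .
qed

text \<open>\<open>deg\<close> sees only the outer variable; exchanging the variables makes the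
  degree in the inner one accessible.\<close>

definition swap2 :: "(nat \<Rightarrow> nat \<Rightarrow> 'a) \<Rightarrow> nat \<Rightarrow> nat \<Rightarrow> 'a" where
  "swap2 p = (\<lambda>k j. p j k)"

lemma swap2_bideg_le [simp]: "swap2 p \<in> bideg_le R e \<longleftrightarrow> p \<in> bideg_le R e"
  by (auto simp: swap2_def bideg_le_def)

lemma swap2_closed: "p \<in> carrier (UP2 R) \<Longrightarrow> swap2 p \<in> carrier (UP2 R)"
  by (erule bideg_le_obtain) (simp add: bideg_le_closed)

lemma UP2_one_apply: "\<one>\<^bsub>UP2 R\<^esub> k j = (if k = 0 \<and> j = 0 then \<one>\<^bsub>R\<^esub> else \<zero>\<^bsub>R\<^esub>)"
  by (simp add: UP_one_apply)

lemma const2_apply: "cring R \<Longrightarrow> r \<in> carrier R \<Longrightarrow> const2 R r k j = (if k = 0 \<and> j = 0 then r else \<zero>\<^bsub>R\<^esub>)"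
  by (simp add: const2_def UP_monom_apply UP_monom_closed)

lemma swap2_hom:
  assumes R: "cring R"
  shows "ring_hom_cring (UP2 R) (UP2 R) swap2"
proof (intro ring_hom_cringI cring_UP R ring_hom_memI)
  interpret R: cring R by fact
  interpret U: cring "UP2 R" by (intro cring_UP R)
  fix p q assume pq: "p \<in> carrier (UP2 R)" "q \<in> carrier (UP2 R)"
  show "swap2 p \<in> carrier (UP2 R)" using pq(1) by (rule swap2_closed)
  show "swap2 (p \<oplus>\<^bsub>UP2 R\<^esub> q) = swap2 p \<oplus>\<^bsub>UP2 R\<^esub> swap2 q"
  proof (intro ext)
    fix k j
    show "swap2 (p \<oplus>\<^bsub>UP2 R\<^esub> q) k j = (swap2 p \<oplus>\<^bsub>UP2 R\<^esub> swap2 q) k j"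
      by (simp only: UP2_apply(1)[OF R swap2_closed[OF pq(1)] swap2_closed[OF pq(2)]])
         (simp add: swap2_def UP2_apply(1)[OF R pq])
  qed
  show "swap2 (p \<otimes>\<^bsub>UP2 R\<^esub> q) = swap2 p \<otimes>\<^bsub>UP2 R\<^esub> swap2 q"
  proof (intro ext)
    fix k j
    have "swap2 (p \<otimes>\<^bsub>UP2 R\<^esub> q) k j = (\<Oplus>\<^bsub>R\<^esub>s\<in>{..j}. \<Oplus>\<^bsub>R\<^esub>i\<in>{..k}. p s i \<otimes>\<^bsub>R\<^esub> q (j - s) (k - i))"
      by (simp add: swap2_def UP2_apply(2)[OF R pq])
    also have "\<dots> = (\<Oplus>\<^bsub>R\<^esub>i\<in>{..k}. \<Oplus>\<^bsub>R\<^esub>s\<in>{..j}. p s i \<otimes>\<^bsub>R\<^esub> q (j - s) (k - i))"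
      by (rule finsum_commute[OF R.abelian_monoid_axioms]) (use pq in \<open>simp_all add: UP2_carrierD\<close>)
    also have "\<dots> = (swap2 p \<otimes>\<^bsub>UP2 R\<^esub> swap2 q) k j"
      by (simp only: UP2_apply(2)[OF R swap2_closed[OF pq(1)] swap2_closed[OF pq(2)]]) (simp add: swap2_def)
    finally show "swap2 (p \<otimes>\<^bsub>UP2 R\<^esub> q) k j = (swap2 p \<otimes>\<^bsub>UP2 R\<^esub> swap2 q) k j" .
  qed
next
  show "swap2 \<one>\<^bsub>UP2 R\<^esub> = \<one>\<^bsub>UP2 R\<^esub>"
    by (intro ext) (auto simp: swap2_def UP2_one_apply simp del: UP_one_apply)
qed

lemma swap2_const2: "cring R \<Longrightarrow> r \<in> carrier R \<Longrightarrow> swap2 (const2 R r) = const2 R r"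
  by (intro ext) (simp add: swap2_def const2_apply)

text \<open>If \<open>G\<close> has positive degree, its powers have distinct degrees, so the
  largest \<open>L\<close> with a nonzero coefficient gives \<open>p\<close> the degree
  \<open>L * deg S G\<close>. The constant \<open>e\<close> does not interfere because
  \<open>L\<close> is at least \<open>K\<close>, hence positive.\<close>

lemma power_combination_degree:
  assumes S: "domain S" and G: "G \<in> carrier (UP S)" and c: "\<And>s. c s \<in> carrier S" and e: "e \<in> carrier S"
    and K: "1 \<le> K" "K \<le> M" "c K \<noteq> \<zero>\<^bsub>S\<^esub>"
    and p: "p = (\<Oplus>\<^bsub>UP S\<^esub>s\<in>{..M}. up_ring.monom (UP S) (c s) 0 \<otimes>\<^bsub>UP S\<^esub> G [^]\<^bsub>UP S\<^esub> s) \<oplus>\<^bsub>UP S\<^esub> up_ring.monom (UP S) e 0"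
    and N: "\<And>n. n > N \<Longrightarrow> p n = \<zero>\<^bsub>S\<^esub>"
  shows "K * deg S G \<le> N"
proof (cases "deg S G = 0")
  case False
  interpret UP_domain S "UP S" using S by (intro UP_domain.intro) simp
  have cr: "cring S" by (rule R.is_cring)
  define D where "D = deg S G"
  have D: "1 \<le> D" using False by (simp add: D_def)
  have G0: "G \<noteq> \<zero>\<^bsub>UP S\<^esub>" using False by auto
  have pow: "G [^]\<^bsub>UP S\<^esub> s \<in> carrier (UP S) \<and> G [^]\<^bsub>UP S\<^esub> s \<noteq> \<zero>\<^bsub>UP S\<^esub> \<and> deg S (G [^]\<^bsub>UP S\<^esub> s) = s * D" for s :: nat
  proof (induction s)
    case 0
    then show ?case using domain.one_not_zero[OF domain_UP[OF S]] by (simp del: UP_zero_apply)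
  next
    case (Suc s)
    then show ?case using G G0 by (auto simp: D_def domain.integral_iff[OF domain_UP[OF S]] simp del: UP_zero_apply)
  qed
  define L where "L = Max {s \<in> {..M}. c s \<noteq> \<zero>\<^bsub>S\<^esub>}"
  have "L \<in> {s \<in> {..M}. c s \<noteq> \<zero>\<^bsub>S\<^esub>}" unfolding L_def using K by (intro Max_in) auto
  then have L: "L \<le> M" "c L \<noteq> \<zero>\<^bsub>S\<^esub>" by auto
  have KL: "K \<le> L" unfolding L_def using K by (intro Max_ge) auto
  have above: "c s = \<zero>\<^bsub>S\<^esub>" if "s \<le> M" "L < s" for s
  proof (rule ccontr)
    assume "c s \<noteq> \<zero>\<^bsub>S\<^esub>"
    then have "s \<le> L" unfolding L_def using that by (intro Max_ge) auto
    then show False using that by simp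
  qed
  have G_s: "(G [^]\<^bsub>UP S\<^esub> s) n \<in> carrier S" for s n :: nat
    using UP_carrierD[of "G [^]\<^bsub>UP S\<^esub> s"] pow[of s] by blast
  have term_n: "(up_ring.monom (UP S) (c s) 0 \<otimes>\<^bsub>UP S\<^esub> G [^]\<^bsub>UP S\<^esub> s) n = c s \<otimes>\<^bsub>S\<^esub> (G [^]\<^bsub>UP S\<^esub> s) n" for s n :: nat
    using pow[of s] c by (intro UP_mult_const_apply[OF cr]) auto
  have L0: "L * D \<noteq> 0" using KL K D by auto
  have tc: "up_ring.monom (UP S) (c s) 0 \<otimes>\<^bsub>UP S\<^esub> G [^]\<^bsub>UP S\<^esub> s \<in> carrier (UP S)" for s :: nat
    using c pow by simp
  have "p (L * D) = (\<Oplus>\<^bsub>UP S\<^esub>s\<in>{..M}. up_ring.monom (UP S) (c s) 0 \<otimes>\<^bsub>UP S\<^esub> G [^]\<^bsub>UP S\<^esub> s) (L * D)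
      \<oplus>\<^bsub>S\<^esub> up_ring.monom (UP S) e 0 (L * D)"
    unfolding p using tc e by (intro UP_add_apply) (auto intro!: P.finsum_closed)
  also have "up_ring.monom (UP S) e 0 (L * D) = \<zero>\<^bsub>S\<^esub>"
    using e L0 by (simp add: UP_monom_apply)
  also have "(\<Oplus>\<^bsub>UP S\<^esub>s\<in>{..M}. up_ring.monom (UP S) (c s) 0 \<otimes>\<^bsub>UP S\<^esub> G [^]\<^bsub>UP S\<^esub> s) (L * D) =
      (\<Oplus>\<^bsub>S\<^esub>s\<in>{..M}. c s \<otimes>\<^bsub>S\<^esub> (G [^]\<^bsub>UP S\<^esub> s) (L * D))"
    using tc by (simp add: UP_finsum_apply[OF cr] term_n)
  also have "\<dots> = (\<Oplus>\<^bsub>S\<^esub>s\<in>{..M}. if L = s then c s \<otimes>\<^bsub>S\<^esub> (G [^]\<^bsub>UP S\<^esub> s) (L * D) else \<zero>\<^bsub>S\<^esub>)"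
  proof (rule R.finsum_cong')
    fix s assume "s \<in> {..M}"
    show "c s \<otimes>\<^bsub>S\<^esub> (G [^]\<^bsub>UP S\<^esub> s) (L * D) = (if L = s then c s \<otimes>\<^bsub>S\<^esub> (G [^]\<^bsub>UP S\<^esub> s) (L * D) else \<zero>\<^bsub>S\<^esub>)"
    proof (cases s L rule: linorder_cases)
      case less
      then have "deg S (G [^]\<^bsub>UP S\<^esub> s) < L * D" using pow D by simp
      then have "(G [^]\<^bsub>UP S\<^esub> s) (L * D) = \<zero>\<^bsub>S\<^esub>"
        using deg_aboveD[of "G [^]\<^bsub>UP S\<^esub> s" "L * D"] pow by simp
      then show ?thesis using c less by simp
    next
      case greater
      then show ?thesis using above[of s] \<open>s \<in> {..M}\<close> G_s by simp
    qed simp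
  qed (use c G_s in auto)
  also have "\<dots> = c L \<otimes>\<^bsub>S\<^esub> (G [^]\<^bsub>UP S\<^esub> L) (L * D)"
    using R.finsum_singleton[of L "{..M}" "\<lambda>s. c s \<otimes>\<^bsub>S\<^esub> (G [^]\<^bsub>UP S\<^esub> s) (L * D)"] L c G_s by simp
  finally have "p (L * D) = c L \<otimes>\<^bsub>S\<^esub> (G [^]\<^bsub>UP S\<^esub> L) (L * D)" using c G_s by simp
  moreover have "(G [^]\<^bsub>UP S\<^esub> L) (L * D) \<noteq> \<zero>\<^bsub>S\<^esub>"
    using lcoeff_nonzero[of "G [^]\<^bsub>UP S\<^esub> L"] pow[of L] by simp
  ultimately have "p (L * D) \<noteq> \<zero>\<^bsub>S\<^esub>" using c L G_s by (auto simp: domain.integral_iff[OF S])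
  then have "L * D \<le> N" using N by (meson not_le)
  moreover have "K * D \<le> L * D" using KL by simp
  ultimately show ?thesis unfolding D_def by linarith
qed simp

section \<open>Counting zeros and polynomials\<close>

lemma id_hom: "cring R \<Longrightarrow> ring_hom_cring R R id"
  by (intro ring_hom_cringI ring_hom_memI) auto

lemma UP_roots_bound:
  assumes R: "field R" "finite (carrier R)" and p: "p \<in> carrier (UP R)" "p i0 \<noteq> \<zero>\<^bsub>R\<^esub>"
    and n: "\<And>i. i > n \<Longrightarrow> p i = \<zero>\<^bsub>R\<^esub>"
  shows "card {x \<in> carrier R. UnivPoly.eval R R id x p = \<zero>\<^bsub>R\<^esub>} \<le> n"
proof -
  interpret UP_domain R "UP R" using R by (intro UP_domain.intro) (auto dest: field.axioms(1))
  have "p \<noteq> \<zero>\<^bsub>UP R\<^esub>" using p by auto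
  then have "card {x \<in> carrier R. UnivPoly.eval R R id x p = \<zero>\<^bsub>R\<^esub>} \<le> deg R p"
    using roots_bound[of p] p R by simp
  also have "deg R p \<le> n" using p n by (intro deg_aboveI) auto
  finally show ?thesis .
qed

lemma bivariate_zeros_bound:
  assumes R: "field R" "finite (carrier R)" and D: "D \<in> bideg_le R e" "D \<noteq> \<zero>\<^bsub>UP2 R\<^esub>"
    and YZ: "Y \<subseteq> carrier R" "Z \<subseteq> carrier R"
  shows "card {(y, z). y \<in> Y \<and> z \<in> Z \<and> eval2 R R id y z D = \<zero>\<^bsub>R\<^esub>} \<le> e * (card Y + card Z)"
proof -
  interpret R: field R by fact
  have cr: "cring R" by (rule R.is_cring)
  have Dc: "D \<in> carrier (UP2 R)" using D(1) by (rule bideg_le_closed)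
  have fin: "finite Y" "finite Z" using YZ R(2) by (auto intro: finite_subset)
  have "\<exists>k j. D k j \<noteq> \<zero>\<^bsub>R\<^esub>"
  proof (rule ccontr)
    assume "\<not> (\<exists>k j. D k j \<noteq> \<zero>\<^bsub>R\<^esub>)"
    then have "D = \<zero>\<^bsub>UP2 R\<^esub>" by (intro ext) simp
    then show False using D by simp
  qed
  then obtain k0 j0 where kj: "D k0 j0 \<noteq> \<zero>\<^bsub>R\<^esub>" by blast
  have row: "D k0 \<in> carrier (UP R)" using Dc by (rule UP_carrierD)
  define A where "A = {y \<in> carrier R. UnivPoly.eval R R id y (D k0) = \<zero>\<^bsub>R\<^esub>}"
  have A: "card A \<le> e" "finite A"
    unfolding A_def using R row kj D(1) by (auto intro!: UP_roots_bound simp: bideg_le_def)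
  define B where "B y = {z \<in> carrier R. eval2 R R id y z D = \<zero>\<^bsub>R\<^esub>}" for y
  have B: "card (B y) \<le> e" "finite (B y)" if y: "y \<in> carrier R" "y \<notin> A" for y
  proof -
    let ?h = "UnivPoly.eval R R id y"
    have h: "ring_hom_cring (UP R) R ?h" by (intro eval_hom id_hom cr y)
    interpret h: ring_hom_cring "UP R" R ?h by (rule h)
    have q: "?h \<circ> D \<in> carrier (UP R)"
      using ring_hom_closed[OF UP_map_hom[OF h]] Dc by blast
    have z: "\<And>i. i > e \<Longrightarrow> (?h \<circ> D) i = \<zero>\<^bsub>R\<^esub>"
    proof -
      fix i assume "i > e"
      then have "D i = \<zero>\<^bsub>UP R\<^esub>" using D(1) by (intro ext) (simp add: bideg_le_def)
      then show "(?h \<circ> D) i = \<zero>\<^bsub>R\<^esub>" by simp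
    qed
    have "eval2 R R id y z D = UnivPoly.eval R R id z (?h \<circ> D)" if "z \<in> carrier R" for z
    proof -
      have "eval2 R R id y z D = (\<Oplus>\<^bsub>R\<^esub>i\<in>{..e}. ?h (D i) \<otimes>\<^bsub>R\<^esub> z [^]\<^bsub>R\<^esub> i)"
        unfolding eval2_def using D(1) by (intro eval_expand[OF h that Dc]) (auto simp: bideg_le_def)
      also have "\<dots> = UnivPoly.eval R R id z (?h \<circ> D)"
        by (simp only: eval_expand[OF id_hom[OF cr] that q z] comp_apply id_apply)
      finally show ?thesis .
    qed
    then have B_eq: "B y = {z \<in> carrier R. UnivPoly.eval R R id z (?h \<circ> D) = \<zero>\<^bsub>R\<^esub>}"
      by (auto simp: B_def)
    have "(?h \<circ> D) k0 \<noteq> \<zero>\<^bsub>R\<^esub>" using y by (simp add: A_def)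
    then show "card (B y) \<le> e" unfolding B_eq by (rule UP_roots_bound[OF R q _ z])
    show "finite (B y)" using R(2) by (simp add: B_def)
  qed
  have "{(y, z). y \<in> Y \<and> z \<in> Z \<and> eval2 R R id y z D = \<zero>\<^bsub>R\<^esub>} \<subseteq> A \<times> Z \<union> Sigma (Y - A) B"
    using YZ by (auto simp: B_def)
  then have "card {(y, z). y \<in> Y \<and> z \<in> Z \<and> eval2 R R id y z D = \<zero>\<^bsub>R\<^esub>} \<le> card (A \<times> Z \<union> Sigma (Y - A) B)"
    using A fin B YZ by (intro card_mono) (auto intro!: finite_SigmaI)
  also have "\<dots> \<le> card (A \<times> Z) + card (Sigma (Y - A) B)" by (rule card_Un_le)
  also have "card (Sigma (Y - A) B) = (\<Sum>y\<in>Y - A. card (B y))"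
    using fin B YZ by (intro card_SigmaI) auto
  also have "\<dots> \<le> (\<Sum>y\<in>Y - A. e)" using B YZ by (intro sum_mono) auto
  also have "\<dots> \<le> e * card Y" using fin by (simp add: card_mono mult.commute)
  also have "card (A \<times> Z) \<le> e * card Z" using A by (simp add: card_cartesian_product)
  finally show ?thesis unfolding add_mult_distrib2 by linarith
qed

lemma card_bideg_le:
  assumes "finite (carrier R)" "\<zero>\<^bsub>R\<^esub> \<in> carrier R"
  shows "finite (bideg_le R e)" "card (bideg_le R e) = card (carrier R) ^ ((e + 1)\<^sup>2)"
proof -
  let ?I = "{..e} \<times> {..e}"
  let ?f = "\<lambda>p. \<lambda>z\<in>?I. p (fst z) (snd z)"
  let ?g = "\<lambda>c k j. if k \<le> e \<and> j \<le> e then c (k, j) else \<zero>\<^bsub>R\<^esub>"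
  have bij: "bij_betw ?f (bideg_le R e) (?I \<rightarrow>\<^sub>E carrier R)"
  proof (rule bij_betwI[of _ _ _ ?g])
    show "?f \<in> bideg_le R e \<rightarrow> (?I \<rightarrow>\<^sub>E carrier R)" by (auto simp: bideg_le_def)
    show "?g \<in> (?I \<rightarrow>\<^sub>E carrier R) \<rightarrow> bideg_le R e" using assms(2) by (auto simp: bideg_le_def)
    show "?g (?f p) = p" if "p \<in> bideg_le R e" for p
      using that by (intro ext) (auto simp: bideg_le_def not_le)
    show "?f (?g c) = c" if "c \<in> ?I \<rightarrow>\<^sub>E carrier R" for c
      using that by (intro ext) (auto simp: PiE_def extensional_def)
  qed
  have "finite (?I \<rightarrow>\<^sub>E carrier R)" using assms by (intro finite_PiE) auto
  then show "finite (bideg_le R e)" using bij bij_betw_finite by blast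
  show "card (bideg_le R e) = card (carrier R) ^ ((e + 1)\<^sup>2)"
    using bij_betw_same_card[OF bij] by (simp add: card_PiE card_cartesian_product power2_eq_square)
qed

lemma bideg_le_diff:
  assumes R: "cring R" and pq: "p \<in> bideg_le R e" "q \<in> bideg_le R e"
  shows "p \<ominus>\<^bsub>UP2 R\<^esub> q \<in> bideg_le R e"
proof -
  interpret R: cring R by fact
  interpret U: cring "UP2 R" by (intro cring_UP R)
  have c: "p \<in> carrier (UP2 R)" "q \<in> carrier (UP2 R)" using pq bideg_le_closed by blast+
  then have d: "p \<ominus>\<^bsub>UP2 R\<^esub> q \<in> carrier (UP2 R)" by simp
  have "(p \<ominus>\<^bsub>UP2 R\<^esub> q) k j = \<zero>\<^bsub>R\<^esub>" if kj: "k > e \<or> j > e" for k j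
  proof -
    have "p = (p \<ominus>\<^bsub>UP2 R\<^esub> q) \<oplus>\<^bsub>UP2 R\<^esub> q" using c by (simp add: a_minus_def U.a_assoc U.l_neg)
    then have "p k j = (p \<ominus>\<^bsub>UP2 R\<^esub> q) k j \<oplus>\<^bsub>R\<^esub> q k j"
      using UP2_apply(1)[OF R d c(2), of k j] by metis
    moreover have "p k j = \<zero>\<^bsub>R\<^esub>" "q k j = \<zero>\<^bsub>R\<^esub>" using pq kj by (auto simp: bideg_le_def)
    ultimately show ?thesis using UP2_carrierD[OF d, of k j] by simp
  qed
  then show ?thesis using UP2_carrierD[OF d] by (auto simp: bideg_le_def)
qed

text \<open>In each variable a monomial of \<open>A\<close> contributes at most \<open>n * d\<close>
  through its power of \<open>G\<close> and as much through its power of \<open>H\<close>.\<close>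

lemma eval2_bideg_le:
  assumes R: "cring R" and GH: "G \<in> bideg_le R d" "H \<in> bideg_le R d" and A: "A \<in> bideg_le R n"
  shows "eval2 R (UP2 R) (const2 R) G H A \<in> bideg_le R (2 * n * d)"
proof -
  have Gc: "G \<in> carrier (UP2 R)" "H \<in> carrier (UP2 R)" using GH bideg_le_closed by blast+
  show ?thesis
    unfolding eval2_expand[OF const2_hom[OF R] Gc A]
  proof (rule bideg_le_finsum[OF R])
    fix k assume k: "k \<in> {..n}"
    have "(\<Oplus>\<^bsub>UP2 R\<^esub>j\<in>{..n}. const2 R (A k j) \<otimes>\<^bsub>UP2 R\<^esub> G [^]\<^bsub>UP2 R\<^esub> j) \<in> bideg_le R (n * d)"
    proof (rule bideg_le_finsum[OF R])
      fix j assume "j \<in> {..n}"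
      then have "0 + j * d \<le> n * d" by simp
      moreover have "const2 R (A k j) \<otimes>\<^bsub>UP2 R\<^esub> G [^]\<^bsub>UP2 R\<^esub> j \<in> bideg_le R (0 + j * d)"
        using A by (intro bideg_le_mult bideg_le_pow bideg_le_const2 R GH) (simp add: bideg_le_def)
      ultimately show "const2 R (A k j) \<otimes>\<^bsub>UP2 R\<^esub> G [^]\<^bsub>UP2 R\<^esub> j \<in> bideg_le R (n * d)"
        using bideg_le_mono by blast
    qed
    then have "(\<Oplus>\<^bsub>UP2 R\<^esub>j\<in>{..n}. const2 R (A k j) \<otimes>\<^bsub>UP2 R\<^esub> G [^]\<^bsub>UP2 R\<^esub> j) \<otimes>\<^bsub>UP2 R\<^esub> H [^]\<^bsub>UP2 R\<^esub> k
      \<in> bideg_le R (n * d + k * d)"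
      by (intro bideg_le_mult bideg_le_pow R GH)
    moreover have "n * d + k * d \<le> 2 * n * d" using k by (simp flip: add_mult_distrib)
    ultimately show "(\<Oplus>\<^bsub>UP2 R\<^esub>j\<in>{..n}. const2 R (A k j) \<otimes>\<^bsub>UP2 R\<^esub> G [^]\<^bsub>UP2 R\<^esub> j) \<otimes>\<^bsub>UP2 R\<^esub> H [^]\<^bsub>UP2 R\<^esub> k
      \<in> bideg_le R (2 * n * d)"
      by (rule bideg_le_mono)
  qed
qed

section \<open>The coefficients of the composite polynomial\<close>

lemma ring_hom_cring_closed: "ring_hom_cring A B h \<Longrightarrow> x \<in> carrier A \<Longrightarrow> h x \<in> carrier B"
  by (erule ring_hom_closed[OF ring_hom_cring.homh])

lemma UP_map_hom_cring:
  assumes "ring_hom_cring A B h"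
  shows "ring_hom_cring (UP A) (UP B) (\<lambda>p. h \<circ> p)"
proof -
  interpret ring_hom_cring A B h by fact
  show ?thesis by (intro ring_hom_cringI cring_UP UP_map_hom assms R.is_cring S.is_cring)
qed

lemma const3_hom: "cring R \<Longrightarrow> ring_hom_cring R (UP3 R) (const3 R)"
  using ring_hom_cring_comp[OF const2_hom const_hom[OF cring_UP[OF cring_UP]], of R]
  by (simp add: comp_def const3_def[abs_def])

lemma XYZ3_closed:
  assumes R: "cring R"
  shows "X3 R \<in> carrier (UP3 R)" "Y3 R \<in> carrier (UP3 R)" "Z3 R \<in> carrier (UP3 R)"
  unfolding X3_def Y3_def Z3_def
  by (intro UP_monom_closed cring_UP R X2_closed Y2_closed cring.cring_simprules(6))+

text \<open>As \<open>x\<close> is the innermost variable, a polynomial in \<open>x\<close> becomes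
  a constant twice over, whereas \<open>embed_yz\<close> turns every single coefficient into a
  constant.\<close>

definition embed_x :: "('a, 'm) ring_scheme \<Rightarrow> (nat \<Rightarrow> 'a) \<Rightarrow> nat \<Rightarrow> nat \<Rightarrow> nat \<Rightarrow> 'a" where
  "embed_x R q = up_ring.monom (UP3 R) (up_ring.monom (UP2 R) q 0) 0"

definition embed_yz :: "('a, 'm) ring_scheme \<Rightarrow> (nat \<Rightarrow> nat \<Rightarrow> 'a) \<Rightarrow> nat \<Rightarrow> nat \<Rightarrow> nat \<Rightarrow> 'a" where
  "embed_yz R p = (\<lambda>k j. up_ring.monom (UP R) (p k j) 0)"

lemma embed_x_hom: "cring R \<Longrightarrow> ring_hom_cring (UP R) (UP3 R) (embed_x R)"
  using ring_hom_cring_comp[OF const_hom[OF cring_UP] const_hom[OF cring_UP[OF cring_UP]], of R]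
  by (simp add: comp_def embed_x_def[abs_def])

lemma embed_yz_hom: "cring R \<Longrightarrow> ring_hom_cring (UP2 R) (UP3 R) (embed_yz R)"
  using UP_map_hom_cring[OF UP_map_hom_cring[OF const_hom, of R]]
  by (simp add: comp_def embed_yz_def[abs_def])

lemma eval_const3_X3:
  assumes R: "cring R" and q: "q \<in> carrier (UP R)"
  shows "UnivPoly.eval R (UP3 R) (const3 R) (X3 R) q = embed_x R q"
proof -
  let ?c = "\<lambda>r. up_ring.monom (UP R) r 0" and ?t = "up_ring.monom (UP R) \<one>\<^bsub>R\<^esub> 1"
  have t: "?t \<in> carrier (UP R)" using R by (intro UP_monom_closed cring.cring_simprules(6))
  have "embed_x R (UnivPoly.eval R (UP R) ?c ?t q) = UnivPoly.eval R (UP3 R) (const3 R) (embed_x R ?t) q"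
    by (rule eval_natural[OF const_hom[OF R] embed_x_hom[OF R] t q]) (simp add: const3_def const2_def embed_x_def)
  then show ?thesis by (simp only: eval_id[OF R q] embed_x_def X3_def X2_def)
qed

lemma eval2_const3_YZ:
  assumes R: "cring R" and p: "p \<in> carrier (UP2 R)"
  shows "eval2 R (UP3 R) (const3 R) (Y3 R) (Z3 R) p = embed_yz R p"
proof -
  let ?c = "\<lambda>r. up_ring.monom (UP R) r 0"
  have hom1: "ring_hom_cring R (UP R) ?c" using R by (rule const_hom)
  have hom2: "ring_hom_cring (UP R) (UP2 R) (\<lambda>q. ?c \<circ> q)" using hom1 by (rule UP_map_hom_cring)
  interpret h2: ring_hom_cring "UP R" "UP2 R" "\<lambda>q. ?c \<circ> q" by (rule hom2)
  interpret h1: ring_hom_cring R "UP R" ?c by (rule hom1)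
  have e: "embed_yz R p = (\<lambda>q. ?c \<circ> q) \<circ> p" for p by (simp add: embed_yz_def comp_def)
  have const: "embed_yz R (const2 R r) = const3 R r" if r: "r \<in> carrier R" for r
  proof -
    have "?c \<circ> up_ring.monom (UP R) r 0 = up_ring.monom (UP2 R) (?c r) 0" using hom1 r by (rule UP_map_monom)
    then show ?thesis
      unfolding e const2_def const3_def using r by (subst UP_map_monom[OF hom2]) (simp_all add: UP_monom_closed[OF R])
  qed
  have X: "embed_yz R (X2 R) = Y3 R"
  proof -
    have "?c \<circ> up_ring.monom (UP R) \<one>\<^bsub>R\<^esub> 1 = up_ring.monom (UP2 R) (?c \<one>\<^bsub>R\<^esub>) 1"
      using hom1 by (rule UP_map_monom) simp
    also have "?c \<one>\<^bsub>R\<^esub> = \<one>\<^bsub>UP R\<^esub>" by (rule h1.hom_one)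
    finally have Y2_eq: "?c \<circ> up_ring.monom (UP R) \<one>\<^bsub>R\<^esub> 1 = Y2 R" unfolding Y2_def .
    show ?thesis
      unfolding e X2_def Y3_def
      by (subst UP_map_monom[OF hom2]) (simp_all only: UP_monom_closed[OF R] h1.R.one_closed Y2_eq)
  qed
  have Y: "embed_yz R (Y2 R) = Z3 R"
    unfolding e Y2_def Z3_def by (subst UP_map_monom[OF hom2]) (simp_all only: h2.hom_one h2.R.one_closed)
  have "embed_yz R (eval2 R (UP2 R) (const2 R) (X2 R) (Y2 R) p) =
    eval2 R (UP3 R) (const3 R) (embed_yz R (X2 R)) (embed_yz R (Y2 R)) p"
    using const by (intro eval2_natural[OF const2_hom[OF R] embed_yz_hom[OF R] X2_closed[OF R] Y2_closed[OF R] p]) simp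
  then show ?thesis by (simp only: X Y eval2_id[OF R p])
qed

lemma UP3_apply:
  assumes R: "cring R"
  shows "p \<in> carrier (UP3 R) \<Longrightarrow> q \<in> carrier (UP3 R) \<Longrightarrow> (p \<oplus>\<^bsub>UP3 R\<^esub> q) k j i = p k j i \<oplus>\<^bsub>R\<^esub> q k j i"
    and "finite A \<Longrightarrow> (\<And>s. s \<in> A \<Longrightarrow> g s \<in> carrier (UP3 R)) \<Longrightarrow>
      finsum (UP3 R) g A k j i = (\<Oplus>\<^bsub>R\<^esub>s\<in>A. g s k j i)"
    and "p \<in> carrier (UP3 R) \<Longrightarrow> p k j i \<in> carrier R"
proof -
  have UP3D: "p k \<in> carrier (UP2 R)" "p k j \<in> carrier (UP R)" "p k j i \<in> carrier R"
    if "p \<in> carrier (UP3 R)" for p k j i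
    using UP_carrierD[OF that] UP_carrierD[OF UP_carrierD[OF that]] UP_carrierD[OF UP_carrierD[OF UP_carrierD[OF that]]]
    by auto
  show "p \<in> carrier (UP3 R) \<Longrightarrow> p k j i \<in> carrier R" by (rule UP3D(3))
  show "p \<in> carrier (UP3 R) \<Longrightarrow> q \<in> carrier (UP3 R) \<Longrightarrow> (p \<oplus>\<^bsub>UP3 R\<^esub> q) k j i = p k j i \<oplus>\<^bsub>R\<^esub> q k j i"
    by (simp add: UP_add_apply UP3D[of p] UP3D[of q])
  show "finsum (UP3 R) g A k j i = (\<Oplus>\<^bsub>R\<^esub>s\<in>A. g s k j i)"
    if "finite A" "\<And>s. s \<in> A \<Longrightarrow> g s \<in> carrier (UP3 R)"
  proof -
    have "finsum (UP3 R) g A k = finsum (UP2 R) (\<lambda>s. g s k) A"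
      using that by (intro UP_finsum_apply cring_UP R)
    moreover have "finsum (UP2 R) (\<lambda>s. g s k) A j = finsum (UP R) (\<lambda>s. g s k j) A"
      using that(1) UP3D(1)[OF that(2)] by (intro UP_finsum_apply[OF cring_UP[OF R]])
    moreover have "finsum (UP R) (\<lambda>s. g s k j) A i = (\<Oplus>\<^bsub>R\<^esub>s\<in>A. g s k j i)"
      using that(1) UP3D(2)[OF that(2)] by (intro UP_finsum_apply[OF R])
    ultimately show ?thesis by simp
  qed
qed

lemma embed_x_apply:
  assumes R: "cring R" and q: "q \<in> carrier (UP R)"
  shows "embed_x R q k j i = (if k = 0 \<and> j = 0 then q i else \<zero>\<^bsub>R\<^esub>)"
  using q by (simp add: embed_x_def UP_monom_apply UP_monom_closed[OF cring_UP[OF R]])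

lemma embed_yz_apply:
  assumes "p \<in> carrier (UP2 R)"
  shows "embed_yz R p k j i = (if i = 0 then p k j else \<zero>\<^bsub>R\<^esub>)"
  using assms by (simp add: embed_yz_def UP_monom_apply UP2_carrierD)

text \<open>The factors have no variable in common, so the convolution collapses to one
  product.\<close>

lemma embed_mult_apply:
  assumes R: "cring R" and q: "q \<in> carrier (UP R)" and p: "p \<in> carrier (UP2 R)"
  shows "(embed_x R q \<otimes>\<^bsub>UP3 R\<^esub> embed_yz R p) k j i = q i \<otimes>\<^bsub>R\<^esub> p k j"
proof -
  interpret R: cring R by (rule R)
  interpret U: cring "UP R" by (rule cring_UP[OF R])
  have Y: "embed_yz R p \<in> carrier (UP3 R)"
    using ring_hom_cring_closed[OF embed_yz_hom[OF R] p] .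
  have c: "p k j \<in> carrier R" using p by (rule UP2_carrierD)
  have row: "embed_yz R p k \<in> carrier (UP2 R)" using Y by (rule UP_carrierD)
  have "(embed_x R q \<otimes>\<^bsub>UP3 R\<^esub> embed_yz R p) k j =
      (up_ring.monom (UP2 R) q 0 \<otimes>\<^bsub>UP2 R\<^esub> embed_yz R p k) j"
    unfolding embed_x_def
    by (subst UP_mult_const_apply[OF cring_UP[OF cring_UP[OF R]] Y]) (intro UP_monom_closed cring_UP R q refl)+
  also have "\<dots> = q \<otimes>\<^bsub>UP R\<^esub> embed_yz R p k j"
    by (rule UP_mult_const_apply[OF cring_UP[OF R] row q])
  also have "\<dots> = up_ring.monom (UP R) (p k j) 0 \<otimes>\<^bsub>UP R\<^esub> q"
    unfolding embed_yz_def using q c by (intro U.m_comm UP_monom_closed R)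
  finally have "(embed_x R q \<otimes>\<^bsub>UP3 R\<^esub> embed_yz R p) k j i = (up_ring.monom (UP R) (p k j) 0 \<otimes>\<^bsub>UP R\<^esub> q) i"
    by (rule arg_cong)
  also have "\<dots> = p k j \<otimes>\<^bsub>R\<^esub> q i" using R q c by (rule UP_mult_const_apply)
  also have "\<dots> = q i \<otimes>\<^bsub>R\<^esub> p k j" using c UP_carrierD[OF q] by (rule R.m_comm)
  finally show ?thesis .
qed

lemma composite_poly_apply:
  assumes R: "cring R" and F: "F \<in> bideg_le R M" and GH: "G \<in> carrier (UP2 R)" "H \<in> carrier (UP2 R)"
    and J: "J \<in> carrier (UP R)"
  shows "composite_poly R F G H J k j i =
    (\<Oplus>\<^bsub>R\<^esub>s\<in>{..M}. F s i \<otimes>\<^bsub>R\<^esub> (G [^]\<^bsub>UP2 R\<^esub> s) k j) \<oplus>\<^bsub>R\<^esub> (if i = 0 then H k j else \<zero>\<^bsub>R\<^esub>)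
      \<oplus>\<^bsub>R\<^esub> (if k = 0 \<and> j = 0 then J i else \<zero>\<^bsub>R\<^esub>)"
proof -
  interpret R: cring R by (rule R)
  interpret U2: cring "UP2 R" by (intro cring_UP R)
  interpret U3: cring "UP3 R" by (intro cring_UP R)
  interpret x: ring_hom_cring "UP R" "UP3 R" "embed_x R" by (rule embed_x_hom[OF R])
  interpret yz: ring_hom_cring "UP2 R" "UP3 R" "embed_yz R" by (rule embed_yz_hom[OF R])
  have Fc: "F \<in> carrier (UP2 R)" using F by (rule bideg_le_closed)
  have row: "F s \<in> carrier (UP R)" for s using Fc by (rule UP_carrierD)
  have tm: "embed_x R (F s) \<otimes>\<^bsub>UP3 R\<^esub> embed_yz R (G [^]\<^bsub>UP2 R\<^esub> s) \<in> carrier (UP3 R)" for s :: nat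
    using row GH by simp
  have "eval2 R (UP3 R) (const3 R) (X3 R) (embed_yz R G) F =
    (\<Oplus>\<^bsub>UP3 R\<^esub>s\<in>{..M}. UnivPoly.eval R (UP3 R) (const3 R) (X3 R) (F s) \<otimes>\<^bsub>UP3 R\<^esub> embed_yz R G [^]\<^bsub>UP3 R\<^esub> s)"
    unfolding eval2_def
  proof (rule eval_expand[OF eval_hom[OF const3_hom[OF R] XYZ3_closed(1)[OF R]] _ Fc])
    show "embed_yz R G \<in> carrier (UP3 R)" using GH by simp
    show "\<And>s. M < s \<Longrightarrow> F s = \<zero>\<^bsub>UP R\<^esub>" using F by (intro ext) (simp add: bideg_le_def)
  qed
  also have "\<dots> = (\<Oplus>\<^bsub>UP3 R\<^esub>s\<in>{..M}. embed_x R (F s) \<otimes>\<^bsub>UP3 R\<^esub> embed_yz R (G [^]\<^bsub>UP2 R\<^esub> s))"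
    using row GH tm by (intro U3.finsum_cong') (auto simp: eval_const3_X3[OF R])
  finally have F_eq: "eval2 R (UP3 R) (const3 R) (X3 R) (embed_yz R G) F =
    (\<Oplus>\<^bsub>UP3 R\<^esub>s\<in>{..M}. embed_x R (F s) \<otimes>\<^bsub>UP3 R\<^esub> embed_yz R (G [^]\<^bsub>UP2 R\<^esub> s))" .
  let ?S = "\<Oplus>\<^bsub>UP3 R\<^esub>s\<in>{..M}. embed_x R (F s) \<otimes>\<^bsub>UP3 R\<^esub> embed_yz R (G [^]\<^bsub>UP2 R\<^esub> s)"
  have Sc: "?S \<in> carrier (UP3 R)" using tm by (intro U3.finsum_closed) auto
  have "composite_poly R F G H J = ?S \<oplus>\<^bsub>UP3 R\<^esub> embed_yz R H \<oplus>\<^bsub>UP3 R\<^esub> embed_x R J"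
    unfolding composite_poly_def
    by (simp only: eval2_const3_YZ[OF R GH(1)] eval2_const3_YZ[OF R GH(2)] eval_const3_X3[OF R J] F_eq)
  then have "composite_poly R F G H J k j i = ?S k j i \<oplus>\<^bsub>R\<^esub> embed_yz R H k j i \<oplus>\<^bsub>R\<^esub> embed_x R J k j i"
    using Sc GH J by (simp only: UP3_apply(1)[OF R] U3.a_closed x.hom_closed yz.hom_closed)
  also have "?S k j i = (\<Oplus>\<^bsub>R\<^esub>s\<in>{..M}. F s i \<otimes>\<^bsub>R\<^esub> (G [^]\<^bsub>UP2 R\<^esub> s) k j)"
  proof -
    have "?S k j i = (\<Oplus>\<^bsub>R\<^esub>s\<in>{..M}. (embed_x R (F s) \<otimes>\<^bsub>UP3 R\<^esub> embed_yz R (G [^]\<^bsub>UP2 R\<^esub> s)) k j i)"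
      using tm by (intro UP3_apply(2)[OF R]) auto
    also have "\<dots> = (\<Oplus>\<^bsub>R\<^esub>s\<in>{..M}. F s i \<otimes>\<^bsub>R\<^esub> (G [^]\<^bsub>UP2 R\<^esub> s) k j)"
      using GH row by (intro R.finsum_cong' embed_mult_apply[OF R]) (auto simp: UP_carrierD UP2_carrierD)
    finally show ?thesis .
  qed
  finally show ?thesis by (simp only: embed_yz_apply[OF GH(2)] embed_x_apply[OF R J])
qed

lemma eval3_hom:
  assumes h: "ring_hom_cring R S h" and abc: "a \<in> carrier S" "b \<in> carrier S" "c \<in> carrier S"
  shows "ring_hom_cring (UP3 R) S (eval3 R S h a b c)"
proof -
  have "eval3 R S h a b c = UnivPoly.eval (UP2 R) S (eval2 R S h a b) c" by (rule ext) (simp add: eval3_def)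
  then show ?thesis using eval_hom[OF eval2_hom[OF h abc(1,2)] abc(3)] by simp
qed

lemma eval3_vars:
  assumes h: "ring_hom_cring R S h" and abc: "a \<in> carrier S" "b \<in> carrier S" "c \<in> carrier S"
  shows "r \<in> carrier R \<Longrightarrow> eval3 R S h a b c (const3 R r) = h r"
    and "eval3 R S h a b c (X3 R) = a" "eval3 R S h a b c (Y3 R) = b" "eval3 R S h a b c (Z3 R) = c"
proof -
  interpret h: ring_hom_cring R S h by (rule h)
  have R: "cring R" by (rule h.R.is_cring)
  interpret U2: cring "UP2 R" by (intro cring_UP R)
  note e2 = eval2_hom[OF h abc(1,2)]
  interpret e2: ring_hom_cring "UP2 R" S "eval2 R S h a b" by (rule e2)
  show "r \<in> carrier R \<Longrightarrow> eval3 R S h a b c (const3 R r) = h r"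
    by (simp add: eval3_def const3_def eval_const_gen[OF e2 abc(3)] const2_closed[OF R] eval2_const[OF h abc(1,2)])
  show "eval3 R S h a b c (X3 R) = a"
    by (simp add: eval3_def X3_def eval_const_gen[OF e2 abc(3)] X2_closed[OF R] eval2_X2[OF h abc(1,2)])
  show "eval3 R S h a b c (Y3 R) = b"
    by (simp add: eval3_def Y3_def eval_const_gen[OF e2 abc(3)] Y2_closed[OF R] eval2_Y2[OF h abc(1,2)])
  show "eval3 R S h a b c (Z3 R) = c"
    using abc by (simp add: eval3_def Z3_def eval_monom_gen[OF e2 abc(3)])
qed

lemma eval3_composite_poly:
  assumes R: "cring R" and FGH: "F \<in> carrier (UP2 R)" "G \<in> carrier (UP2 R)" "H \<in> carrier (UP2 R)"
    and J: "J \<in> carrier (UP R)" and xyz: "x \<in> carrier R" "y \<in> carrier R" "z \<in> carrier R"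
  shows "eval3 R R id x y z (composite_poly R F G H J) =
    eval2 R R id x (eval2 R R id y z G) F \<oplus>\<^bsub>R\<^esub> eval2 R R id y z H \<oplus>\<^bsub>R\<^esub> UnivPoly.eval R R id x J"
proof -
  let ?v = "eval3 R R id x y z"
  note id = id_hom[OF R]
  have v: "ring_hom_cring (UP3 R) R ?v" using id xyz by (rule eval3_hom)
  interpret v: ring_hom_cring "UP3 R" R ?v by (rule v)
  note vars = eval3_vars[OF id xyz] and cl = XYZ3_closed[OF R] and c3 = const3_hom[OF R]
  let ?e = "eval2 R (UP3 R) (const3 R) (Y3 R) (Z3 R)"
  interpret e: ring_hom_cring "UP2 R" "UP3 R" ?e by (rule eval2_hom[OF c3 cl(2,3)])
  have yz: "?v (?e p) = eval2 R R id y z p" if p: "p \<in> carrier (UP2 R)" for p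
    using eval2_natural[OF c3 v cl(2,3) p, of id] by (simp add: vars)
  have eG: "?e G \<in> carrier (UP3 R)" using FGH(2) by (rule e.hom_closed)
  interpret f: ring_hom_cring "UP2 R" "UP3 R" "eval2 R (UP3 R) (const3 R) (X3 R) (?e G)"
    by (rule eval2_hom[OF c3 cl(1) eG])
  interpret j: ring_hom_cring "UP R" "UP3 R" "UnivPoly.eval R (UP3 R) (const3 R) (X3 R)"
    by (rule eval_hom[OF c3 cl(1)])
  have F: "?v (eval2 R (UP3 R) (const3 R) (X3 R) (?e G) F) = eval2 R R id x (eval2 R R id y z G) F"
    using eval2_natural[OF c3 v cl(1) eG FGH(1), of id] by (simp add: vars yz FGH)
  have J': "?v (UnivPoly.eval R (UP3 R) (const3 R) (X3 R) J) = UnivPoly.eval R R id x J"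
    using eval_natural[OF c3 v cl(1) J, of id] by (simp add: vars)
  show ?thesis
    unfolding composite_poly_def using FGH J f.hom_closed[OF FGH(1)] e.hom_closed[OF FGH(3)] j.hom_closed[OF J]
    by (simp add: F J' yz)
qed

text \<open>With n = (2 d + 1)^2 the sides count coefficients: those of a polynomial of bidegree n +
  2 n d on the left, those of n + 1 polynomials of bidegree n on the right. The value of n is chosen
  because the left side is at most (n + 1)^2 (2 d + 1)^2.\<close>

lemma fibre_bound_arith: "(((2 * d + 1)\<^sup>2 + 2 * (2 * d + 1)\<^sup>2 * d + 1)\<^sup>2 :: nat) < ((2 * d + 1)\<^sup>2 + 1)\<^sup>2 * ((2 * d + 1)\<^sup>2 + 1)"
proof -
  let ?n = "(2 * d + 1)\<^sup>2"
  have "?n + 2 * ?n * d + 1 \<le> (?n + 1) * (2 * d + 1)" by (simp add: algebra_simps)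
  then have "(?n + 2 * ?n * d + 1)\<^sup>2 \<le> ((?n + 1) * (2 * d + 1))\<^sup>2" by (rule power_mono) simp
  also have "\<dots> = (?n + 1)\<^sup>2 * ?n" by (simp only: power_mult_distrib)
  also have "\<dots> < (?n + 1)\<^sup>2 * (?n + 1)" by (intro mult_strict_left_mono) auto
  finally show ?thesis .
qed

text \<open>
  There are more families \<open>(B\<^sub>i)\<close> of polynomials than values of the sum of the \<open>T\<^sup>i B\<^sub>i(G, H)\<close>, so
  \<open>T\<close> satisfies an algebraic equation over \<open>R(G, H)\<close> whose degree is bounded in terms of \<open>d\<close>.
\<close>

lemma fibre_bound:
  fixes d :: nat
  defines "n \<equiv> (2 * d + 1)\<^sup>2"
  assumes R: "field R" "finite (carrier R)" and GH: "G \<in> bideg_le R d" "H \<in> bideg_le R d" and T: "T \<in> bideg_le R 1"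
    and indep: "\<And>A. A \<in> carrier (UP2 R) \<Longrightarrow> eval2 R (UP2 R) (const2 R) G H A = \<zero>\<^bsub>UP2 R\<^esub> \<Longrightarrow> A = \<zero>\<^bsub>UP2 R\<^esub>"
  obtains D where "D \<in> bideg_le R (2 * n * d)" "D \<noteq> \<zero>\<^bsub>UP2 R\<^esub>"
    "\<And>y z. y \<in> carrier R \<Longrightarrow> z \<in> carrier R \<Longrightarrow> eval2 R R id y z D \<noteq> \<zero>\<^bsub>R\<^esub> \<Longrightarrow>
      card {eval2 R R id y' z' T | y' z'. y' \<in> carrier R \<and> z' \<in> carrier R \<and>
        eval2 R R id y' z' G = eval2 R R id y z G \<and> eval2 R R id y' z' H = eval2 R R id y z H} \<le> n"
proof -
  interpret R: field R by fact
  have cr: "cring R" by (rule R.is_cring)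
  interpret U: cring "UP2 R" by (intro cring_UP cr)
  have c: "G \<in> carrier (UP2 R)" "H \<in> carrier (UP2 R)" "T \<in> carrier (UP2 R)" using GH T bideg_le_closed by blast+
  let ?e = "eval2 R (UP2 R) (const2 R) G H"
  interpret e: ring_hom_cring "UP2 R" "UP2 R" ?e by (intro eval2_hom const2_hom cr c)
  define \<Phi> where "\<Phi> B = (\<Oplus>\<^bsub>UP2 R\<^esub>i\<in>{..n}. T [^]\<^bsub>UP2 R\<^esub> i \<otimes>\<^bsub>UP2 R\<^esub> ?e (B i))" for B :: "nat \<Rightarrow> nat \<Rightarrow> nat \<Rightarrow> 'a"
  define E where "E = n + 2 * n * d"
  let ?V = "{..n} \<rightarrow>\<^sub>E bideg_le R n"
  have \<Phi>: "\<Phi> B \<in> bideg_le R E" if B: "B \<in> ?V" for B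
    unfolding \<Phi>_def E_def
  proof (rule bideg_le_finsum[OF cr])
    fix i assume i: "i \<in> {..n}"
    have "T [^]\<^bsub>UP2 R\<^esub> i \<in> bideg_le R n"
      using bideg_le_pow[OF cr T, of i] i by (auto intro: bideg_le_mono)
    moreover have "?e (B i) \<in> bideg_le R (2 * n * d)"
      using B i by (intro eval2_bideg_le cr GH) auto
    ultimately show "T [^]\<^bsub>UP2 R\<^esub> i \<otimes>\<^bsub>UP2 R\<^esub> ?e (B i) \<in> bideg_le R (n + 2 * n * d)"
      by (rule bideg_le_mult[OF cr])
  qed
  have cards: "finite (bideg_le R k)" "card (bideg_le R k) = card (carrier R) ^ ((k + 1)\<^sup>2)" for k
    by (rule card_bideg_le[OF R(2) R.zero_closed])+
  have "card {\<zero>\<^bsub>R\<^esub>, \<one>\<^bsub>R\<^esub>} \<le> card (carrier R)" using R(2) by (intro card_mono) auto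
  then have q: "1 < card (carrier R)" by simp
  have "card (bideg_le R E) < card ?V"
  proof -
    have "(E + 1)\<^sup>2 < (n + 1)\<^sup>2 * (n + 1)" unfolding E_def n_def by (rule fibre_bound_arith)
    then have "card (carrier R) ^ (E + 1)\<^sup>2 < card (carrier R) ^ ((n + 1)\<^sup>2 * (n + 1))"
      using q by (intro power_strict_increasing)
    moreover have "card ?V = (card (carrier R) ^ (n + 1)\<^sup>2) ^ (n + 1)" by (simp add: cards(2) card_PiE)
    ultimately show ?thesis by (simp only: cards(2) power_mult)
  qed
  moreover have "\<Phi> ` ?V \<subseteq> bideg_le R E" using \<Phi> by blast
  ultimately have "\<not> inj_on \<Phi> ?V" using cards(1) by (metis card_inj_on_le leD)
  then obtain B1 B2 where B: "B1 \<in> ?V" "B2 \<in> ?V" "\<Phi> B1 = \<Phi> B2" "B1 \<noteq> B2"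
    by (auto simp: inj_on_def)
  have Bd: "B1 i \<in> bideg_le R n" "B2 i \<in> bideg_le R n" if "i \<le> n" for i using B(1,2) that by auto
  have Bc: "B1 i \<in> carrier (UP2 R)" "B2 i \<in> carrier (UP2 R)" if "i \<le> n" for i
    using Bd[OF that] bideg_le_closed by blast+
  obtain i0 where i0: "i0 \<le> n" "B1 i0 \<noteq> B2 i0"
    using PiE_ext[OF B(1,2)] B(4) by auto
  \<comment> \<open>A coefficient of the equation for \<open>T\<close>, with \<open>G\<close> and
    \<open>H\<close> inserted. It is a nonzero polynomial by algebraic independence, and at points
    where it does not vanish the specialised equation for \<open>T\<close> is not trivial.\<close>
  define D where "D = ?e (B1 i0 \<ominus>\<^bsub>UP2 R\<^esub> B2 i0)"
  show thesis
  proof (rule that[of D])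
    show "D \<in> bideg_le R (2 * n * d)"
      unfolding D_def using Bd[OF i0(1)] by (intro eval2_bideg_le bideg_le_diff cr GH)
    show "D \<noteq> \<zero>\<^bsub>UP2 R\<^esub>"
    proof
      assume D0: "D = \<zero>\<^bsub>UP2 R\<^esub>"
      have "B1 i0 \<ominus>\<^bsub>UP2 R\<^esub> B2 i0 = \<zero>\<^bsub>UP2 R\<^esub>"
      proof (rule indep)
        show "B1 i0 \<ominus>\<^bsub>UP2 R\<^esub> B2 i0 \<in> carrier (UP2 R)" using Bc[OF i0(1)] by simp
      qed (use D0 in \<open>simp only: D_def\<close>)
      then show False using Bc[OF i0(1)] i0(2) U.r_right_minus_eq by blast
    qed
    fix y z assume yz: "y \<in> carrier R" "z \<in> carrier R" and nz: "eval2 R R id y z D \<noteq> \<zero>\<^bsub>R\<^esub>"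
    define a where "a = eval2 R R id y z G"
    define b where "b = eval2 R R id y z H"
    have ev: "ring_hom_cring (UP2 R) R (eval2 R R id y' z')" if "y' \<in> carrier R" "z' \<in> carrier R" for y' z'
      using that by (intro eval2_hom id_hom cr)
    interpret v: ring_hom_cring "UP2 R" R "eval2 R R id y z" using ev yz .
    have ab: "a \<in> carrier R" "b \<in> carrier R" using c by (simp_all add: a_def b_def)
    interpret w: ring_hom_cring "UP2 R" R "eval2 R R id a b" using ev ab .
    have sub: "eval2 R R id y' z' (?e A) = eval2 R R id a b A"
      if "y' \<in> carrier R" "z' \<in> carrier R" "eval2 R R id y' z' G = a" "eval2 R R id y' z' H = b" "A \<in> carrier (UP2 R)"
      for y' z' A
      using eval2_natural[OF const2_hom[OF cr] ev[OF that(1,2)] c(1,2) that(5), of id]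
        eval2_const[OF id_hom[OF cr] that(1,2)] that(3,4) by simp
    \<comment> \<open>The equation for \<open>T\<close> specialised at \<open>(a, b)\<close>. It
      depends on the fibre only, so all values of \<open>T\<close> on the fibre are roots of this
      one polynomial.\<close>
    define g where "g i = (if i \<le> n then eval2 R R id a b (B1 i \<ominus>\<^bsub>UP2 R\<^esub> B2 i) else \<zero>\<^bsub>R\<^esub>)" for i
    have gc: "g i \<in> carrier R" for i using Bc by (simp add: g_def)
    have g: "g \<in> carrier (UP R)" "\<And>i. i > n \<Longrightarrow> g i = \<zero>\<^bsub>R\<^esub>"
      using gc by (auto simp: UP_carrier_iff g_def intro!: exI[of _ n])
    have "g i0 = eval2 R R id y z D"
      unfolding D_def using i0(1) Bc[OF i0(1)] yz by (subst sub) (auto simp: g_def a_def b_def)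
    then have "g i0 \<noteq> \<zero>\<^bsub>R\<^esub>" using nz by simp
    have "{eval2 R R id y' z' T | y' z'. y' \<in> carrier R \<and> z' \<in> carrier R \<and>
        eval2 R R id y' z' G = a \<and> eval2 R R id y' z' H = b} \<subseteq> {t \<in> carrier R. UnivPoly.eval R R id t g = \<zero>\<^bsub>R\<^esub>}"
    proof clarify
      fix y' z' assume yz': "y' \<in> carrier R" "z' \<in> carrier R" "a = eval2 R R id y' z' G" "b = eval2 R R id y' z' H"
      interpret v': ring_hom_cring "UP2 R" R "eval2 R R id y' z'" using ev yz'(1,2) .
      let ?t = "eval2 R R id y' z' T"
      have t: "?t \<in> carrier R" using c by simp
      have val: "eval2 R R id y' z' (\<Phi> B) = (\<Oplus>\<^bsub>R\<^esub>i\<in>{..n}. ?t [^]\<^bsub>R\<^esub> i \<otimes>\<^bsub>R\<^esub> eval2 R R id a b (B i))"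
        if B: "\<And>i. i \<le> n \<Longrightarrow> B i \<in> carrier (UP2 R)" for B
      proof -
        have "eval2 R R id y' z' (\<Phi> B) = (\<Oplus>\<^bsub>R\<^esub>i\<in>{..n}. eval2 R R id y' z' (T [^]\<^bsub>UP2 R\<^esub> i \<otimes>\<^bsub>UP2 R\<^esub> ?e (B i)))"
          unfolding \<Phi>_def using c B by (subst v'.hom_finsum) (auto simp: comp_def)
        also have "\<dots> = (\<Oplus>\<^bsub>R\<^esub>i\<in>{..n}. ?t [^]\<^bsub>R\<^esub> i \<otimes>\<^bsub>R\<^esub> eval2 R R id a b (B i))"
          using c B t by (intro R.finsum_cong') (auto simp: sub[OF yz'(1,2) yz'(3)[symmetric] yz'(4)[symmetric]])
        finally show ?thesis .
      qed
      let ?s = "\<lambda>B. \<Oplus>\<^bsub>R\<^esub>i\<in>{..n}. ?t [^]\<^bsub>R\<^esub> i \<otimes>\<^bsub>R\<^esub> eval2 R R id a b (B i)"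
      have s: "?s B1 = ?s B2" using val[of B1] val[of B2] Bc B(3) by simp
      have sc: "?s B2 \<in> carrier R" using t Bc by (intro R.finsum_closed) auto
      have ev_g: "UnivPoly.eval R R id ?t g = (\<Oplus>\<^bsub>R\<^esub>i\<in>{..n}. g i \<otimes>\<^bsub>R\<^esub> ?t [^]\<^bsub>R\<^esub> i)"
        using eval_expand[OF id_hom[OF cr] t g] by simp
      have diff: "?s B1 = (\<Oplus>\<^bsub>R\<^esub>i\<in>{..n}. g i \<otimes>\<^bsub>R\<^esub> ?t [^]\<^bsub>R\<^esub> i) \<oplus>\<^bsub>R\<^esub> ?s B2"
      proof -
        have "?s B1 = (\<Oplus>\<^bsub>R\<^esub>i\<in>{..n}. g i \<otimes>\<^bsub>R\<^esub> ?t [^]\<^bsub>R\<^esub> i \<oplus>\<^bsub>R\<^esub> ?t [^]\<^bsub>R\<^esub> i \<otimes>\<^bsub>R\<^esub> eval2 R R id a b (B2 i))"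
        proof (rule R.finsum_cong')
          fix i assume i: "i \<in> {..n}"
          let ?u = "eval2 R R id a b (B1 i)" and ?v = "eval2 R R id a b (B2 i)"
          have uv: "?u \<in> carrier R" "?v \<in> carrier R" using Bc i by auto
          have "g i = ?u \<ominus>\<^bsub>R\<^esub> ?v" using Bc i by (simp add: g_def a_minus_def)
          then have "?u = g i \<oplus>\<^bsub>R\<^esub> ?v" using uv by (simp add: a_minus_def R.a_assoc R.l_neg)
          then show "?t [^]\<^bsub>R\<^esub> i \<otimes>\<^bsub>R\<^esub> ?u = g i \<otimes>\<^bsub>R\<^esub> ?t [^]\<^bsub>R\<^esub> i \<oplus>\<^bsub>R\<^esub> ?t [^]\<^bsub>R\<^esub> i \<otimes>\<^bsub>R\<^esub> ?v"
            using t gc uv by (simp add: R.r_distr R.m_comm)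
        qed (use t gc Bc in auto)
        also have "\<dots> = (\<Oplus>\<^bsub>R\<^esub>i\<in>{..n}. g i \<otimes>\<^bsub>R\<^esub> ?t [^]\<^bsub>R\<^esub> i) \<oplus>\<^bsub>R\<^esub> ?s B2"
          using t gc Bc by (intro R.finsum_addf) auto
        finally show ?thesis .
      qed
      have eq: "?s B2 = UnivPoly.eval R R id ?t g \<oplus>\<^bsub>R\<^esub> ?s B2"
        unfolding ev_g by (rule trans[OF s[symmetric] diff])
      have evc: "UnivPoly.eval R R id ?t g \<in> carrier R"
        using ring_hom_cring_closed[OF eval_hom[OF id_hom[OF cr] t] g(1)] .
      have "UnivPoly.eval R R id ?t g = \<zero>\<^bsub>R\<^esub>"
        by (rule iffD1[OF R.add.r_cancel_one'[OF sc evc] eq])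
      then show "?t \<in> carrier R \<and> UnivPoly.eval R R id ?t g = \<zero>\<^bsub>R\<^esub>" using t by simp
    qed
    then have "card {eval2 R R id y' z' T | y' z'. y' \<in> carrier R \<and> z' \<in> carrier R \<and>
        eval2 R R id y' z' G = a \<and> eval2 R R id y' z' H = b} \<le> card {t \<in> carrier R. UnivPoly.eval R R id t g = \<zero>\<^bsub>R\<^esub>}"
      using R(2) by (intro card_mono) auto
    also have "\<dots> \<le> n" using \<open>g i0 \<noteq> \<zero>\<^bsub>R\<^esub>\<close> g by (intro UP_roots_bound[OF R])
    finally show "card {eval2 R R id y' z' T | y' z'. y' \<in> carrier R \<and> z' \<in> carrier R \<and>
        eval2 R R id y' z' G = eval2 R R id y z G \<and> eval2 R R id y' z' H = eval2 R R id y z H} \<le> n"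
      by (simp add: a_def b_def)
  qed
qed

section \<open>Degrees and slices\<close>

text \<open>\<open>Max\<close> has its intended meaning only on finite sets, so the point is that
  only finitely many coefficients are nonzero.\<close>

lemma total_deg2_bound:
  assumes p: "p \<in> carrier (UP2 R)" and nz: "p k i \<noteq> \<zero>\<^bsub>R\<^esub>"
  shows "i + k \<le> total_deg2 R p"
proof -
  obtain e where e: "p \<in> bideg_le R e" using p by (rule bideg_le_obtain)
  have c: "coeff2 R p i j = p j i" for i j
    using p UP_carrierD[OF p] by (simp add: coeff2_def)
  have "i + j \<le> 2 * e" if "coeff2 R p i j \<noteq> \<zero>\<^bsub>R\<^esub>" for i j
  proof -
    have "\<not> (j > e \<or> i > e)" using e that unfolding bideg_le_def c by blast
    then show ?thesis by simp
  qed
  then have "{i + j | i j. coeff2 R p i j \<noteq> \<zero>\<^bsub>R\<^esub>} \<subseteq> {..2 * e}" by auto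
  then have "finite {i + j | i j. coeff2 R p i j \<noteq> \<zero>\<^bsub>R\<^esub>}" by (rule finite_subset) simp
  moreover have "i + k \<in> {i + j | i j. coeff2 R p i j \<noteq> \<zero>\<^bsub>R\<^esub>}" using nz unfolding c by blast
  ultimately show ?thesis unfolding total_deg2_def by (intro Max_ge) auto
qed

lemma total_deg3_bound:
  assumes p: "p \<in> carrier (UP3 R)" and nz: "p k j i \<noteq> \<zero>\<^bsub>R\<^esub>"
  shows "i + j + k \<le> total_deg3 R p"
proof -
  obtain N where N: "\<And>k. k > N \<Longrightarrow> p k = \<zero>\<^bsub>UP2 R\<^esub>" using UP_bound_obtain[OF p] by blast
  have row: "p k \<in> carrier (UP2 R)" for k using p by (rule UP_carrierD)
  then have "\<exists>e. p k \<in> bideg_le R e" for k by (meson bideg_le_obtain)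
  then obtain e where e: "\<And>k. p k \<in> bideg_le R (e k)" by metis
  have c: "coeff3 R p i j k = p k j i" for i j k
    using p row UP_carrierD[OF row] by (simp add: coeff3_def coeff2_def)
  let ?A = "{i + j + k | i j k. coeff3 R p i j k \<noteq> \<zero>\<^bsub>R\<^esub>}"
  have "i + j + k \<in> (\<lambda>(k, j, i). i + j + k) ` (SIGMA k:{..N}. {..e k} \<times> {..e k})"
    if nz: "coeff3 R p i j k \<noteq> \<zero>\<^bsub>R\<^esub>" for i j k
  proof -
    have "\<not> (j > e k \<or> i > e k)" using e[of k] nz unfolding bideg_le_def c by blast
    moreover have "\<not> k > N" using nz N[of k] by (auto simp: c)
    ultimately show ?thesis by (intro image_eqI[of _ _ "(k, j, i)"]) auto
  qed
  then have "?A \<subseteq> (\<lambda>(k, j, i). i + j + k) ` (SIGMA k:{..N}. {..e k} \<times> {..e k})" by blast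
  then have "finite ?A" by (rule finite_subset) auto
  moreover have "i + j + k \<in> ?A" using nz unfolding c by blast
  ultimately show ?thesis unfolding total_deg3_def by (intro Max_ge) auto
qed

text \<open>The assumptions exclude the value 0, which encodes that no positive multiple of one
  vanishes; hence \<open>ring_char R\<close> is the least positive integer with this
  property.\<close>

lemma less_ring_char:
  assumes "0 < k" "k < ring_char R"
  shows "[k] \<cdot>\<^bsub>R\<^esub> \<one>\<^bsub>R\<^esub> \<noteq> \<zero>\<^bsub>R\<^esub>"
  using assms not_less_Least[of k "\<lambda>n. 0 < n \<and> [n] \<cdot>\<^bsub>R\<^esub> \<one>\<^bsub>R\<^esub> = \<zero>\<^bsub>R\<^esub>"]
  by (auto simp: ring_char_def split: if_splits)

lemma eval_const2_X2:
  assumes R: "cring R" and f: "f \<in> carrier (UP R)"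
  shows "UnivPoly.eval R (UP2 R) (const2 R) (X2 R) f k i = (if k = 0 then f i else \<zero>\<^bsub>R\<^esub>)"
proof -
  have "up_ring.monom (UP2 R) f 0 \<in> carrier (UP2 R)" using f by (intro UP_monom_closed cring_UP R)
  from eval2_id[OF R this] have "UnivPoly.eval R (UP2 R) (const2 R) (X2 R) f = up_ring.monom (UP2 R) f 0"
    unfolding eval2_def
    by (simp only: eval_const_gen[OF eval_hom[OF const2_hom[OF R] X2_closed[OF R]] Y2_closed[OF R] f])
  then show ?thesis using f by (simp add: UP_monom_apply)
qed

lemma swap2_X2: "cring R \<Longrightarrow> swap2 (X2 R) = Y2 R"
  by (intro ext) (simp add: swap2_def X2_def Y2_def UP_monom_apply UP_monom_closed cring.cring_simprules cring_UP UP_one_apply)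

lemma eval_const2_Y2:
  assumes R: "cring R" and f: "f \<in> carrier (UP R)"
  shows "UnivPoly.eval R (UP2 R) (const2 R) (Y2 R) f k i = (if i = 0 then f k else \<zero>\<^bsub>R\<^esub>)"
proof -
  have "swap2 (UnivPoly.eval R (UP2 R) (const2 R) (X2 R) f) = UnivPoly.eval R (UP2 R) (const2 R) (swap2 (X2 R)) f"
    by (rule eval_natural[OF const2_hom[OF R] swap2_hom[OF R] X2_closed[OF R] f]) (simp add: swap2_const2 R)
  then have "UnivPoly.eval R (UP2 R) (const2 R) (Y2 R) f k i = swap2 (UnivPoly.eval R (UP2 R) (const2 R) (X2 R) f) k i"
    by (simp add: swap2_X2[OF R])
  then show ?thesis by (simp add: swap2_def eval_const2_X2[OF R f])
qed

definition mixed_part :: "('a, 'm) ring_scheme \<Rightarrow> (nat \<Rightarrow> nat \<Rightarrow> 'a) \<Rightarrow> nat \<Rightarrow> nat \<Rightarrow> 'a" where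
  "mixed_part R F k i = (if k = 0 \<or> i = 0 then \<zero>\<^bsub>R\<^esub> else F k i)"

text \<open>The constant term may be counted only once. It is kept in \<open>swap2 F 0\<close>, the
  polynomial F(0, a), and deleted from the part in the first variable.\<close>

lemma mixed_part_decomposition:
  assumes R: "cring R" and F: "F \<in> carrier (UP2 R)"
  shows "mixed_part R F \<in> carrier (UP2 R)" "(\<lambda>i. if i = 0 then \<zero>\<^bsub>R\<^esub> else F 0 i) \<in> carrier (UP R)"
    "swap2 F 0 \<in> carrier (UP R)"
    "F = mixed_part R F \<oplus>\<^bsub>UP2 R\<^esub> (UnivPoly.eval R (UP2 R) (const2 R) (X2 R) (\<lambda>i. if i = 0 then \<zero>\<^bsub>R\<^esub> else F 0 i)
      \<oplus>\<^bsub>UP2 R\<^esub> UnivPoly.eval R (UP2 R) (const2 R) (Y2 R) (swap2 F 0))"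
proof -
  interpret R: cring R by (rule R)
  interpret U: cring "UP2 R" by (intro cring_UP R)
  obtain e where e: "F \<in> bideg_le R e" using F by (rule bideg_le_obtain)
  let ?h = "\<lambda>i. if i = 0 then \<zero>\<^bsub>R\<^esub> else F 0 i"
  have "mixed_part R F \<in> bideg_le R e" using e by (auto simp: bideg_le_def mixed_part_def)
  then show m: "mixed_part R F \<in> carrier (UP2 R)" by (rule bideg_le_closed)
  show h: "?h \<in> carrier (UP R)" using e by (auto simp: UP_carrier_iff bideg_le_def intro!: exI[of _ e])
  show s: "swap2 F 0 \<in> carrier (UP R)" using swap2_closed[OF F] by (rule UP_carrierD)
  have ev: "UnivPoly.eval R (UP2 R) (const2 R) t f \<in> carrier (UP2 R)"
    if "t \<in> carrier (UP2 R)" "f \<in> carrier (UP R)" for t f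
    using ring_hom_cring_closed[OF eval_hom[OF const2_hom[OF R] that(1)] that(2)] .
  have cl: "UnivPoly.eval R (UP2 R) (const2 R) (X2 R) ?h \<in> carrier (UP2 R)"
      "UnivPoly.eval R (UP2 R) (const2 R) (Y2 R) (swap2 F 0) \<in> carrier (UP2 R)"
    using ev X2_closed[OF R] Y2_closed[OF R] h s by blast+
  have "F k i = (mixed_part R F \<oplus>\<^bsub>UP2 R\<^esub> (UnivPoly.eval R (UP2 R) (const2 R) (X2 R) ?h
      \<oplus>\<^bsub>UP2 R\<^esub> UnivPoly.eval R (UP2 R) (const2 R) (Y2 R) (swap2 F 0))) k i" for k i
    unfolding UP2_apply(1)[OF R m U.a_closed[OF cl]] UP2_apply(1)[OF R cl]
      eval_const2_X2[OF R h] eval_const2_Y2[OF R s]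
    using UP2_carrierD[OF F] by (simp add: mixed_part_def swap2_def)
  then show "F = mixed_part R F \<oplus>\<^bsub>UP2 R\<^esub> (UnivPoly.eval R (UP2 R) (const2 R) (X2 R) ?h
      \<oplus>\<^bsub>UP2 R\<^esub> UnivPoly.eval R (UP2 R) (const2 R) (Y2 R) (swap2 F 0))" by blast
qed

text \<open>Without such a monomial the mixed part would be zero, and the decomposition would
  exhibit \<open>F\<close> as diagonal.\<close>

lemma not_diagonal2:
  assumes R: "cring R" and F: "F \<in> carrier (UP2 R)" and nd: "\<not> diagonal2 R F"
  obtains k i where "0 < k" "0 < i" "F k i \<noteq> \<zero>\<^bsub>R\<^esub>"
proof -
  interpret U: cring "UP2 R" by (intro cring_UP R)
  note D = mixed_part_decomposition[OF R F]
  have "mixed_part R F \<noteq> \<zero>\<^bsub>UP2 R\<^esub>"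
  proof
    assume z: "mixed_part R F = \<zero>\<^bsub>UP2 R\<^esub>"
    let ?u = "UnivPoly.eval R (UP2 R) (const2 R) (X2 R) (\<lambda>i. if i = 0 then \<zero>\<^bsub>R\<^esub> else F 0 i)"
    let ?v = "UnivPoly.eval R (UP2 R) (const2 R) (Y2 R) (swap2 F 0)"
    have uv: "?u \<in> carrier (UP2 R)" "?v \<in> carrier (UP2 R)"
      using ring_hom_cring_closed[OF eval_hom[OF const2_hom[OF R] X2_closed[OF R]] D(2)]
        ring_hom_cring_closed[OF eval_hom[OF const2_hom[OF R] Y2_closed[OF R]] D(3)] by blast+
    have "F = ?u \<oplus>\<^bsub>UP2 R\<^esub> ?v" using D(4) unfolding z U.l_zero[OF U.a_closed[OF uv]] .
    then show False using nd D(2,3) unfolding diagonal2_def by blast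
  qed
  moreover have "mixed_part R F = \<zero>\<^bsub>UP2 R\<^esub>" if "\<And>k i. mixed_part R F k i = \<zero>\<^bsub>R\<^esub>"
    using that by (intro ext) simp
  ultimately obtain k i where "mixed_part R F k i \<noteq> \<zero>\<^bsub>R\<^esub>" by blast
  then show thesis using that[of k i] by (auto simp: mixed_part_def split: if_splits)
qed

lemma eval2_mixed_part:
  assumes R: "cring R" and F: "F \<in> carrier (UP2 R)" and m: "mixed_part R F \<in> bideg_le R d"
    and xa: "x \<in> carrier R" "a \<in> carrier R"
  shows "eval2 R R id x a F = carrier_mixed_form R d (\<lambda>i k. mixed_part R F k i) x a \<oplus>\<^bsub>R\<^esub>
    (UnivPoly.eval R R id x (\<lambda>i. if i = 0 then \<zero>\<^bsub>R\<^esub> else F 0 i) \<oplus>\<^bsub>R\<^esub> UnivPoly.eval R R id a (swap2 F 0))"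
    "carrier_mixed_form R d (\<lambda>i k. mixed_part R F k i) x a \<in> carrier R"
proof -
  note D = mixed_part_decomposition[OF R F] and id = id_hom[OF R]
  have v: "ring_hom_cring (UP2 R) R (eval2 R R id x a)" using id xa by (rule eval2_hom)
  interpret v: ring_hom_cring "UP2 R" R "eval2 R R id x a" by (rule v)
  let ?h = "\<lambda>i. if i = 0 then \<zero>\<^bsub>R\<^esub> else F 0 i"
  have cl: "UnivPoly.eval R (UP2 R) (const2 R) (X2 R) ?h \<in> carrier (UP2 R)"
      "UnivPoly.eval R (UP2 R) (const2 R) (Y2 R) (swap2 F 0) \<in> carrier (UP2 R)"
    using ring_hom_cring_closed[OF eval_hom[OF const2_hom[OF R] X2_closed[OF R]] D(2)]
      ring_hom_cring_closed[OF eval_hom[OF const2_hom[OF R] Y2_closed[OF R]] D(3)] by blast+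
  have vX: "eval2 R R id x a (UnivPoly.eval R (UP2 R) (const2 R) (X2 R) ?h) = UnivPoly.eval R R id x ?h"
    using eval_natural[OF const2_hom[OF R] v X2_closed[OF R] D(2), of id]
    by (simp add: eval2_const[OF id xa] eval2_X2[OF id xa])
  have vY: "eval2 R R id x a (UnivPoly.eval R (UP2 R) (const2 R) (Y2 R) (swap2 F 0)) = UnivPoly.eval R R id a (swap2 F 0)"
    using eval_natural[OF const2_hom[OF R] v Y2_closed[OF R] D(3), of id]
    by (simp add: eval2_const[OF id xa] eval2_Y2[OF id xa])
  have vm: "eval2 R R id x a (mixed_part R F) = carrier_mixed_form R d (\<lambda>i k. mixed_part R F k i) x a"
    unfolding eval2_expand[OF id xa m] carrier_mixed_form_def by simp
  show "carrier_mixed_form R d (\<lambda>i k. mixed_part R F k i) x a \<in> carrier R"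
    unfolding vm[symmetric] using D(1) by (rule v.hom_closed)
  show "eval2 R R id x a F = carrier_mixed_form R d (\<lambda>i k. mixed_part R F k i) x a \<oplus>\<^bsub>R\<^esub>
    (UnivPoly.eval R R id x ?h \<oplus>\<^bsub>R\<^esub> UnivPoly.eval R R id a (swap2 F 0))"
    by (subst D(4)) (simp only: v.hom_add D(1) cl v.R.a_closed vX vY vm)
qed

text \<open>The coefficient of \<open>x^i\<close> in F(x, G(y, z)) + J(x). It is encoded as a
  polynomial in \<open>G\<close>, the form in which \<open>alg_independent2_shear\<close> can use
  it.\<close>

definition slice :: "('a, 'm) ring_scheme \<Rightarrow> (nat \<Rightarrow> nat \<Rightarrow> 'a) \<Rightarrow> (nat \<Rightarrow> nat \<Rightarrow> 'a) \<Rightarrow> (nat \<Rightarrow> 'a)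
    \<Rightarrow> nat \<Rightarrow> nat \<Rightarrow> nat \<Rightarrow> 'a" where
  "slice R F G J i = UnivPoly.eval R (UP2 R) (const2 R) G (swap2 F i \<oplus>\<^bsub>UP R\<^esub> up_ring.monom (UP R) (J i) 0)"

lemma slice_expand:
  assumes R: "cring R" and F: "F \<in> bideg_le R M" and G: "G \<in> carrier (UP2 R)" and J: "J \<in> carrier (UP R)"
  shows "swap2 F i \<oplus>\<^bsub>UP R\<^esub> up_ring.monom (UP R) (J i) 0 \<in> carrier (UP R)"
    "slice R F G J i \<in> carrier (UP2 R)"
    "slice R F G J i = (\<Oplus>\<^bsub>UP2 R\<^esub>s\<in>{..M}. const2 R (F s i) \<otimes>\<^bsub>UP2 R\<^esub> G [^]\<^bsub>UP2 R\<^esub> s) \<oplus>\<^bsub>UP2 R\<^esub> const2 R (J i)"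
    "slice R F G J i k j = (\<Oplus>\<^bsub>R\<^esub>s\<in>{..M}. F s i \<otimes>\<^bsub>R\<^esub> (G [^]\<^bsub>UP2 R\<^esub> s) k j) \<oplus>\<^bsub>R\<^esub> (if k = 0 \<and> j = 0 then J i else \<zero>\<^bsub>R\<^esub>)"
proof -
  interpret R: cring R by (rule R)
  interpret U: cring "UP R" by (intro cring_UP R)
  interpret U2: cring "UP2 R" by (intro cring_UP R)
  have Fc: "F \<in> carrier (UP2 R)" using F by (rule bideg_le_closed)
  have Fk: "F s i \<in> carrier R" for s i using Fc by (rule UP2_carrierD)
  have Ji: "J i \<in> carrier R" using J by (rule UP_carrierD)
  have s: "swap2 F i \<in> carrier (UP R)" using swap2_closed[OF Fc] by (rule UP_carrierD)
  have m: "up_ring.monom (UP R) (J i) 0 \<in> carrier (UP R)" using Ji by (intro UP_monom_closed R)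
  show c: "swap2 F i \<oplus>\<^bsub>UP R\<^esub> up_ring.monom (UP R) (J i) 0 \<in> carrier (UP R)" using s m by simp
  interpret e: ring_hom_cring "UP R" "UP2 R" "UnivPoly.eval R (UP2 R) (const2 R) G"
    by (intro eval_hom const2_hom R G)
  show sc: "slice R F G J i \<in> carrier (UP2 R)" unfolding slice_def using c by (rule e.hom_closed)
  have "UnivPoly.eval R (UP2 R) (const2 R) G (swap2 F i) =
    (\<Oplus>\<^bsub>UP2 R\<^esub>s\<in>{..M}. const2 R (swap2 F i s) \<otimes>\<^bsub>UP2 R\<^esub> G [^]\<^bsub>UP2 R\<^esub> s)"
    using F by (intro eval_expand[OF const2_hom[OF R] G s]) (auto simp: swap2_def bideg_le_def)
  then show ex: "slice R F G J i =
    (\<Oplus>\<^bsub>UP2 R\<^esub>s\<in>{..M}. const2 R (F s i) \<otimes>\<^bsub>UP2 R\<^esub> G [^]\<^bsub>UP2 R\<^esub> s) \<oplus>\<^bsub>UP2 R\<^esub> const2 R (J i)"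
    unfolding slice_def e.hom_add[OF s m] eval_const_gen[OF const2_hom[OF R] G Ji] by (simp only: swap2_def)
  have t: "const2 R (F s i) \<otimes>\<^bsub>UP2 R\<^esub> G [^]\<^bsub>UP2 R\<^esub> s \<in> carrier (UP2 R)" for s :: nat
    using G Fk const2_closed[OF R] by simp
  have fs: "(\<Oplus>\<^bsub>UP2 R\<^esub>s\<in>{..M}. const2 R (F s i) \<otimes>\<^bsub>UP2 R\<^esub> G [^]\<^bsub>UP2 R\<^esub> s) \<in> carrier (UP2 R)"
    using t by (intro U2.finsum_closed) auto
  have "(\<Oplus>\<^bsub>UP2 R\<^esub>s\<in>{..M}. const2 R (F s i) \<otimes>\<^bsub>UP2 R\<^esub> G [^]\<^bsub>UP2 R\<^esub> s) k j =
    (\<Oplus>\<^bsub>UP R\<^esub>s\<in>{..M}. (const2 R (F s i) \<otimes>\<^bsub>UP2 R\<^esub> G [^]\<^bsub>UP2 R\<^esub> s) k) j"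
    using t by (subst UP_finsum_apply[OF cring_UP[OF R]]) auto
  also have "\<dots> = (\<Oplus>\<^bsub>R\<^esub>s\<in>{..M}. (const2 R (F s i) \<otimes>\<^bsub>UP2 R\<^esub> G [^]\<^bsub>UP2 R\<^esub> s) k j)"
    using UP_carrierD[OF t] by (intro UP_finsum_apply[OF R]) auto
  also have "\<dots> = (\<Oplus>\<^bsub>R\<^esub>s\<in>{..M}. F s i \<otimes>\<^bsub>R\<^esub> (G [^]\<^bsub>UP2 R\<^esub> s) k j)"
    using G Fk by (intro R.finsum_cong') (auto simp: const2_mult_apply[OF R] UP2_carrierD)
  finally show "slice R F G J i k j =
    (\<Oplus>\<^bsub>R\<^esub>s\<in>{..M}. F s i \<otimes>\<^bsub>R\<^esub> (G [^]\<^bsub>UP2 R\<^esub> s) k j) \<oplus>\<^bsub>R\<^esub> (if k = 0 \<and> j = 0 then J i else \<zero>\<^bsub>R\<^esub>)"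
    unfolding ex UP2_apply(1)[OF R fs const2_closed[OF R Ji]] const2_apply[OF R Ji] by simp
qed

text \<open>\<open>H\<close> is free of \<open>x\<close>, so it affects only the coefficient of
  \<open>x^0\<close>, and that coefficient is the polynomial b of the overview.\<close>

lemma composite_poly_slice:
  assumes R: "cring R" and FGH: "F \<in> carrier (UP2 R)" "G \<in> carrier (UP2 R)" "H \<in> carrier (UP2 R)"
    and J: "J \<in> carrier (UP R)"
  shows "0 < i \<Longrightarrow> composite_poly R F G H J k j i = slice R F G J i k j"
    and "composite_poly R F G H J k j 0 = (H \<oplus>\<^bsub>UP2 R\<^esub> slice R F G J 0) k j"
proof -
  interpret R: cring R by (rule R)
  interpret U2: cring "UP2 R" by (intro cring_UP R)
  obtain M where F: "F \<in> bideg_le R M" using FGH(1) by (rule bideg_le_obtain)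
  note s = slice_expand[OF R F FGH(2) J] and a = composite_poly_apply[OF R F FGH(2,3) J]
  have Fk: "F s i \<in> carrier R" for s i using FGH(1) by (rule UP2_carrierD)
  have sum: "(\<Oplus>\<^bsub>R\<^esub>s\<in>{..M}. F s i \<otimes>\<^bsub>R\<^esub> (G [^]\<^bsub>UP2 R\<^esub> s) k j) \<in> carrier R" for i
    using Fk FGH(2) by (intro R.finsum_closed) (auto simp: UP2_carrierD)
  have Jc: "J i \<in> carrier R" for i using J by (rule UP_carrierD)
  have Hc: "H k j \<in> carrier R" using FGH(3) by (rule UP2_carrierD)
  show "0 < i \<Longrightarrow> composite_poly R F G H J k j i = slice R F G J i k j"
    using sum[of i] Jc[of i] by (simp add: a s(4))
  show "composite_poly R F G H J k j 0 = (H \<oplus>\<^bsub>UP2 R\<^esub> slice R F G J 0) k j"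
    unfolding UP2_apply(1)[OF R FGH(3) s(2)] using sum[of 0] Jc[of 0] Hc
    by (simp add: a s(4) R.a_ac)
qed

text \<open>A slice is a combination of powers of \<open>G\<close> in which the \<open>K\<close>-th
  power really occurs. The second inequality is the first one after exchanging the
  variables.\<close>

lemma slice_degree:
  assumes R: "field R" and F: "F \<in> carrier (UP2 R)" and G: "G \<in> carrier (UP2 R)" and J: "J \<in> carrier (UP R)"
    and K: "0 < K" "F K i \<noteq> \<zero>\<^bsub>R\<^esub>" and p: "slice R F G J i \<in> bideg_le R N"
  shows "K * deg (UP R) G \<le> N" "K * deg (UP R) (swap2 G) \<le> N"
proof -
  interpret R: field R by fact
  have cr: "cring R" and d: "domain (UP R)" by (rule R.is_cring, intro domain_UP R.domain_axioms)
  obtain M where M: "F \<in> bideg_le R M" using F by (rule bideg_le_obtain)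
  interpret s: ring_hom_cring "UP2 R" "UP2 R" swap2 by (rule swap2_hom[OF cr])
  have Fk: "F s i \<in> carrier R" for s using F by (rule UP2_carrierD)
  have Ji: "J i \<in> carrier R" using J by (rule UP_carrierD)
  have "F K i = \<zero>\<^bsub>R\<^esub>" if "\<not> K \<le> M" using M that by (simp add: bideg_le_def)
  then have KM: "1 \<le> K" "K \<le> M" using K by auto
  have nz: "up_ring.monom (UP R) (F K i) 0 \<noteq> \<zero>\<^bsub>UP R\<^esub>"
  proof
    assume "up_ring.monom (UP R) (F K i) 0 = \<zero>\<^bsub>UP R\<^esub>"
    then have "up_ring.monom (UP R) (F K i) 0 0 = \<zero>\<^bsub>UP R\<^esub> 0" by (rule arg_cong)
    then show False using K(2) Fk by (simp add: UP_monom_apply)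
  qed
  have mc: "up_ring.monom (UP R) (F s i) 0 \<in> carrier (UP R)" for s using Fk by (intro UP_monom_closed cr)
  have Jm: "up_ring.monom (UP R) (J i) 0 \<in> carrier (UP R)" using Ji by (intro UP_monom_closed cr)
  note ex = slice_expand(3)[OF cr M G J, of i]
  have van: "p n = \<zero>\<^bsub>UP R\<^esub>" if "p \<in> bideg_le R N" "n > N" for p n
    using that by (intro ext) (simp add: bideg_le_def)
  show "K * deg (UP R) G \<le> N"
    using van[OF p] by (intro power_combination_degree[OF d G mc Jm KM nz ex[unfolded const2_def]])
  let ?g = "\<lambda>s. const2 R (F s i) \<otimes>\<^bsub>UP2 R\<^esub> G [^]\<^bsub>UP2 R\<^esub> s"
  have gc: "?g s \<in> carrier (UP2 R)" for s :: nat using G const2_closed[OF cr Fk] by simp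
  have Jc: "const2 R (J i) \<in> carrier (UP2 R)" using cr Ji by (rule const2_closed)
  have "swap2 (slice R F G J i) = swap2 (\<Oplus>\<^bsub>UP2 R\<^esub>s\<in>{..M}. ?g s) \<oplus>\<^bsub>UP2 R\<^esub> swap2 (const2 R (J i))"
    unfolding ex using gc Jc by (intro s.hom_add s.R.finsum_closed) auto
  also have "swap2 (\<Oplus>\<^bsub>UP2 R\<^esub>s\<in>{..M}. ?g s) = finsum (UP2 R) (swap2 \<circ> ?g) {..M}"
    using gc by (intro s.hom_finsum) auto
  also have "\<dots> = (\<Oplus>\<^bsub>UP2 R\<^esub>s\<in>{..M}. const2 R (F s i) \<otimes>\<^bsub>UP2 R\<^esub> swap2 G [^]\<^bsub>UP2 R\<^esub> s)"
  proof (rule s.R.finsum_cong')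
    show "(\<lambda>s. const2 R (F s i) \<otimes>\<^bsub>UP2 R\<^esub> swap2 G [^]\<^bsub>UP2 R\<^esub> s) \<in> {..M} \<rightarrow> carrier (UP2 R)"
      using swap2_closed[OF G] const2_closed[OF cr Fk] by simp
    show "(swap2 \<circ> ?g) s = const2 R (F s i) \<otimes>\<^bsub>UP2 R\<^esub> swap2 G [^]\<^bsub>UP2 R\<^esub> s" for s
      using G const2_closed[OF cr Fk] by (simp add: swap2_const2[OF cr Fk])
  qed simp
  also have "swap2 (const2 R (J i)) = const2 R (J i)" using cr Ji by (rule swap2_const2)
  finally have ex': "swap2 (slice R F G J i) =
    (\<Oplus>\<^bsub>UP2 R\<^esub>s\<in>{..M}. const2 R (F s i) \<otimes>\<^bsub>UP2 R\<^esub> swap2 G [^]\<^bsub>UP2 R\<^esub> s) \<oplus>\<^bsub>UP2 R\<^esub> const2 R (J i)" .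
  have "swap2 (slice R F G J i) \<in> bideg_le R N" using p by simp
  then show "K * deg (UP R) (swap2 G) \<le> N"
    using van by (intro power_combination_degree[OF d swap2_closed[OF G] mc Jm KM nz ex'[unfolded const2_def]])
qed

lemma bideg_le_degI:
  assumes R: "cring R" and G: "G \<in> carrier (UP2 R)" and d: "deg (UP R) G \<le> d" "deg (UP R) (swap2 G) \<le> d"
  shows "G \<in> bideg_le R d"
proof -
  interpret U: UP_cring "UP R" "UP2 R" by (intro UP_cring.intro cring_UP R) simp
  have *: "p k j = \<zero>\<^bsub>R\<^esub>" if "p \<in> carrier (UP2 R)" "deg (UP R) p \<le> d" "k > d" for p k j
    using U.deg_aboveD[of p k] that by simp
  show ?thesis
    unfolding bideg_le_def using UP2_carrierD[OF G] *[OF G d(1)] *[OF swap2_closed[OF G] d(2)]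
    by (auto simp: swap2_def)
qed

text \<open>If \<open>G\<close> were a constant, then \<open>X2 R\<close> minus this constant would
  be a relation.\<close>

lemma alg_independent2_nonconstant:
  assumes R: "field R" and GH: "G \<in> carrier (UP2 R)" "H \<in> carrier (UP2 R)" and indep: "alg_independent2 R G H"
  shows "G \<notin> bideg_le R 0"
proof
  assume G: "G \<in> bideg_le R 0"
  interpret R: field R by fact
  have cr: "cring R" by (rule R.is_cring)
  interpret U2: cring "UP2 R" by (intro cring_UP cr)
  have g: "G 0 0 \<in> carrier R" using G by (simp add: bideg_le_def)
  have Geq: "G = const2 R (G 0 0)"
    using G by (intro ext) (auto simp: const2_apply[OF cr g] bideg_le_def)
  let ?e = "eval2 R (UP2 R) (const2 R) G H"
  interpret e: ring_hom_cring "UP2 R" "UP2 R" ?e by (intro eval2_hom const2_hom cr GH)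
  let ?c = "const2 R (G 0 0)"
  have c: "?c \<in> carrier (UP2 R)" "X2 R \<in> carrier (UP2 R)"
    using g by (auto intro: const2_closed[OF cr] X2_closed[OF cr])
  have "?e (X2 R \<ominus>\<^bsub>UP2 R\<^esub> ?c) = G \<ominus>\<^bsub>UP2 R\<^esub> ?c"
    unfolding a_minus_def using c
    by (simp only: e.hom_add e.hom_a_inv U2.a_inv_closed eval2_X2[OF const2_hom[OF cr] GH] eval2_const[OF const2_hom[OF cr] GH g])
  also have "\<dots> = \<zero>\<^bsub>UP2 R\<^esub>" unfolding Geq[symmetric] a_minus_def using GH(1) by (rule U2.r_neg)
  finally have "X2 R \<ominus>\<^bsub>UP2 R\<^esub> ?c = \<zero>\<^bsub>UP2 R\<^esub>"
    using indep c unfolding alg_independent2_def by blast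
  then have "X2 R = ?c" using c by (simp only: U2.r_right_minus_eq)
  then have "X2 R 0 1 = const2 R (G 0 0) 0 1" by (rule arg_cong)
  then show False by (simp add: const2_apply[OF cr g] X2_def UP_monom_apply UP_monom_closed[OF cr])
qed

text \<open>The substitution (u, v) -> (u, v + p(u)) is invertible. A relation \<open>A\<close> for
  the new pair gives the relation \<open>?B\<close> for the old one, so \<open>?B\<close> is zero,
  and substituting v - p(u) for v in \<open>?B\<close> recovers \<open>A\<close>.\<close>

lemma alg_independent2_shear:
  assumes R: "cring R" and GH: "G \<in> carrier (UP2 R)" "H \<in> carrier (UP2 R)" and p: "p \<in> carrier (UP R)"
    and indep: "alg_independent2 R G H"
  shows "alg_independent2 R G (H \<oplus>\<^bsub>UP2 R\<^esub> UnivPoly.eval R (UP2 R) (const2 R) G p)"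
  unfolding alg_independent2_def
proof (intro ballI impI)
  fix A assume A: "A \<in> carrier (UP2 R)"
    and zero: "eval2 R (UP2 R) (const2 R) G (H \<oplus>\<^bsub>UP2 R\<^esub> UnivPoly.eval R (UP2 R) (const2 R) G p) A = \<zero>\<^bsub>UP2 R\<^esub>"
  interpret U2: cring "UP2 R" by (intro cring_UP R)
  note c2 = const2_hom[OF R] and X = X2_closed[OF R] and Y = Y2_closed[OF R]
  let ?E = "\<lambda>g. UnivPoly.eval R (UP2 R) (const2 R) g p"
  let ?ev = "eval2 R (UP2 R) (const2 R)"
  have E: "?E g \<in> carrier (UP2 R)" if "g \<in> carrier (UP2 R)" for g
    using ring_hom_cring_closed[OF eval_hom[OF c2 that] p] .
  have subst: "?ev u v (?E (X2 R)) = ?E u" if "u \<in> carrier (UP2 R)" "v \<in> carrier (UP2 R)" for u v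
    using eval_natural[OF c2 eval2_hom[OF c2 that] X p, of "const2 R"]
    by (simp add: eval2_X2[OF c2 that] eval2_const[OF c2 that])
  have comp: "?ev u v (?ev (X2 R) w A) = ?ev u (?ev u v w) A"
    if "u \<in> carrier (UP2 R)" "v \<in> carrier (UP2 R)" "w \<in> carrier (UP2 R)" for u v w
    using eval2_natural[OF c2 eval2_hom[OF c2 that(1,2)] X that(3) A, of "const2 R"]
    by (simp add: eval2_X2[OF c2 that(1,2)] eval2_const[OF c2 that(1,2)])
  let ?w = "Y2 R \<oplus>\<^bsub>UP2 R\<^esub> ?E (X2 R)"
  have w: "?w \<in> carrier (UP2 R)" using Y E[OF X] by simp
  have ev_w: "?ev u v ?w = v \<oplus>\<^bsub>UP2 R\<^esub> ?E u" if uv: "u \<in> carrier (UP2 R)" "v \<in> carrier (UP2 R)" for u v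
  proof -
    interpret e: ring_hom_cring "UP2 R" "UP2 R" "?ev u v" by (rule eval2_hom[OF c2 uv])
    show ?thesis using Y E[OF X] by (simp only: e.hom_add subst[OF uv] eval2_Y2[OF c2 uv])
  qed
  let ?B = "?ev (X2 R) ?w A"
  have B: "?B \<in> carrier (UP2 R)" using ring_hom_cring_closed[OF eval2_hom[OF c2 X w] A] .
  have "?ev G H ?B = \<zero>\<^bsub>UP2 R\<^esub>" unfolding comp[OF GH w] ev_w[OF GH] by (rule zero)
  then have B0: "?B = \<zero>\<^bsub>UP2 R\<^esub>" using indep B unfolding alg_independent2_def by blast
  let ?v = "Y2 R \<ominus>\<^bsub>UP2 R\<^esub> ?E (X2 R)"
  have v: "?v \<in> carrier (UP2 R)" using Y E[OF X] by simp
  have vw: "?v \<oplus>\<^bsub>UP2 R\<^esub> ?E (X2 R) = Y2 R"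
    using Y E[OF X] by (simp add: a_minus_def U2.a_assoc U2.l_neg del: UP_zero_apply)
  interpret t: ring_hom_cring "UP2 R" "UP2 R" "?ev (X2 R) ?v" by (rule eval2_hom[OF c2 X v])
  have "?ev (X2 R) ?v ?B = \<zero>\<^bsub>UP2 R\<^esub>" unfolding B0 by (rule t.hom_zero)
  then show "A = \<zero>\<^bsub>UP2 R\<^esub>" unfolding comp[OF X v w] ev_w[OF X v] vw eval2_id[OF R A] .
qed

section \<open>The image of the composite polynomial\<close>

lemma card_le_fibres:
  assumes "finite A" "\<And>p. p \<in> f ` A \<Longrightarrow> card {a \<in> A. f a = p} \<le> n"
  shows "card A \<le> n * card (f ` A)"
proof -
  have A: "(\<Union>p\<in>f ` A. {a \<in> A. f a = p}) = A" by blast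
  have "card A \<le> (\<Sum>p\<in>f ` A. card {a \<in> A. f a = p})"
    using card_UN_le[of "f ` A" "\<lambda>p. {a \<in> A. f a = p}", OF finite_imageI[OF assms(1)]] unfolding A .
  also have "\<dots> \<le> of_nat (card (f ` A)) * n" using assms(2) by (rule sum_bounded_above)
  finally show ?thesis by (simp add: mult.commute)
qed

text \<open>A fibre lies in the product of its two coordinate projections, and each has at most
  \<open>n\<close> elements unless \<open>D1\<close> or \<open>D2\<close> vanishes. This gives the
  factor \<open>n\<^sup>2\<close>; the zeros of \<open>D1\<close> times \<open>D2\<close>, of
  bidegree \<open>4 * n * d\<close>, are accounted for by the first summand.\<close>

lemma independent_image_bound:
  fixes d :: nat
  defines "n \<equiv> (2 * d + 1)\<^sup>2"
  assumes R: "field R" "finite (carrier R)" and GQ: "G \<in> bideg_le R d" "Q \<in> bideg_le R d"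
    and indep: "alg_independent2 R G Q" and YZ: "Y \<subseteq> carrier R" "Z \<subseteq> carrier R"
  shows "card Y * card Z \<le> 4 * n * d * (card Y + card Z) +
    n\<^sup>2 * card {(eval2 R R id y z G, eval2 R R id y z Q) | y z. y \<in> Y \<and> z \<in> Z}"
proof -
  interpret R: field R by fact
  have cr: "cring R" by (rule R.is_cring)
  interpret U2: domain "UP2 R" by (intro domain_UP R.domain_axioms)
  have T: "X2 R \<in> bideg_le R 1" "Y2 R \<in> bideg_le R 1"
    using UP2_carrierD[OF X2_closed[OF cr]] UP2_carrierD[OF Y2_closed[OF cr]]
    by (auto simp: bideg_le_def X2_def Y2_def UP_monom_apply UP_monom_closed[OF cr] UP_one_apply
        cring.cring_simprules(6)[OF cring_UP[OF cr]])
  have ind: "A = \<zero>\<^bsub>UP2 R\<^esub>" if "A \<in> carrier (UP2 R)" "eval2 R (UP2 R) (const2 R) G Q A = \<zero>\<^bsub>UP2 R\<^esub>" for A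
    using indep that unfolding alg_independent2_def by blast
  define S where "S T y z = {eval2 R R id y' z' T | y' z'. y' \<in> carrier R \<and> z' \<in> carrier R \<and>
    eval2 R R id y' z' G = eval2 R R id y z G \<and> eval2 R R id y' z' Q = eval2 R R id y z Q}" for T y z
  obtain D1 where D1: "D1 \<in> bideg_le R (2 * n * d)" "D1 \<noteq> \<zero>\<^bsub>UP2 R\<^esub>"
    "\<And>y z. y \<in> carrier R \<Longrightarrow> z \<in> carrier R \<Longrightarrow> eval2 R R id y z D1 \<noteq> \<zero>\<^bsub>R\<^esub> \<Longrightarrow> card (S (X2 R) y z) \<le> n"
    using fibre_bound[OF R GQ T(1) ind] unfolding S_def n_def by blast
  obtain D2 where D2: "D2 \<in> bideg_le R (2 * n * d)" "D2 \<noteq> \<zero>\<^bsub>UP2 R\<^esub>"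
    "\<And>y z. y \<in> carrier R \<Longrightarrow> z \<in> carrier R \<Longrightarrow> eval2 R R id y z D2 \<noteq> \<zero>\<^bsub>R\<^esub> \<Longrightarrow> card (S (Y2 R) y z) \<le> n"
    using fibre_bound[OF R GQ T(2) ind] unfolding S_def n_def by blast
  define D where "D = D1 \<otimes>\<^bsub>UP2 R\<^esub> D2"
  have Dc: "D1 \<in> carrier (UP2 R)" "D2 \<in> carrier (UP2 R)" using D1(1) D2(1) bideg_le_closed by blast+
  have "D \<in> bideg_le R (2 * n * d + 2 * n * d)" unfolding D_def using D1(1) D2(1) by (rule bideg_le_mult[OF cr])
  then have D: "D \<in> bideg_le R (4 * n * d)" by (rule bideg_le_mono) simp
  have "D \<noteq> \<zero>\<^bsub>UP2 R\<^esub>" unfolding D_def using U2.integral_iff[OF Dc] D1(2) D2(2) by blast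
  from bivariate_zeros_bound[OF R D this YZ]
  have bad: "card {(y, z). y \<in> Y \<and> z \<in> Z \<and> eval2 R R id y z D = \<zero>\<^bsub>R\<^esub>} \<le> 4 * n * d * (card Y + card Z)" .
  define A where "A = {(y, z). y \<in> Y \<and> z \<in> Z \<and> eval2 R R id y z D \<noteq> \<zero>\<^bsub>R\<^esub>}"
  define m where "m = (\<lambda>(y, z). (eval2 R R id y z G, eval2 R R id y z Q))"
  have fin: "finite Y" "finite Z" using YZ R(2) finite_subset by blast+
  have A: "A \<subseteq> Y \<times> Z" by (auto simp: A_def)
  have finA: "finite A" using A fin by (meson finite_SigmaI finite_subset)
  have "card A \<le> n\<^sup>2 * card (m ` A)"
  proof (rule card_le_fibres[OF finA])
    fix p assume "p \<in> m ` A"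
    then obtain y z where yz: "(y, z) \<in> A" "p = m (y, z)" by auto
    then have c: "y \<in> carrier R" "z \<in> carrier R" and nz: "eval2 R R id y z D \<noteq> \<zero>\<^bsub>R\<^esub>"
      using YZ by (auto simp: A_def)
    interpret v: ring_hom_cring "UP2 R" R "eval2 R R id y z" by (rule eval2_hom[OF id_hom[OF cr] c])
    have "eval2 R R id y z D1 \<noteq> \<zero>\<^bsub>R\<^esub>" "eval2 R R id y z D2 \<noteq> \<zero>\<^bsub>R\<^esub>"
      using nz Dc unfolding D_def by auto
    then have cards: "card (S (X2 R) y z) \<le> n" "card (S (Y2 R) y z) \<le> n"
      using D1(3)[OF c] D2(3)[OF c] by blast+
    have inS: "y' \<in> S (X2 R) y z \<and> z' \<in> S (Y2 R) y z" if "(y', z') \<in> A" "m (y', z') = p" for y' z'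
    proof -
      have c': "y' \<in> carrier R" "z' \<in> carrier R" using that(1) A YZ by auto
      have eq: "eval2 R R id y' z' G = eval2 R R id y z G" "eval2 R R id y' z' Q = eval2 R R id y z Q"
        using that(2) by (simp_all add: yz(2) m_def)
      have "eval2 R R id y' z' (X2 R) = y'" "eval2 R R id y' z' (Y2 R) = z'"
        using eval2_X2[OF id_hom[OF cr] c'] eval2_Y2[OF id_hom[OF cr] c'] .
      then have "y' = eval2 R R id y' z' (X2 R)" "z' = eval2 R R id y' z' (Y2 R)" by simp_all
      then show ?thesis unfolding S_def mem_Collect_eq using c' eq by (intro conjI exI[of _ y'] exI[of _ z'])
    qed
    have finS: "finite (S T y z)" if "T \<in> carrier (UP2 R)" for T
    proof (rule finite_subset[OF _ R(2)])
      show "S T y z \<subseteq> carrier R"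
        unfolding S_def using ring_hom_cring_closed[OF eval2_hom[OF id_hom[OF cr]] that] by blast
    qed
    have "{a \<in> A. m a = p} \<subseteq> S (X2 R) y z \<times> S (Y2 R) y z" using inS by auto
    then have "card {a \<in> A. m a = p} \<le> card (S (X2 R) y z \<times> S (Y2 R) y z)"
      using finS[OF X2_closed[OF cr]] finS[OF Y2_closed[OF cr]] by (intro card_mono finite_SigmaI)
    also have "\<dots> \<le> n\<^sup>2" using cards by (simp add: card_cartesian_product power2_eq_square mult_le_mono)
    finally show "card {a \<in> A. m a = p} \<le> n\<^sup>2" .
  qed
  also have "\<dots> \<le> n\<^sup>2 * card {(eval2 R R id y z G, eval2 R R id y z Q) | y z. y \<in> Y \<and> z \<in> Z}"
  proof (intro mult_le_mono order_refl card_mono)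
    have "{(eval2 R R id y z G, eval2 R R id y z Q) | y z. y \<in> Y \<and> z \<in> Z} = m ` (Y \<times> Z)" by (auto simp: m_def)
    then show "finite {(eval2 R R id y z G, eval2 R R id y z Q) | y z. y \<in> Y \<and> z \<in> Z}" using fin by simp
    show "m ` A \<subseteq> {(eval2 R R id y z G, eval2 R R id y z Q) | y z. y \<in> Y \<and> z \<in> Z}"
      using A by (auto simp: m_def)
  qed
  finally have good: "card A \<le> n\<^sup>2 * card {(eval2 R R id y z G, eval2 R R id y z Q) | y z. y \<in> Y \<and> z \<in> Z}" .
  let ?B = "{(y, z). y \<in> Y \<and> z \<in> Z \<and> eval2 R R id y z D = \<zero>\<^bsub>R\<^esub>}"
  have "Y \<times> Z = ?B \<union> A" by (auto simp: A_def)
  then have "card (Y \<times> Z) \<le> card ?B + card A" by (simp only: card_Un_le)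
  then show ?thesis using bad good by (simp add: card_cartesian_product)
qed

text \<open>Degrees are controlled for the coefficients of the composite polynomial only. A mixed
  monomial of \<open>F\<close> with exponents \<open>i\<close> of x and \<open>k\<close> of G gives
  \<open>k\<close> times the degree of \<open>G\<close> at most \<open>d\<close>, which bounds both
  factors since \<open>G\<close> is not constant. For \<open>i > d\<close> the slice vanishes, and
  the same inequality would make \<open>G\<close> constant.\<close>

lemma composite_degrees:
  assumes R: "field R" and FGH: "F \<in> carrier (UP2 R)" "G \<in> carrier (UP2 R)" "H \<in> carrier (UP2 R)"
    and J: "J \<in> carrier (UP R)" and P: "composite_poly R F G H J \<in> carrier (UP3 R)"
    and d: "total_deg3 R (composite_poly R F G H J) = d"
    and nd: "\<not> diagonal2 R F" and indep: "alg_independent2 R G H"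
  shows "G \<in> bideg_le R d" "H \<oplus>\<^bsub>UP2 R\<^esub> slice R F G J 0 \<in> bideg_le R d" "mixed_part R F \<in> bideg_le R d"
proof -
  interpret R: field R by fact
  have cr: "cring R" by (rule R.is_cring)
  interpret U2: cring "UP2 R" by (intro cring_UP cr)
  obtain M where M: "F \<in> bideg_le R M" using FGH(1) by (rule bideg_le_obtain)
  note cs = composite_poly_slice[OF cr FGH J] and sc = slice_expand(2)[OF cr M FGH(2) J]
  have bound: "i + j + k \<le> d" if "composite_poly R F G H J k j i \<noteq> \<zero>\<^bsub>R\<^esub>" for i j k
    using total_deg3_bound[OF P that] d by simp
  have zero: "composite_poly R F G H J k j i = \<zero>\<^bsub>R\<^esub>" if "d < i \<or> d < j \<or> d < k" for i j k
    using bound[of k j i] that by linarith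
  have slice_zero: "slice R F G J i k j = \<zero>\<^bsub>R\<^esub>" if "0 < i" "d < i \<or> d < j \<or> d < k" for i j k
    using zero[OF that(2)] cs(1)[OF that(1)] by simp
  have slice_d: "slice R F G J i \<in> bideg_le R d" if "0 < i" for i
    unfolding bideg_le_def using UP2_carrierD[OF sc] slice_zero[OF that] by auto
  have slice_0: "slice R F G J i \<in> bideg_le R 0" if "d < i" for i
    unfolding bideg_le_def using UP2_carrierD[OF sc] slice_zero[of i] that by auto
  have Qc: "H \<oplus>\<^bsub>UP2 R\<^esub> slice R F G J 0 \<in> carrier (UP2 R)" using FGH(3) sc by simp
  show "H \<oplus>\<^bsub>UP2 R\<^esub> slice R F G J 0 \<in> bideg_le R d"
    unfolding bideg_le_def using UP2_carrierD[OF Qc] zero[of 0, unfolded cs(2)] by auto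
  have pos: "\<not> (deg (UP R) G = 0 \<and> deg (UP R) (swap2 G) = 0)"
    using bideg_le_degI[OF cr FGH(2), of 0] alg_independent2_nonconstant[OF R FGH(2,3) indep] by auto
  have index: "k \<le> d \<and> i \<le> d" if ki: "0 < k" "0 < i" "F k i \<noteq> \<zero>\<^bsub>R\<^esub>" for k i
  proof -
    note sd = slice_degree[OF R FGH(1,2) J ki(1,3)]
    have "k \<le> k * deg (UP R) G \<or> k \<le> k * deg (UP R) (swap2 G)" using pos by auto
    then have "k \<le> d" using sd[OF slice_d[OF ki(2)]] by linarith
    moreover have "\<not> d < i" using sd[OF slice_0[of i]] pos ki(1) by auto
    ultimately show ?thesis by simp
  qed
  obtain k i where ki: "0 < k" "0 < i" "F k i \<noteq> \<zero>\<^bsub>R\<^esub>" using not_diagonal2[OF cr FGH(1) nd] by blast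
  have k_le: "x \<le> k * x" for x using ki(1) by simp
  show "G \<in> bideg_le R d"
    using slice_degree[OF R FGH(1,2) J ki(1,3) slice_d[OF ki(2)]] k_le
    by (intro bideg_le_degI[OF cr FGH(2)]) (meson order_trans)+
  have "mixed_part R F k i = \<zero>\<^bsub>R\<^esub>" if "k > d \<or> i > d" for k i
  proof (rule ccontr)
    assume "mixed_part R F k i \<noteq> \<zero>\<^bsub>R\<^esub>"
    then have *: "0 < k" "0 < i" "F k i \<noteq> \<zero>\<^bsub>R\<^esub>" by (auto simp: mixed_part_def split: if_splits)
    show False using index[OF *] that by linarith
  qed
  then show "mixed_part R F \<in> bideg_le R d"
    using UP2_carrierD[OF mixed_part_decomposition(1)[OF cr FGH(1)]] by (simp add: bideg_le_def)
qed

text \<open>The set \<open>Pts\<close> of pairs (a, b) is put into the incidence bound with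
  \<open>W\<close> as the set of missed values. The factor 2 d of that bound and the loss of
  \<open>2 * n\<^sup>2\<close> between \<open>Pts\<close> and \<open>Y \<times> Z\<close> make up
  the constant \<open>4 * d * n\<^sup>2\<close>.\<close>

lemma missing_values_bound:
  fixes R :: "'a ring" and d :: nat
  defines "n \<equiv> (2 * d + 1)\<^sup>2"
  assumes R: "field R" "finite (carrier R)"
    and FGH: "F \<in> carrier (UP2 R)" "G \<in> carrier (UP2 R)" "H \<in> carrier (UP2 R)" and J: "J \<in> carrier (UP R)"
    and P: "composite_poly R F G H J \<in> carrier (UP3 R)" "total_deg3 R (composite_poly R F G H J) = d"
    and nd: "\<not> diagonal2 R F" and char: "total_deg2 R F < ring_char R" and indep: "alg_independent2 R G H"
    and XYZ: "X \<subseteq> carrier R" "Y \<subseteq> carrier R" "Z \<subseteq> carrier R"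
    and large: "16 * n * d \<le> card Y" "16 * n * d \<le> card Z"
  shows "real (card (carrier R - value_set3 R (composite_poly R F G H J) X Y Z)) * (real (card X) * real (card Y) * real (card Z))
    \<le> 4 * real d * (real n)\<^sup>2 * (real (order R) ^ 3 * sqrt (real (order R)))"
proof -
  interpret R: field R by fact
  have cr: "cring R" by (rule R.is_cring)
  note id = id_hom[OF cr]
  obtain M where M: "F \<in> bideg_le R M" using FGH(1) by (rule bideg_le_obtain)
  define Q where "Q = H \<oplus>\<^bsub>UP2 R\<^esub> slice R F G J 0"
  let ?p0 = "swap2 F 0 \<oplus>\<^bsub>UP R\<^esub> up_ring.monom (UP R) (J 0) 0"
  have p0: "?p0 \<in> carrier (UP R)" by (rule slice_expand(1)[OF cr M FGH(2) J])
  have sc: "slice R F G J 0 \<in> carrier (UP2 R)" by (rule slice_expand(2)[OF cr M FGH(2) J])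
  note deg = composite_degrees[OF R(1) FGH J P nd indep, folded Q_def]
  have "alg_independent2 R G Q"
    unfolding Q_def slice_def by (rule alg_independent2_shear[OF cr FGH(2,3) p0 indep])
  then have count: "card Y * card Z \<le> 4 * n * d * (card Y + card Z) +
    n\<^sup>2 * card {(eval2 R R id y z G, eval2 R R id y z Q) | y z. y \<in> Y \<and> z \<in> Z}"
    unfolding n_def by (intro independent_image_bound R deg XYZ)
  define Pts where "Pts = {(eval2 R R id y z G, eval2 R R id y z Q) | y z. y \<in> Y \<and> z \<in> Z}"
  define V where "V = value_set3 R (composite_poly R F G H J) X Y Z"
  define W where "W = carrier R - V"
  let ?h = "\<lambda>i. if i = 0 then \<zero>\<^bsub>R\<^esub> else F 0 i"
  define s where "s x = UnivPoly.eval R R id x ?h \<oplus>\<^bsub>R\<^esub> UnivPoly.eval R R id x J" for x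
  \<comment> \<open>The value \<open>J 0\<close> is already contained in \<open>Q\<close> through
    its slice, so it is taken away here.\<close>
  define J' where "J' x = s x \<ominus>\<^bsub>R\<^esub> J 0" for x
  note parts = mixed_part_decomposition[OF cr FGH(1)]
  have J0: "J 0 \<in> carrier R" using J by (rule UP_carrierD)
  have ev: "UnivPoly.eval R R id t p \<in> carrier R" if "t \<in> carrier R" "p \<in> carrier (UP R)" for t p
    using ring_hom_cring_closed[OF eval_hom[OF id that(1)] that(2)] .
  have ev2: "eval2 R R id y z p \<in> carrier R" if "y \<in> carrier R" "z \<in> carrier R" "p \<in> carrier (UP2 R)" for y z p
    using ring_hom_cring_closed[OF eval2_hom[OF id that(1,2)] that(3)] .
  have Qc: "Q \<in> carrier (UP2 R)" using deg(2) by (rule bideg_le_closed)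
  have sx: "s x \<in> carrier R" if "x \<in> carrier R" for x
    unfolding s_def using ev[OF that] parts(2) J by (intro R.a_closed)
  have J': "J' \<in> carrier R \<rightarrow> carrier R" unfolding J'_def using sx J0 by auto
  have Pts: "Pts \<subseteq> carrier R \<times> carrier R"
    unfolding Pts_def using XYZ(2,3) ev2 FGH(2) Qc by blast
  let ?f = "\<lambda>i k. mixed_part R F k i"
  obtain k1 i1 where ki: "0 < k1" "0 < i1" "F k1 i1 \<noteq> \<zero>\<^bsub>R\<^esub>" using not_diagonal2[OF cr FGH(1) nd] by blast
  have nz: "?f i1 k1 \<noteq> \<zero>\<^bsub>R\<^esub>" using ki by (simp add: mixed_part_def)
  have f: "\<forall>i k. ?f i k \<in> carrier R \<and> (?f i k \<noteq> \<zero>\<^bsub>R\<^esub> \<longrightarrow>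
    i \<in> {1..d} \<and> k \<in> {1..d} \<and> [k] \<cdot>\<^bsub>R\<^esub> \<one>\<^bsub>R\<^esub> \<noteq> \<zero>\<^bsub>R\<^esub>)"
  proof (intro allI conjI impI)
    fix i k
    show "?f i k \<in> carrier R" using deg(3) by (simp add: bideg_le_def)
    assume ne: "?f i k \<noteq> \<zero>\<^bsub>R\<^esub>"
    then have *: "0 < k" "0 < i" "F k i \<noteq> \<zero>\<^bsub>R\<^esub>" by (auto simp: mixed_part_def split: if_splits)
    have "\<not> (k > d \<or> i > d)" using deg(3) ne unfolding bideg_le_def by blast
    then show "i \<in> {1..d}" "k \<in> {1..d}" using * by auto
    show "[k] \<cdot>\<^bsub>R\<^esub> \<one>\<^bsub>R\<^esub> \<noteq> \<zero>\<^bsub>R\<^esub>"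
      using total_deg2_bound[OF FGH(1) *(3)] char *(1) by (intro less_ring_char) auto
  qed
  have none: "\<forall>x\<in>X. \<forall>(a, b)\<in>Pts. carrier_mixed_form R d ?f x a \<oplus>\<^bsub>R\<^esub> b \<oplus>\<^bsub>R\<^esub> J' x \<notin> W"
  proof clarify
    fix x a b assume x: "x \<in> X" and ab: "(a, b) \<in> Pts" and inW: "carrier_mixed_form R d ?f x a \<oplus>\<^bsub>R\<^esub> b \<oplus>\<^bsub>R\<^esub> J' x \<in> W"
    obtain y z where yz: "y \<in> Y" "z \<in> Z" and a: "a = eval2 R R id y z G" and b: "b = eval2 R R id y z Q"
      using ab unfolding Pts_def by blast
    have c: "x \<in> carrier R" "y \<in> carrier R" "z \<in> carrier R" using x yz XYZ by auto
    have ac: "a \<in> carrier R" unfolding a using c FGH(2) by (intro ev2)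
    have v: "ring_hom_cring (UP2 R) R (eval2 R R id y z)" by (rule eval2_hom[OF id c(2,3)])
    interpret v: ring_hom_cring "UP2 R" R "eval2 R R id y z" by (rule v)
    interpret w: ring_hom_cring "UP R" R "UnivPoly.eval R R id a" by (rule eval_hom[OF id ac])
    define h where "h = eval2 R R id y z H"
    define m where "m = carrier_mixed_form R d ?f x a"
    define fa where "fa = UnivPoly.eval R R id a (swap2 F 0)"
    define fx where "fx = UnivPoly.eval R R id x ?h"
    define j where "j = UnivPoly.eval R R id x J"
    define u where "u = J' x"
    note mixed = eval2_mixed_part[OF cr FGH(1) deg(3) c(1) ac]
    have cl: "h \<in> carrier R" "m \<in> carrier R" "fa \<in> carrier R" "fx \<in> carrier R" "j \<in> carrier R" "u \<in> carrier R"
      unfolding h_def m_def fa_def fx_def j_def u_def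
      using ev2[OF c(2,3) FGH(3)] mixed(2) ev[OF ac parts(3)] ev[OF c(1) parts(2)] ev[OF c(1) J] J' c(1) by auto
    have "eval2 R R id y z (slice R F G J 0) = UnivPoly.eval R R id a ?p0"
      unfolding slice_def a
      using eval_natural[OF const2_hom[OF cr] v FGH(2) p0, of id] by (simp add: eval2_const[OF id c(2,3)])
    also have "\<dots> = fa \<oplus>\<^bsub>R\<^esub> J 0"
      unfolding fa_def using w.hom_add[OF parts(3) UP_monom_closed[OF cr J0]]
      by (simp add: eval_const_gen[OF id ac J0])
    finally have b_eq: "b = h \<oplus>\<^bsub>R\<^esub> (fa \<oplus>\<^bsub>R\<^esub> J 0)"
      unfolding b h_def Q_def using v.hom_add[OF FGH(3) sc] by simp
    have "J 0 \<oplus>\<^bsub>R\<^esub> u = s x"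
    proof -
      have "J 0 \<oplus>\<^bsub>R\<^esub> (s x \<oplus>\<^bsub>R\<^esub> \<ominus>\<^bsub>R\<^esub> J 0) = s x \<oplus>\<^bsub>R\<^esub> (J 0 \<oplus>\<^bsub>R\<^esub> \<ominus>\<^bsub>R\<^esub> J 0)"
        using J0 sx[OF c(1)] by (intro R.a_lcomm) auto
      then show ?thesis unfolding u_def J'_def a_minus_def using J0 sx[OF c(1)] by (simp add: R.r_neg)
    qed
    then have ju: "J 0 \<oplus>\<^bsub>R\<^esub> u = fx \<oplus>\<^bsub>R\<^esub> j" by (simp only: s_def fx_def j_def)
    have "m \<oplus>\<^bsub>R\<^esub> b \<oplus>\<^bsub>R\<^esub> u = m \<oplus>\<^bsub>R\<^esub> (h \<oplus>\<^bsub>R\<^esub> (fa \<oplus>\<^bsub>R\<^esub> (J 0 \<oplus>\<^bsub>R\<^esub> u)))"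
      unfolding b_eq using cl J0 by (simp add: R.a_assoc)
    also have "\<dots> = m \<oplus>\<^bsub>R\<^esub> (fx \<oplus>\<^bsub>R\<^esub> fa) \<oplus>\<^bsub>R\<^esub> h \<oplus>\<^bsub>R\<^esub> j"
      unfolding ju using cl by (simp add: R.a_ac)
    also have "\<dots> = eval3 R R id x y z (composite_poly R F G H J)"
      unfolding eval3_composite_poly[OF cr FGH J c] a[symmetric] mixed(1) m_def fx_def fa_def h_def j_def ..
    finally have "m \<oplus>\<^bsub>R\<^esub> b \<oplus>\<^bsub>R\<^esub> u \<in> V" unfolding V_def value_set3_def using x yz by blast
    then show False using inW unfolding m_def u_def W_def by blast
  qed
  have W: "W \<subseteq> carrier R" by (auto simp: W_def)
  have inc: "real (card X) * real (card W) * real (card Pts) \<le> 2 * real d * real (order R) ^ 3 * sqrt (real (order R))"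
    by (rule incidence_property_finite_field[OF R, unfolded incidence_property_def, THEN spec, of d, THEN spec, of ?f,
      THEN spec, of i1, THEN spec, of k1, THEN spec, of X, THEN spec, of W, THEN spec, of Pts, THEN spec, of J',
      THEN mp, OF nz, THEN mp, OF f, THEN mp, OF XYZ(1), THEN mp, OF W, THEN mp, OF Pts, THEN mp, OF J', THEN mp, OF none])
  \<comment> \<open>The threshold 16 n d makes the exceptional term at most half of
    \<open>card Y * card Z\<close>; the other half is bounded by
    \<open>n\<^sup>2 * card Pts\<close>.\<close>
  have "16 * n * d * card Z \<le> card Y * card Z" "16 * n * d * card Y \<le> card Y * card Z"
    using large by (auto simp: mult.commute)
  moreover have "4 * (4 * n * d * (card Y + card Z)) = 16 * n * d * card Z + 16 * n * d * card Y"
    by (simp add: algebra_simps)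
  moreover have "yz \<le> 2 * p" if "4 * t = u + v" "u \<le> yz" "v \<le> yz" "yz \<le> t + p" for t u v yz p :: nat
    using that by linarith
  ultimately have "card Y * card Z \<le> 2 * (n\<^sup>2 * card Pts)"
    using count unfolding Pts_def[symmetric] by metis
  then have "real (card Y * card Z) \<le> real (2 * (n\<^sup>2 * card Pts))" by (rule of_nat_mono)
  then have yz: "real (card Y) * real (card Z) \<le> 2 * (real n)\<^sup>2 * real (card Pts)" by simp
  have "real (card W) * (real (card X) * real (card Y) * real (card Z)) =
    real (card X) * real (card W) * (real (card Y) * real (card Z))" by (simp add: mult_ac)
  also have "\<dots> \<le> real (card X) * real (card W) * (2 * (real n)\<^sup>2 * real (card Pts))"
    using yz by (rule mult_left_mono) simp
  also have "\<dots> = 2 * (real n)\<^sup>2 * (real (card X) * real (card W) * real (card Pts))" by (simp add: mult_ac)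
  also have "\<dots> \<le> 2 * (real n)\<^sup>2 * (2 * real d * real (order R) ^ 3 * sqrt (real (order R)))"
    using inc by (rule mult_left_mono) simp
  also have "\<dots> = 4 * real d * (real n)\<^sup>2 * (real (order R) ^ 3 * sqrt (real (order R)))" by (simp add: mult_ac)
  finally show ?thesis unfolding W_def V_def .
qed

theorem theorem1p4:
  fixes d :: nat
  shows "\<exists>C::real. C > 0 \<and> (\<exists>C'::real. C' > 0 \<and>
    (\<forall>(R :: 'a ring) F G H J P X Y Z.
       field R \<longrightarrow> finite (carrier R) \<longrightarrow>
       F \<in> carrier (UP2 R) \<longrightarrow> G \<in> carrier (UP2 R) \<longrightarrow> H \<in> carrier (UP2 R) \<longrightarrow>
       J \<in> carrier (UP R) \<longrightarrow> P \<in> carrier (UP3 R) \<longrightarrow>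
       P = composite_poly R F G H J \<longrightarrow>
       total_deg3 R P = d \<longrightarrow>
       \<not> diagonal2 R F \<longrightarrow> symmetric2 R F \<longrightarrow> total_deg2 R F < ring_char R \<longrightarrow>
       alg_independent2 R G H \<longrightarrow>
       X \<subseteq> carrier R \<longrightarrow> Y \<subseteq> carrier R \<longrightarrow> Z \<subseteq> carrier R \<longrightarrow>
       real (card X) \<ge> C * sqrt (real (order R)) \<longrightarrow>
       real (card Y) \<ge> C * sqrt (real (order R)) \<longrightarrow>
       real (card Z) \<ge> C * sqrt (real (order R)) \<longrightarrow>
       \<bar>real (card (value_set3 R P X Y Z)) - real (order R)\<bar>
         \<le> C' * (real (order R) powr (11/3) / (real (card X) * real (card Y) * real (card Z)))))"
proof -
  \<comment> \<open>\<open>n\<close> is the fibre bound of each coordinate and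
    \<open>16 * n * d\<close> the threshold for the sizes of \<open>Y\<close> and \<open>Z\<close>.
    The added 1 keeps both constants positive for \<open>d = 0\<close>, and a positive
    \<open>C\<close> makes the three sets nonempty, so the final division is legitimate.\<close>
  define n where "n = (2 * d + 1)\<^sup>2"
  define C where "C = real (16 * n * d + 1)"
  define C' where "C' = 4 * real d * (real n)\<^sup>2 + 1"
  have "C > 0" unfolding C_def of_nat_0_less_iff by simp
  moreover have "C' > 0" unfolding C'_def by (intro add_nonneg_pos) auto
  ultimately have pos: "C > 0" "C' > 0" .
  show ?thesis
  proof (rule exI[of _ C], rule conjI[OF pos(1)], rule exI[of _ C'], rule conjI[OF pos(2)], intro allI impI)
    fix R :: "'a ring" and F G H J P X Y Z
    assume R: "field R" "finite (carrier R)"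
      and FGH: "F \<in> carrier (UP2 R)" "G \<in> carrier (UP2 R)" "H \<in> carrier (UP2 R)" and J: "J \<in> carrier (UP R)"
      and P: "P \<in> carrier (UP3 R)" "P = composite_poly R F G H J" "total_deg3 R P = d"
      and nd: "\<not> diagonal2 R F" and char: "total_deg2 R F < ring_char R" and indep: "alg_independent2 R G H"
      and XYZ: "X \<subseteq> carrier R" "Y \<subseteq> carrier R" "Z \<subseteq> carrier R"
      and large: "real (card X) \<ge> C * sqrt (real (order R))" "real (card Y) \<ge> C * sqrt (real (order R))"
        "real (card Z) \<ge> C * sqrt (real (order R))"
    interpret R: field R by fact
    define q where "q = real (order R)"
    have "0 < order R" unfolding Coset.order_def card_gt_0_iff using R(2) R.zero_closed by blast
    then have q: "1 \<le> q" by (simp add: q_def)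
    have "C * 1 \<le> C * sqrt q" using q pos(1) by (intro mult_left_mono) auto
    then have cards: "C \<le> real (card X)" "C \<le> real (card Y)" "C \<le> real (card Z)"
      using large unfolding q_def by linarith+
    then have large': "16 * n * d \<le> card Y" "16 * n * d \<le> card Z" unfolding C_def of_nat_le_iff by linarith+
    let ?V = "value_set3 R P X Y Z"
    have bound: "real (card (carrier R - ?V)) * (real (card X) * real (card Y) * real (card Z))
      \<le> 4 * real d * (real n)\<^sup>2 * (q ^ 3 * sqrt q)"
      unfolding P(2) q_def n_def
      by (rule missing_values_bound[OF R FGH J P(1,3)[unfolded P(2)] nd char indep XYZ large'[unfolded n_def]])
    have "?V \<subseteq> carrier R"
    proof
      fix v assume "v \<in> ?V"
      then obtain x y z where "x \<in> X" "y \<in> Y" "z \<in> Z" "v = eval3 R R id x y z P"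
        unfolding value_set3_def by blast
      then show "v \<in> carrier R"
        using ring_hom_cring_closed[OF eval3_hom[OF id_hom[OF R.is_cring]] P(1), of x y z] XYZ by blast
    qed
    \<comment> \<open>As all values lie in the field, the distance from \<open>q\<close> is the
      number of missed values.\<close>
    then have "card (carrier R - ?V) + card ?V = order R"
      unfolding Coset.order_def using R(2) card_mono[OF R(2)] by (simp add: card_Diff_subset finite_subset)
    then have "\<bar>real (card ?V) - q\<bar> = real (card (carrier R - ?V))" unfolding q_def by linarith
    also have "\<dots> \<le> 4 * real d * (real n)\<^sup>2 * (q ^ 3 * sqrt q) / (real (card X) * real (card Y) * real (card Z))"
      using bound cards pos(1) by (subst pos_le_divide_eq) auto
    also have "\<dots> \<le> C' * q powr (11/3) / (real (card X) * real (card Y) * real (card Z))"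
    proof (intro divide_right_mono mult_mono)
      \<comment> \<open>The exponent reached is 7/2, which is below 11/3, and \<open>q\<close> is at
        least 1.\<close>
      have "q powr real 3 = q ^ 3" using q by (intro powr_realpow) auto
      moreover have "q powr (1/2) = sqrt q" using q by (intro powr_half_sqrt) auto
      ultimately have "q ^ 3 * sqrt q = q powr (real 3 + 1/2)" by (simp only: powr_add)
      also have "\<dots> \<le> q powr (11/3)" using q by (intro powr_mono) auto
      finally show "q ^ 3 * sqrt q \<le> q powr (11/3)" .
    qed (use q pos(2) in \<open>auto simp: C'_def\<close>)
    finally show "\<bar>real (card ?V) - real (order R)\<bar>
      \<le> C' * (real (order R) powr (11/3) / (real (card X) * real (card Y) * real (card Z)))"
      by (simp add: q_def)
  qed
qed

end
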